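(* Let $(M,\xi)$ be a contact 3-manifold equipped with a compatible metric $g$, where $\alpha$, $J$, $\theta'$ and $X_\alpha$ are the corresponding contact form, complex structure, instantaneous rotation and Reeb vector field, respectively. Then for any unit vector $e\in\xi$: $$k(e,X_\alpha)=g(Je,\nabla_eX_\alpha)^2-g(e,\nabla_eX_\alpha)^2-\frac{\partial}{\partial t}g(e(t),\nabla_{e(t)}X_\alpha)\Big|_{t=0},$$ where $e(t):=\frac{\tilde e(t)}{|\tilde e(t)|}$ and $\tilde e(t)$ is the unique (locally defined) $\alpha$-Jacobi field with $\tilde e(0)=e$. Moreover, $$Ricci(X_\alpha):=k(e,X_\alpha)+k(Je,X_\alpha)=2G(\xi)\le\frac{\theta'^2}{2},$$ where $G(\xi)$ is the extrinsic curvature of $\xi$.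
   Context: $M$ is a closed, connected, oriented 3-manifold; all objects are smooth. A (positive) contact form is a 1-form $\alpha$ with $\alpha\wedge d\alpha>0$; $\xi=\ker\alpha$ is a contact structure. Convention: $d\alpha(u,v)=u(\alpha(v))-v(\alpha(u))-\alpha([u,v])$. The Reeb vector field $X_\alpha$ is the unique vector field with $d\alpha(X_\alpha,\cdot)=0$, $\alpha(X_\alpha)=1$. A Riemannian metric $g$ is compatible with $(M,\xi)$ if $g(u,v)=\frac{1}{\theta'}d\alpha(u,Jv)+\alpha(u)\alpha(v)$ for all $u,v\in TM$, where $\alpha$ is a contact form for $\xi$, $\theta'$ is a positive constant (the instantaneous rotation), and $J$ is a complex structure on $\xi$ (with $d\alpha(u,Ju)>0$ for $0\ne u\in\xi$), extended to $TM$ by first projecting to $\xi$ along $X_\alpha$. $\nabla$ is the Levi-Civita connection of $g$ and $k(u,v)$ is the sectional curvature of the plane spanned by $u,v$. $\alpha$-Jacobi field: for $e\in\xi_p$, the $\alpha$-Jacobi field with initial value $e$ is the vector field $\tilde e(t)=(\phi_t)_*e$ along the flow line $t\mapsto\phi_t(p)$, where $\phi_t$ is the flow of $X_\alpha$; equivalently, it is the Jacobi field along the geodesic $t\mapsto\phi_t(p)$ with $\tilde e(0)=e$ and $\nabla_{X_\alpha}\tilde e=\nabla_{\tilde e}X_\alpha$. The second fundamental form of $\xi$ is $\mathbb{II}(u,v)=g(\nabla_uv,n)$ for $u,v\in\xi$ (sections of $\xi$), where $n=X_\alpha$ is the unit normal of $\xi$ (not symmetric in general); the extrinsic curvature is $G(\xi)=\det(\mathbb{II})$,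 the determinant of its matrix in an orthonormal basis of $\xi$. *)

theory Defs
  imports "HOL-Analysis.Analysis" "HOL-Library.Function_Algebras"
begin

section \<open>Smooth maps between Euclidean spaces\<close>

text \<open>Only meaningful for open \<open>S\<close>: derivatives are full (two-sided) Frechet derivatives,
  and \<open>C\<^sup>k\<close> is expressed through iterated partial derivatives.\<close>

primrec Ck_on :: "nat \<Rightarrow> 'a::euclidean_space set \<Rightarrow> ('a \<Rightarrow> 'b::real_normed_vector) \<Rightarrow> bool" where
  "Ck_on 0 S f \<longleftrightarrow> continuous_on S f"
| "Ck_on (Suc k) S f \<longleftrightarrow>
     (\<forall>x\<in>S. f differentiable (at x)) \<and>
     (\<forall>i\<in>Basis. Ck_on k S (\<lambda>x. frechet_derivative f (at x) i))"

definition Cinf_on :: "'a::euclidean_space set \<Rightarrow> ('a \<Rightarrow> 'b::real_normed_vector) \<Rightarrow> bool" where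
  "Cinf_on S f \<longleftrightarrow> (\<forall>k. Ck_on k S f)"


section \<open>Closed oriented 3-manifolds\<close>

text \<open>The manifold is the whole type \<open>'m\<close>. A chart is a pair of its (open) domain and the
  coordinate map, whose values outside the domain are irrelevant.\<close>

type_synonym 'm chart = "'m set \<times> ('m \<Rightarrow> real^3)"

definition oriented_atlas :: "('m::t2_space) chart set \<Rightarrow> bool" where
  "oriented_atlas A \<longleftrightarrow>
     (\<Union>(U,\<psi>)\<in>A. U) = UNIV \<and>
     (\<forall>(U,\<psi>)\<in>A. open U \<and> open (\<psi> ` U) \<and> homeomorphism U (\<psi> ` U) \<psi> (inv_into U \<psi>)) \<and>
     (\<forall>(U,\<psi>)\<in>A. \<forall>(U',\<psi>')\<in>A.
        Cinf_on (\<psi> ` (U \<inter> U')) (\<psi>' \<circ> inv_into U \<psi>) \<and>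
        (\<forall>x\<in>\<psi> ` (U \<inter> U'). 0 < det (matrix (frechet_derivative (\<psi>' \<circ> inv_into U \<psi>) (at x)))))"

text \<open>Second countability is automatic for a compact locally Euclidean space.\<close>

definition closed_connected_oriented_3manifold :: "('m::t2_space) chart set \<Rightarrow> bool" where
  "closed_connected_oriented_3manifold A \<longleftrightarrow>
     oriented_atlas A \<and> compact (UNIV :: 'm set) \<and> connected (UNIV :: 'm set)"

definition smooth_fun_on :: "('m::t2_space) chart set \<Rightarrow> 'm set \<Rightarrow> ('m \<Rightarrow> real) \<Rightarrow> bool" where
  "smooth_fun_on A W f \<longleftrightarrow> (\<forall>(U,\<psi>)\<in>A. Cinf_on (\<psi> ` (U \<inter> W)) (f \<circ> inv_into U \<psi>))"

definition smooth_fun_at :: "('m::t2_space) chart set \<Rightarrow> 'm \<Rightarrow> ('m \<Rightarrow> real) \<Rightarrow> bool" where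
  "smooth_fun_at A p f \<longleftrightarrow> (\<exists>W. open W \<and> p \<in> W \<and> smooth_fun_on A W f)"


section \<open>Tangent vectors and vector fields\<close>

text \<open>A tangent vector at \<open>p\<close> is a derivation of the algebra of germs at \<open>p\<close> of smooth functions.
  It is applied to arbitrary total functions; the value 0 on functions that are not smooth
  near \<open>p\<close> makes the representation unique. Sums and differences of tangent
  vectors, vector fields and functions are the pointwise ones of
  \<^theory>\<open>HOL-Library.Function_Algebras\<close>.\<close>

type_synonym 'm tvec = "('m \<Rightarrow> real) \<Rightarrow> real"
type_synonym 'm vfield = "'m \<Rightarrow> 'm tvec"

definition scalev :: "real \<Rightarrow> 'm tvec \<Rightarrow> 'm tvec" where
  "scalev c v = (\<lambda>f. c * v f)"

definition scalef :: "('m \<Rightarrow> real) \<Rightarrow> 'm vfield \<Rightarrow> 'm vfield" where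
  "scalef f X = (\<lambda>q. scalev (f q) (X q))"

definition tangent :: "('m::t2_space) chart set \<Rightarrow> 'm \<Rightarrow> 'm tvec set" where
  "tangent A p = {v.
     (\<forall>f g. smooth_fun_at A p f \<longrightarrow> smooth_fun_at A p g \<longrightarrow>
        (eventually (\<lambda>q. f q = g q) (nhds p) \<longrightarrow> v f = v g) \<and>
        v (f + g) = v f + v g \<and>
        v (f * g) = v f * g p + f p * v g) \<and>
     (\<forall>c f. smooth_fun_at A p f \<longrightarrow> v (\<lambda>q. c * f q) = c * v f) \<and>
     (\<forall>f. \<not> smooth_fun_at A p f \<longrightarrow> v f = 0)}"

definition vfield_on :: "('m::t2_space) chart set \<Rightarrow> 'm set \<Rightarrow> 'm vfield \<Rightarrow> bool" where
  "vfield_on A W X \<longleftrightarrow>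
     (\<forall>q\<in>W. X q \<in> tangent A q) \<and>
     (\<forall>V f. open V \<longrightarrow> V \<subseteq> W \<longrightarrow> smooth_fun_on A V f \<longrightarrow> smooth_fun_on A V (\<lambda>q. X q f))"

definition vfield_at :: "('m::t2_space) chart set \<Rightarrow> 'm \<Rightarrow> 'm vfield \<Rightarrow> bool" where
  "vfield_at A p X \<longleftrightarrow> (\<exists>W. open W \<and> p \<in> W \<and> vfield_on A W X)"

definition bracket :: "('m::t2_space) chart set \<Rightarrow> 'm vfield \<Rightarrow> 'm vfield \<Rightarrow> 'm vfield" where
  "bracket A X Y = (\<lambda>p f. if smooth_fun_at A p f
       then X p (\<lambda>q. Y q f) - Y p (\<lambda>q. X q f) else 0)"

text \<open>An arbitrary smooth local extension of a tangent vector. It is only used inside tensorial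
  expressions, which do not depend on the choice.\<close>

definition ext :: "('m::t2_space) chart set \<Rightarrow> 'm \<Rightarrow> 'm tvec \<Rightarrow> 'm vfield" where
  "ext A p v = (SOME V. vfield_at A p V \<and> V p = v)"

definition pos_oriented :: "('m::t2_space) chart set \<Rightarrow> 'm \<Rightarrow> 'm tvec \<Rightarrow> 'm tvec \<Rightarrow> 'm tvec \<Rightarrow> bool" where
  "pos_oriented A p u v w \<longleftrightarrow>
     (\<forall>(U,\<psi>)\<in>A. p \<in> U \<longrightarrow>
        0 < det (vector [\<chi> i. u (\<lambda>q. \<psi> q $ i), \<chi> i. v (\<lambda>q. \<psi> q $ i), \<chi> i. w (\<lambda>q. \<psi> q $ i)]
                 :: real^3^3))"


section \<open>Contact forms and Reeb vector fields\<close>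

type_synonym 'm form1 = "'m \<Rightarrow> 'm tvec \<Rightarrow> real"

definition one_form :: "('m::t2_space) chart set \<Rightarrow> 'm form1 \<Rightarrow> bool" where
  "one_form A \<alpha> \<longleftrightarrow>
     (\<forall>p. \<forall>u\<in>tangent A p. \<forall>v\<in>tangent A p. \<forall>c.
        \<alpha> p (u + v) = \<alpha> p u + \<alpha> p v \<and> \<alpha> p (scalev c u) = c * \<alpha> p u) \<and>
     (\<forall>W X. open W \<longrightarrow> vfield_on A W X \<longrightarrow> smooth_fun_on A W (\<lambda>q. \<alpha> q (X q)))"

definition ext_deriv :: "('m::t2_space) chart set \<Rightarrow> 'm form1 \<Rightarrow> 'm \<Rightarrow> 'm tvec \<Rightarrow> 'm tvec \<Rightarrow> real" where
  "ext_deriv A \<alpha> p u v = (let U = ext A p u; V = ext A p v in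
     u (\<lambda>q. \<alpha> q (V q)) - v (\<lambda>q. \<alpha> q (U q)) - \<alpha> p (bracket A U V p))"

definition wedge_ext_deriv ::
  "('m::t2_space) chart set \<Rightarrow> 'm form1 \<Rightarrow> 'm \<Rightarrow> 'm tvec \<Rightarrow> 'm tvec \<Rightarrow> 'm tvec \<Rightarrow> real" where
  "wedge_ext_deriv A \<alpha> p u v w =
     \<alpha> p u * ext_deriv A \<alpha> p v w - \<alpha> p v * ext_deriv A \<alpha> p u w + \<alpha> p w * ext_deriv A \<alpha> p u v"

definition contact_form :: "('m::t2_space) chart set \<Rightarrow> 'm form1 \<Rightarrow> bool" where
  "contact_form A \<alpha> \<longleftrightarrow> one_form A \<alpha> \<and>
     (\<forall>p. \<forall>u\<in>tangent A p. \<forall>v\<in>tangent A p. \<forall>w\<in>tangent A p.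
        pos_oriented A p u v w \<longrightarrow> 0 < wedge_ext_deriv A \<alpha> p u v w)"

definition contact_form_for :: "('m::t2_space) chart set \<Rightarrow> ('m \<Rightarrow> 'm tvec set) \<Rightarrow> 'm form1 \<Rightarrow> bool" where
  "contact_form_for A \<xi> \<alpha> \<longleftrightarrow> contact_form A \<alpha> \<and> (\<forall>p. \<xi> p = {v \<in> tangent A p. \<alpha> p v = 0})"

definition contact_structure :: "('m::t2_space) chart set \<Rightarrow> ('m \<Rightarrow> 'm tvec set) \<Rightarrow> bool" where
  "contact_structure A \<xi> \<longleftrightarrow> (\<exists>\<alpha>. contact_form_for A \<xi> \<alpha>)"

definition reeb_field :: "('m::t2_space) chart set \<Rightarrow> 'm form1 \<Rightarrow> 'm vfield \<Rightarrow> bool" where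
  "reeb_field A \<alpha> X \<longleftrightarrow> vfield_on A UNIV X \<and>
     (\<forall>p. \<alpha> p (X p) = 1 \<and> (\<forall>v\<in>tangent A p. ext_deriv A \<alpha> p (X p) v = 0))"


section \<open>Riemannian metrics, Levi-Civita connection, curvature\<close>

type_synonym 'm metric = "'m \<Rightarrow> 'm tvec \<Rightarrow> 'm tvec \<Rightarrow> real"

definition riemannian_metric :: "('m::t2_space) chart set \<Rightarrow> 'm metric \<Rightarrow> bool" where
  "riemannian_metric A g \<longleftrightarrow>
     (\<forall>p. \<forall>u\<in>tangent A p. \<forall>v\<in>tangent A p. \<forall>w\<in>tangent A p. \<forall>c.
        g p (u + v) w = g p u w + g p v w \<and> g p (scalev c u) w = c * g p u w \<and>
        g p u v = g p v u \<and> (u \<noteq> 0 \<longrightarrow> 0 < g p u u)) \<and>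
     (\<forall>W X Y. open W \<longrightarrow> vfield_on A W X \<longrightarrow> vfield_on A W Y \<longrightarrow>
        smooth_fun_on A W (\<lambda>q. g q (X q) (Y q)))"

definition gnorm :: "'m metric \<Rightarrow> 'm \<Rightarrow> 'm tvec \<Rightarrow> real" where
  "gnorm g p v = sqrt (g p v v)"

text \<open>\<open>D p u Y\<close> is the covariant derivative \<open>\<nabla>\<^sub>u Y\<close> at \<open>p\<close>, where \<open>u\<close> is a tangent vector at \<open>p\<close> and
  \<open>Y\<close> a vector field that is smooth near \<open>p\<close>. That it depends only on the germ of \<open>Y\<close> follows
  from the Leibniz rule, as \<open>f\<close> there need only be smooth near \<open>p\<close>.\<close>

type_synonym 'm connection = "'m \<Rightarrow> 'm tvec \<Rightarrow> 'm vfield \<Rightarrow> 'm tvec"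

definition affine_connection :: "('m::t2_space) chart set \<Rightarrow> 'm connection \<Rightarrow> bool" where
  "affine_connection A D \<longleftrightarrow>
     (\<forall>p. \<forall>u\<in>tangent A p. \<forall>v\<in>tangent A p. \<forall>Y Z c f.
        vfield_at A p Y \<longrightarrow> vfield_at A p Z \<longrightarrow> smooth_fun_at A p f \<longrightarrow>
          D p u Y \<in> tangent A p \<and>
          D p (u + v) Y = D p u Y + D p v Y \<and>
          D p (scalev c u) Y = scalev c (D p u Y) \<and>
          D p u (Y + Z) = D p u Y + D p u Z \<and>
          D p u (scalef f Y) = scalev (u f) (Y p) + scalev (f p) (D p u Y)) \<and>
     (\<forall>W U Y. open W \<longrightarrow> vfield_on A W U \<longrightarrow> vfield_on A W Y \<longrightarrow>
        vfield_on A W (\<lambda>q. D q (U q) Y))"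

definition levi_civita :: "('m::t2_space) chart set \<Rightarrow> 'm metric \<Rightarrow> 'm connection \<Rightarrow> bool" where
  "levi_civita A g D \<longleftrightarrow> affine_connection A D \<and>
     (\<forall>p Y Z. vfield_at A p Y \<longrightarrow> vfield_at A p Z \<longrightarrow>
        D p (Y p) Z - D p (Z p) Y = bracket A Y Z p \<and>
        (\<forall>u\<in>tangent A p.
           u (\<lambda>q. g q (Y q) (Z q)) = g p (D p u Y) (Z p) + g p (Y p) (D p u Z)))"

definition curvature ::
  "('m::t2_space) chart set \<Rightarrow> 'm connection \<Rightarrow> 'm vfield \<Rightarrow> 'm vfield \<Rightarrow> 'm vfield \<Rightarrow> 'm vfield" where
  "curvature A D U V W = (\<lambda>p.
     D p (U p) (\<lambda>q. D q (V q) W) - D p (V p) (\<lambda>q. D q (U q) W) - D p (bracket A U V p) W)"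

definition sectional ::
  "('m::t2_space) chart set \<Rightarrow> 'm metric \<Rightarrow> 'm connection \<Rightarrow> 'm \<Rightarrow> 'm tvec \<Rightarrow> 'm tvec \<Rightarrow> real" where
  "sectional A g D p u v = (let U = ext A p u; V = ext A p v in
     g p (curvature A D U V V p) u / (g p u u * g p v v - (g p u v)\<^sup>2))"


section \<open>Compatible metrics\<close>

definition complex_structure_on ::
  "('m::t2_space) chart set \<Rightarrow> ('m \<Rightarrow> 'm tvec set) \<Rightarrow> ('m \<Rightarrow> 'm tvec \<Rightarrow> 'm tvec) \<Rightarrow> bool" where
  "complex_structure_on A \<xi> J \<longleftrightarrow>
     (\<forall>p. \<forall>u\<in>\<xi> p. \<forall>v\<in>\<xi> p. \<forall>c.
        J p u \<in> \<xi> p \<and> J p (u + v) = J p u + J p v \<and> J p (scalev c u) = scalev c (J p u) \<and>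
        J p (J p u) = - u) \<and>
     (\<forall>W V. open W \<longrightarrow> vfield_on A W V \<longrightarrow> (\<forall>q\<in>W. V q \<in> \<xi> q) \<longrightarrow> vfield_on A W (\<lambda>q. J q (V q)))"

text \<open>Extension of \<open>J\<close> to the whole tangent bundle, by first projecting to \<open>\<xi>\<close> along \<open>X\<close>.\<close>

definition J_ext ::
  "'m form1 \<Rightarrow> 'm vfield \<Rightarrow> ('m \<Rightarrow> 'm tvec \<Rightarrow> 'm tvec) \<Rightarrow> 'm \<Rightarrow> 'm tvec \<Rightarrow> 'm tvec" where
  "J_ext \<alpha> X J p v = J p (v - scalev (\<alpha> p v) (X p))"

definition compatible_metric ::
  "('m::t2_space) chart set \<Rightarrow> ('m \<Rightarrow> 'm tvec set) \<Rightarrow> 'm metric \<Rightarrow>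
   'm form1 \<Rightarrow> ('m \<Rightarrow> 'm tvec \<Rightarrow> 'm tvec) \<Rightarrow> real \<Rightarrow> 'm vfield \<Rightarrow> bool" where
  "compatible_metric A \<xi> g \<alpha> J \<theta>' X \<longleftrightarrow>
     riemannian_metric A g \<and> contact_form_for A \<xi> \<alpha> \<and> reeb_field A \<alpha> X \<and> 0 < \<theta>' \<and>
     complex_structure_on A \<xi> J \<and>
     (\<forall>p. \<forall>u\<in>\<xi> p. u \<noteq> 0 \<longrightarrow> 0 < ext_deriv A \<alpha> p u (J p u)) \<and>
     (\<forall>p. \<forall>u\<in>tangent A p. \<forall>v\<in>tangent A p.
        g p u v = 1 / \<theta>' * ext_deriv A \<alpha> p u (J_ext \<alpha> X J p v) + \<alpha> p u * \<alpha> p v)"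


section \<open>Extrinsic curvature of a plane field\<close>

text \<open>The second argument of the second fundamental form has to be extended to a local section of
  \<open>\<xi>\<close>; \<open>n\<close> is the unit normal.\<close>

definition section_ext ::
  "('m::t2_space) chart set \<Rightarrow> ('m \<Rightarrow> 'm tvec set) \<Rightarrow> 'm \<Rightarrow> 'm tvec \<Rightarrow> 'm vfield" where
  "section_ext A \<xi> p v =
     (SOME V. vfield_at A p V \<and> eventually (\<lambda>q. V q \<in> \<xi> q) (nhds p) \<and> V p = v)"

definition second_fundamental_form ::
  "('m::t2_space) chart set \<Rightarrow> ('m \<Rightarrow> 'm tvec set) \<Rightarrow> 'm metric \<Rightarrow> 'm connection \<Rightarrow> 'm vfield \<Rightarrow>
   'm \<Rightarrow> 'm tvec \<Rightarrow> 'm tvec \<Rightarrow> real" where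
  "second_fundamental_form A \<xi> g D n p u v = g p (D p u (section_ext A \<xi> p v)) (n p)"

definition orthonormal_basis :: "('m \<Rightarrow> 'm tvec set) \<Rightarrow> 'm metric \<Rightarrow> 'm \<Rightarrow> (2 \<Rightarrow> 'm tvec) \<Rightarrow> bool" where
  "orthonormal_basis \<xi> g p b \<longleftrightarrow>
     (\<forall>i. b i \<in> \<xi> p) \<and> (\<forall>i j. g p (b i) (b j) = (if i = j then 1 else 0))"

definition extrinsic_curvature ::
  "('m::t2_space) chart set \<Rightarrow> ('m \<Rightarrow> 'm tvec set) \<Rightarrow> 'm metric \<Rightarrow> 'm connection \<Rightarrow> 'm vfield \<Rightarrow>
   'm \<Rightarrow> real" where
  "extrinsic_curvature A \<xi> g D n p = (let b = (SOME b. orthonormal_basis \<xi> g p b) in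
     det (\<chi> i j. second_fundamental_form A \<xi> g D n p (b i) (b j)))"


section \<open>Flows and Jacobi fields\<close>

text \<open>Global flow of \<open>X\<close>, smooth as a map from \<open>\<real> \<times> M\<close> to \<open>M\<close>; it exists since \<open>M\<close> is closed.\<close>

definition flow_of :: "('m::t2_space) chart set \<Rightarrow> 'm vfield \<Rightarrow> (real \<Rightarrow> 'm \<Rightarrow> 'm) \<Rightarrow> bool" where
  "flow_of A X \<phi> \<longleftrightarrow>
     continuous_on UNIV (\<lambda>(t, p). \<phi> t p) \<and>
     (\<forall>(U,\<psi>)\<in>A. \<forall>(U',\<psi>')\<in>A.
        Cinf_on {(t, x). x \<in> \<psi> ` U \<and> \<phi> t (inv_into U \<psi> x) \<in> U'}
          (\<lambda>(t, x). \<psi>' (\<phi> t (inv_into U \<psi> x)))) \<and>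
     (\<forall>p. \<phi> 0 p = p) \<and> (\<forall>s t p. \<phi> (s + t) p = \<phi> s (\<phi> t p)) \<and>
     (\<forall>p t f. smooth_fun_at A (\<phi> t p) f \<longrightarrow>
        ((\<lambda>s. f (\<phi> s p)) has_real_derivative X (\<phi> t p) f) (at t))"

definition pushforward ::
  "('m::t2_space) chart set \<Rightarrow> ('m \<Rightarrow> 'm) \<Rightarrow> 'm \<Rightarrow> 'm tvec \<Rightarrow> 'm tvec" where
  "pushforward A F p v = (\<lambda>f. if smooth_fun_at A (F p) f then v (f \<circ> F) else 0)"

text \<open>The Jacobi field with initial value \<open>e\<close> at \<open>p\<close> along \<open>t \<mapsto> \<phi> t p\<close>, for \<open>\<phi>\<close> the Reeb flow, and
  its normalization; at time \<open>t\<close> both are tangent vectors at \<open>\<phi> t p\<close>.\<close>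

definition jacobi_field ::
  "('m::t2_space) chart set \<Rightarrow> (real \<Rightarrow> 'm \<Rightarrow> 'm) \<Rightarrow> 'm \<Rightarrow> 'm tvec \<Rightarrow> real \<Rightarrow> 'm tvec" where
  "jacobi_field A \<phi> p e t = pushforward A (\<phi> t) p e"

definition unit_jacobi_field ::
  "('m::t2_space) chart set \<Rightarrow> 'm metric \<Rightarrow> (real \<Rightarrow> 'm \<Rightarrow> 'm) \<Rightarrow> 'm \<Rightarrow> 'm tvec \<Rightarrow> real \<Rightarrow> 'm tvec" where
  "unit_jacobi_field A g \<phi> p e t =
     scalev (1 / gnorm g (\<phi> t p) (jacobi_field A \<phi> p e t)) (jacobi_field A \<phi> p e t)"

end

theory Submission
  imports Defs
begin

text \<open>
  Write \<open>S u\<close> for \<open>\<nabla>\<^sub>u X\<close>. Compatibility of the metric makes \<open>\<alpha>\<close> the form \<open>g(X, \<cdot>)\<close>, so \<open>d\<alpha>(u, v)\<close> is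
  \<open>g(S u, v) - g(S v, u)\<close> (lemma \<open>dalpha_eq\<close>). As \<open>X\<close> has length 1, \<open>S\<close> takes values in \<open>\<xi>\<close>, and
  \<open>d\<alpha>(X, \<cdot>) = 0\<close> says that the Reeb orbits are geodesics, \<open>S X = 0\<close>. On \<open>\<xi>\<close>, compatibility says that
  \<open>d\<alpha>\<close> is \<open>\<theta>'\<close> times the area form. Since the Reeb flow preserves \<open>d\<alpha>\<close>, the trace of \<open>S\<close> on \<open>\<xi>\<close>
  vanishes (\<open>trace_S_zero\<close>), and the antisymmetric part of \<open>S\<close> is fixed by \<open>g(S e, J e) - g(S (J e), e) = \<theta>'\<close>.

  For the first formula, extend \<open>e\<close> to any local field \<open>U\<close>. As the connection is metric and torsion
  free and \<open>X\<close> is geodesic, \<open>k(e, X)\<close> equals \<open>- X(g(S U, U)) + g(S e, \<nabla>\<^sub>X U) - g(S [U, X], e)\<close>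
  (\<open>g_curvature_X\<close>). The \<open>\<alpha>\<close>-Jacobi field is the push-forward of \<open>e\<close>, and along the flow line it
  differs from \<open>U\<close> to first order by \<open>[U, X]\<close>; so the derivative \<open>B'\<close> of \<open>g(S u, u)\<close> along the Jacobi
  field \<open>u\<close> is \<open>X(g(S U, U)) + g([U, X], S e) + g(e, S [U, X])\<close>
  (\<open>tensor_along_flow_derivative\<close>). With \<open>\<nabla>\<^sub>X U = S e - [U, X]\<close> this gives
  \<open>k(e, X) = |S e|\<^sup>2 - B'\<close>. Normalizing the Jacobi field divides \<open>g(S u, u)\<close> by \<open>|u|\<^sup>2\<close>, whose
  derivative is \<open>2 g(S e, e)\<close>, and \<open>|S e|\<^sup>2 = g(S e, e)\<^sup>2 + g(S e, J e)\<^sup>2\<close>; the claim follows.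

  For the Ricci curvature, the same expression for \<open>k\<close> is summed over a frame \<open>V\<close>, \<open>J V\<close> of \<open>\<xi>\<close>. The
  terms with \<open>\<nabla>\<^sub>X\<close> cancel, because the trace of \<open>S\<close> vanishes along the orbit and because \<open>\<nabla>\<^sub>X\<close> acts on
  the frame by a rotation and a common dilation. What is left is minus the trace of \<open>S\<^sup>2\<close>, which is
  \<open>2 det S\<close> for a trace-free \<open>2 \<times> 2\<close> matrix (\<open>Reeb_Ricci\<close>). Differentiating \<open>g(V, X) = 0\<close> shows that
  the second fundamental form is \<open>- g(S u, v)\<close>, so \<open>G(\<xi>) = det S\<close>; and a trace-free matrix
  whose off-diagonal entries differ by \<open>\<theta>'\<close> has determinant at most \<open>\<theta>'\<^sup>2 / 4\<close>.

  Tangent vectors are derivations of germs, and \<open>d\<alpha>\<close>, curvature and the second fundamental form are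
  defined through chosen extensions of tangent vectors. Two general facts make this work: a
  derivation is determined by its values on coordinates, by Hadamard's lemma
  (\<open>tangent_expansion\<close>), which provides extensions and bounds the dimension of \<open>\<xi>\<close>; and curvature
  depends only on the values of its arguments at the point (\<open>curvature_tensorial\<close>).\<close>

section \<open>Calculus of smooth maps between Euclidean spaces\<close>

lemma has_derivative_cong_open:
  assumes "open S" "x \<in> S" "\<And>y. y \<in> S \<Longrightarrow> f y = g y"
  shows "(f has_derivative F) (at x) \<longleftrightarrow> (g has_derivative F) (at x)"
  using assms by (metis has_derivative_transform_within_open)

lemma frechet_derivative_cong_open:
  assumes "open S" "x \<in> S" "\<And>y. y \<in> S \<Longrightarrow> f y = g y"
  shows "frechet_derivative f (at x) = frechet_derivative g (at x)"
  unfolding frechet_derivative_def using has_derivative_cong_open[OF assms] by simp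

lemma differentiable_cong_open:
  assumes "open S" "x \<in> S" "\<And>y. y \<in> S \<Longrightarrow> f y = g y"
  shows "f differentiable (at x) \<longleftrightarrow> g differentiable (at x)"
  unfolding differentiable_def using has_derivative_cong_open[OF assms] by simp

lemma Ck_on_cong:
  assumes "open S" "\<And>x. x \<in> S \<Longrightarrow> f x = g x"
  shows "Ck_on k S f \<longleftrightarrow> Ck_on k S g"
  using assms(2)
proof (induction k arbitrary: f g)
  case 0
  then show ?case by (simp cong: continuous_on_cong)
next
  case (Suc k)
  have "Ck_on k S (\<lambda>x. frechet_derivative f (at x) i) \<longleftrightarrow> Ck_on k S (\<lambda>x. frechet_derivative g (at x) i)" for i
    by (rule Suc.IH) (simp add: frechet_derivative_cong_open[OF \<open>open S\<close> _ Suc.prems])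
  then show ?case
    by (simp add: differentiable_cong_open[OF \<open>open S\<close> _ Suc.prems] cong: ball_cong)
qed

lemma Ck_on_subset: "Ck_on k S f \<Longrightarrow> T \<subseteq> S \<Longrightarrow> Ck_on k T f"
  by (induction k arbitrary: f) (auto intro: continuous_on_subset)

lemma Ck_on_imp_continuous_on: "Ck_on k S f \<Longrightarrow> continuous_on S f"
  by (cases k)
    (auto intro!: differentiable_imp_continuous_on simp: differentiable_on_def
      differentiable_at_withinI)

lemma Ck_on_has_derivative:
  "Ck_on (Suc k) S f \<Longrightarrow> x \<in> S \<Longrightarrow> (f has_derivative frechet_derivative f (at x)) (at x)"
  by (simp add: frechet_derivative_works[symmetric])

lemma Ck_on_partial_derivative:
  "Ck_on (Suc k) S f \<Longrightarrow> i \<in> Basis \<Longrightarrow> Ck_on k S (\<lambda>x. frechet_derivative f (at x) i)"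
  by simp

lemma Ck_on_SucD: "Ck_on (Suc k) S f \<Longrightarrow> Ck_on k S f"
proof (induction k arbitrary: f)
  case 0
  then show ?case using Ck_on_imp_continuous_on[of "Suc 0" S f] by simp
next
  case (Suc k)
  have "Ck_on k S (\<lambda>x. frechet_derivative f (at x) i)" if "i \<in> Basis" for i
    by (rule Suc.IH) (rule Ck_on_partial_derivative[OF Suc.prems that])
  then show ?case using Suc.prems by simp
qed

lemma Ck_on_local:
  assumes "\<And>x. x \<in> S \<Longrightarrow> \<exists>T. open T \<and> x \<in> T \<and> Ck_on k T f"
  shows "Ck_on k S f"
  using assms
proof (induction k arbitrary: f)
  case 0
  show ?case
    unfolding Ck_on.simps
  proof (intro continuous_at_imp_continuous_on ballI)
    fix x assume "x \<in> S"
    from 0[OF this] show "isCont f x" using continuous_on_eq_continuous_at by auto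
  qed
next
  case (Suc k)
  show ?case
    unfolding Ck_on.simps
  proof (intro conjI ballI)
    show "f differentiable at x" if "x \<in> S" for x
      using Suc.prems[OF that] by auto
    show "Ck_on k S (\<lambda>x. frechet_derivative f (at x) i)" if "i \<in> Basis" for i
    proof (rule Suc.IH)
      fix x assume "x \<in> S"
      from Suc.prems[OF this] that
      show "\<exists>T. open T \<and> x \<in> T \<and> Ck_on k T (\<lambda>x. frechet_derivative f (at x) i)" by auto
    qed
  qed
qed

lemma Ck_on_SucI:
  assumes "open S" "\<And>x. x \<in> S \<Longrightarrow> (f has_derivative f' x) (at x)"
    and "\<And>i. i \<in> Basis \<Longrightarrow> Ck_on k S (\<lambda>x. f' x i)"
  shows "Ck_on (Suc k) S f"
proof -
  have eq: "frechet_derivative f (at x) = f' x" if "x \<in> S" for x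
    using frechet_derivative_at[OF assms(2)[OF that]] by simp
  have "Ck_on k S (\<lambda>x. frechet_derivative f (at x) i)" if "i \<in> Basis" for i
    using assms(3)[OF that] Ck_on_cong[OF assms(1), of "\<lambda>x. frechet_derivative f (at x) i" "\<lambda>x. f' x i"] eq
    by simp
  then show ?thesis using assms(2) by (auto simp: differentiable_def)
qed

lemma Ck_on_const: "open S \<Longrightarrow> Ck_on k S (\<lambda>x. c)"
proof (induction k arbitrary: c)
  case (Suc k)
  then show ?case by (intro Ck_on_SucI[where f' = "\<lambda>_ _. 0"]) auto
qed auto

lemma Ck_on_bounded_linear_compose:
  assumes "open S" "bounded_linear L"
  shows "Ck_on k S f \<Longrightarrow> Ck_on k S (\<lambda>x. L (f x))"
proof (induction k arbitrary: f)
  case 0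
  then show ?case using bounded_linear.continuous_on[OF assms(2)] by simp
next
  case (Suc k)
  note f' = Ck_on_has_derivative[OF Suc.prems] Ck_on_partial_derivative[OF Suc.prems]
  show ?case
    by (rule Ck_on_SucI[OF assms(1) bounded_linear.has_derivative[OF assms(2) f'(1)]])
      (assumption, rule Suc.IH, rule f'(2))
qed

lemma Ck_on_bounded_linear:
  assumes "open S" "bounded_linear L"
  shows "Ck_on k S L"
proof (cases k)
  case 0
  then show ?thesis using assms(2) by (auto intro: linear_continuous_on)
next
  case (Suc l)
  show ?thesis unfolding Suc
    by (rule Ck_on_SucI[OF assms(1) bounded_linear_imp_has_derivative[OF assms(2)]])
      (simp add: Ck_on_const assms(1))
qed

lemma Ck_on_add:
  assumes "open S"
  shows "Ck_on k S f \<Longrightarrow> Ck_on k S g \<Longrightarrow> Ck_on k S (\<lambda>x. f x + g x)"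
proof (induction k arbitrary: f g)
  case 0
  then show ?case by (auto intro: continuous_on_add)
next
  case (Suc k)
  note f' = Ck_on_has_derivative[OF Suc.prems(1)] Ck_on_partial_derivative[OF Suc.prems(1)]
  note g' = Ck_on_has_derivative[OF Suc.prems(2)] Ck_on_partial_derivative[OF Suc.prems(2)]
  show ?case
    by (rule Ck_on_SucI[OF assms(1) has_derivative_add[OF f'(1) g'(1)]])
      (assumption, assumption, rule Suc.IH, erule f'(2), erule g'(2))
qed

lemma Ck_on_sum:
  assumes "open S" "\<And>i. i \<in> I \<Longrightarrow> Ck_on k S (f i)"
  shows "Ck_on k S (\<lambda>x. \<Sum>i\<in>I. f i x)"
  using assms(2) by (induction I rule: infinite_finite_induct) (auto intro: Ck_on_add Ck_on_const assms(1))

lemma Ck_on_scaleR: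
  fixes f :: "'a::euclidean_space \<Rightarrow> real"
  assumes "open S"
  shows "Ck_on k S f \<Longrightarrow> Ck_on k S g \<Longrightarrow> Ck_on k S (\<lambda>x. f x *\<^sub>R g x)"
proof (induction k arbitrary: f g)
  case 0
  then show ?case by (auto intro: continuous_on_scaleR)
next
  case (Suc k)
  note f' = Ck_on_has_derivative[OF Suc.prems(1)] Ck_on_partial_derivative[OF Suc.prems(1)]
  note g' = Ck_on_has_derivative[OF Suc.prems(2)] Ck_on_partial_derivative[OF Suc.prems(2)]
  show ?case
    by (rule Ck_on_SucI[OF assms(1) has_derivative_scaleR[OF f'(1) g'(1)]])
      (assumption, assumption,
        intro Ck_on_add[OF assms] Suc.IH f'(2) g'(2) Ck_on_SucD[OF Suc.prems(1)] Ck_on_SucD[OF Suc.prems(2)])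
qed

lemma Ck_on_mult:
  fixes f :: "'a::euclidean_space \<Rightarrow> real"
  shows "open S \<Longrightarrow> Ck_on k S f \<Longrightarrow> Ck_on k S g \<Longrightarrow> Ck_on k S (\<lambda>x. f x * g x)"
  using Ck_on_scaleR[of S k f g] by simp

text \<open>By the chain rule each partial derivative of \<open>g \<circ> f\<close> is a sum of products of a component of a
  partial derivative of \<open>f\<close> with a partial derivative of \<open>g\<close> composed with \<open>f\<close>; the induction
  hypothesis is applied to the latter, with \<open>f\<close> fixed and \<open>g\<close> varying.\<close>

lemma Ck_on_compose:
  fixes f :: "'a::euclidean_space \<Rightarrow> 'b::euclidean_space" and g :: "'b \<Rightarrow> 'c::real_normed_vector"
  assumes "open S" "open T" "f ` S \<subseteq> T"
  shows "Ck_on k S f \<Longrightarrow> Ck_on k T g \<Longrightarrow> Ck_on k S (\<lambda>x. g (f x))"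
proof (induction k arbitrary: g)
  case 0
  then show ?case using assms(3) by (auto intro: continuous_on_compose2)
next
  case (Suc k)
  note f' = Ck_on_has_derivative[OF Suc.prems(1)] Ck_on_partial_derivative[OF Suc.prems(1)]
  note g' = Ck_on_has_derivative[OF Suc.prems(2)] Ck_on_partial_derivative[OF Suc.prems(2)]
  let ?f' = "\<lambda>x. frechet_derivative f (at x)" and ?g' = "\<lambda>x. frechet_derivative g (at x)"
  show ?case
  proof (rule Ck_on_SucI[OF assms(1)])
    fix x assume "x \<in> S"
    then have "?g' (f x) (?f' x v) = (\<Sum>j\<in>Basis. (?f' x v \<bullet> j) *\<^sub>R ?g' (f x) j)" for v
      using has_derivative_linear[OF g'(1)[of "f x"]] assms(3)
      by (subst (1) euclidean_representation[of "?f' x v", symmetric])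
        (auto simp: linear_sum linear_scale)
    then show "((\<lambda>x. g (f x)) has_derivative (\<lambda>v. \<Sum>j\<in>Basis. (?f' x v \<bullet> j) *\<^sub>R ?g' (f x) j)) (at x)"
      using has_derivative_compose[OF f'(1) g'(1), OF \<open>x \<in> S\<close>] \<open>x \<in> S\<close> assms(3)
      by (auto simp: image_subset_iff)
  next
    fix i :: 'a assume "i \<in> Basis"
    then show "Ck_on k S (\<lambda>x. \<Sum>j\<in>Basis. (?f' x i \<bullet> j) *\<^sub>R ?g' (f x) j)"
      by (intro Ck_on_sum Ck_on_scaleR assms(1) Suc.IH Ck_on_SucD[OF Suc.prems(1)] g'(2)
          Ck_on_bounded_linear_compose[OF assms(1) bounded_linear_inner_left] f'(2))
  qed
qed

lemma Cinf_on_cong: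
  "open S \<Longrightarrow> (\<And>x. x \<in> S \<Longrightarrow> f x = g x) \<Longrightarrow> Cinf_on S f \<longleftrightarrow> Cinf_on S g"
  unfolding Cinf_on_def using Ck_on_cong[of S f g] by auto

lemma Cinf_on_subset: "Cinf_on S f \<Longrightarrow> T \<subseteq> S \<Longrightarrow> Cinf_on T f"
  unfolding Cinf_on_def using Ck_on_subset by blast

lemma Cinf_on_frechet_derivative:
  assumes "open S" "Cinf_on S f"
  shows "Cinf_on S (\<lambda>x. frechet_derivative f (at x) v)"
  unfolding Cinf_on_def
proof
  fix k
  have f: "Ck_on (Suc k) S f" using assms(2) by (simp only: Cinf_on_def)
  have eq: "frechet_derivative f (at x) v = (\<Sum>j\<in>Basis. (v \<bullet> j) *\<^sub>R frechet_derivative f (at x) j)"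
    if "x \<in> S" for x
    using f that linear_frechet_derivative[of f "at x"]
    by (subst (1) euclidean_representation[of v, symmetric]) (auto simp: linear_sum linear_scale)
  have "Ck_on k S (\<lambda>x. \<Sum>j\<in>Basis. (v \<bullet> j) *\<^sub>R frechet_derivative f (at x) j)"
    using f by (intro Ck_on_sum Ck_on_scaleR Ck_on_const assms(1)) auto
  then show "Ck_on k S (\<lambda>x. frechet_derivative f (at x) v)"
    using Ck_on_cong[OF assms(1) eq] by simp
qed

lemma Cinf_on_has_derivative:
  "Cinf_on S f \<Longrightarrow> x \<in> S \<Longrightarrow> (f has_derivative frechet_derivative f (at x)) (at x)"
  unfolding Cinf_on_def by (metis Ck_on.simps(2) frechet_derivative_works)

lemma Cinf_on_const: "open S \<Longrightarrow> Cinf_on S (\<lambda>x. c)"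
  by (simp add: Cinf_on_def Ck_on_const)

lemma Cinf_on_bounded_linear: "open S \<Longrightarrow> bounded_linear L \<Longrightarrow> Cinf_on S L"
  by (simp add: Cinf_on_def Ck_on_bounded_linear)

lemma Cinf_on_add: "open S \<Longrightarrow> Cinf_on S f \<Longrightarrow> Cinf_on S g \<Longrightarrow> Cinf_on S (\<lambda>x. f x + g x)"
  by (simp add: Cinf_on_def Ck_on_add)

lemma Cinf_on_mult:
  fixes f :: "'a::euclidean_space \<Rightarrow> real"
  shows "open S \<Longrightarrow> Cinf_on S f \<Longrightarrow> Cinf_on S g \<Longrightarrow> Cinf_on S (\<lambda>x. f x * g x)"
  by (simp add: Cinf_on_def Ck_on_mult)

lemma Cinf_on_compose:
  fixes f :: "'a::euclidean_space \<Rightarrow> 'b::euclidean_space"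
  shows "open S \<Longrightarrow> open T \<Longrightarrow> f ` S \<subseteq> T \<Longrightarrow> Cinf_on S f \<Longrightarrow> Cinf_on T g \<Longrightarrow> Cinf_on S (\<lambda>x. g (f x))"
  unfolding Cinf_on_def using Ck_on_compose by blast


text \<open>The mean value theorem in direction \<open>u\<close>, followed by differentiability of the \<open>u\<close>-derivative
  in direction \<open>v\<close>, shows that the second difference of \<open>f\<close> divided by \<open>h\<^sup>2\<close> tends to the iterated
  derivative; the second difference is symmetric in \<open>u\<close> and \<open>v\<close>.\<close>

lemma second_difference_tendsto:
  fixes f :: "'a::real_normed_vector \<Rightarrow> real"
  assumes "open S" "a \<in> S"
    and f: "\<And>x. x \<in> S \<Longrightarrow> (f has_derivative f' x) (at x)"
    and f'': "((\<lambda>x. f' x u) has_derivative d) (at a)"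
  shows "((\<lambda>h. (f (a + h *\<^sub>R u + h *\<^sub>R v) - f (a + h *\<^sub>R u) - f (a + h *\<^sub>R v) + f a) / h\<^sup>2) \<longlongrightarrow> d v)
           (at_right 0)"
proof (rule tendstoI)
  fix e :: real assume "0 < e"
  define C where "C = norm u + norm v + 1"
  have "0 < C" by (simp add: C_def add_nonneg_pos)
  \<comment> \<open>Both linear approximations below are made at distance at most \<open>h * C\<close> from \<open>a\<close>, so their errors
    add up to at most \<open>h * e / 2\<close>.\<close>
  define e' where "e' = e / (4 * C)"
  have "0 < e'" using \<open>0 < e\<close> \<open>0 < C\<close> by (simp add: e'_def)
  from assms(1,2) obtain r where r: "0 < r" "ball a r \<subseteq> S" using openE by blast
  from has_derivative_at_alt[THEN iffD1, OF f''] \<open>0 < e'\<close> obtain s where s: "0 < s"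
    "\<And>y. norm (y - a) < s \<Longrightarrow> \<bar>f' y u - f' a u - d (y - a)\<bar> \<le> e' * norm (y - a)"
    and lin: "bounded_linear d"
    by (metis real_norm_def)
  have "\<forall>\<^sub>F h in at_right 0. 0 < h \<and> h < min r s / C"
    using \<open>0 < C\<close> r s by (intro eventually_at_right_real[THEN eventually_mono]) auto
  then show "\<forall>\<^sub>F h in at_right 0. dist ((f (a + h *\<^sub>R u + h *\<^sub>R v) - f (a + h *\<^sub>R u) - f (a + h *\<^sub>R v) + f a) / h\<^sup>2) (d v) < e"
  proof eventually_elim
    case (elim h)
    then have h: "0 < h" "h * C < r" "h * C < s" using \<open>0 < C\<close> by (auto simp: field_simps)
    have nrm: "norm (t *\<^sub>R u + k *\<^sub>R v) \<le> h * C" if "0 \<le> t" "t \<le> h" "0 \<le> k" "k \<le> h" for t k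
    proof -
      have "norm (t *\<^sub>R u + k *\<^sub>R v) \<le> t * norm u + k * norm v"
        using that norm_triangle_ineq[of "t *\<^sub>R u" "k *\<^sub>R v"] by simp
      also have "\<dots> \<le> h * norm u + h * norm v" using that by (intro add_mono mult_right_mono) auto
      also have "\<dots> \<le> h * C" using h by (simp add: C_def algebra_simps)
      finally show ?thesis .
    qed
    have inS: "a + t *\<^sub>R u + k *\<^sub>R v \<in> S" if "0 \<le> t" "t \<le> h" "0 \<le> k" "k \<le> h" for t k
    proof (rule subsetD[OF r(2)])
      have "dist (a + (t *\<^sub>R u + k *\<^sub>R v)) a < r"
        using nrm[OF that] h by (simp add: dist_norm)
      then show "a + t *\<^sub>R u + k *\<^sub>R v \<in> ball a r"
        by (simp add: add.assoc dist_commute)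
    qed
    define F where "F t = f (a + t *\<^sub>R u + h *\<^sub>R v) - f (a + t *\<^sub>R u)" for t
    have F: "(F has_real_derivative (f' (a + t *\<^sub>R u + h *\<^sub>R v) u - f' (a + t *\<^sub>R u) u)) (at t)"
      if "0 \<le> t" "t \<le> h" for t
    proof -
      have 1: "((\<lambda>t. f (a + t *\<^sub>R u + k *\<^sub>R v)) has_real_derivative f' (a + t *\<^sub>R u + k *\<^sub>R v) u) (at t)"
        if "0 \<le> k" "k \<le> h" for k
      proof -
        have "((\<lambda>t. f (a + t *\<^sub>R u + k *\<^sub>R v)) has_derivative (\<lambda>y. f' (a + t *\<^sub>R u + k *\<^sub>R v) (y *\<^sub>R u))) (at t)"
          using that \<open>0 \<le> t\<close> \<open>t \<le> h\<close>
          by (intro has_derivative_compose[where g = f and f = "\<lambda>t. a + t *\<^sub>R u + k *\<^sub>R v"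
                and f' = "\<lambda>y. y *\<^sub>R u" and g' = "f' (a + t *\<^sub>R u + k *\<^sub>R v)"] f inS)
            (auto intro!: derivative_eq_intros)
        moreover have "f' (a + t *\<^sub>R u + k *\<^sub>R v) (y *\<^sub>R u) = y * f' (a + t *\<^sub>R u + k *\<^sub>R v) u" for y
          using linear_scale[OF has_derivative_linear[OF f[OF inS]]] that \<open>0 \<le> t\<close> \<open>t \<le> h\<close> by simp
        ultimately show ?thesis by (simp add: has_field_derivative_def mult_commute_abs)
      qed
      from DERIV_diff[OF 1[of h] 1[of 0]] show ?thesis using h by (simp add: F_def[abs_def])
    qed
    obtain t where t: "0 < t" "t < h"
      "F h - F 0 = h * (f' (a + t *\<^sub>R u + h *\<^sub>R v) u - f' (a + t *\<^sub>R u) u)"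
      using MVT2[of 0 h F "\<lambda>t. f' (a + t *\<^sub>R u + h *\<^sub>R v) u - f' (a + t *\<^sub>R u) u"] h F by auto
    let ?y = "t *\<^sub>R u + h *\<^sub>R v" and ?z = "t *\<^sub>R u + 0 *\<^sub>R v"
    have y: "\<bar>f' (a + ?y) u - f' a u - d ?y\<bar> \<le> e' * (h * C)"
    proof -
      have "\<bar>f' (a + ?y) u - f' a u - d ?y\<bar> \<le> e' * norm ?y"
        using s(2)[of "a + ?y"] nrm[of t h] t h by simp
      also have "\<dots> \<le> e' * (h * C)" using nrm[of t h] t \<open>0 < e'\<close> by (intro mult_left_mono) auto
      finally show ?thesis .
    qed
    have z: "\<bar>f' (a + ?z) u - f' a u - d ?z\<bar> \<le> e' * (h * C)"
    proof -
      have "\<bar>f' (a + ?z) u - f' a u - d ?z\<bar> \<le> e' * norm ?z"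
        using s(2)[of "a + ?z"] nrm[of t 0] t h by simp
      also have "\<dots> \<le> e' * (h * C)" using nrm[of t 0] t \<open>0 < e'\<close> by (intro mult_left_mono) auto
      finally show ?thesis .
    qed
    have "d ?y - d ?z = h * d v"
      using bounded_linear.linear[OF lin] by (simp add: linear_add linear_scale)
    with y z have "\<bar>(f' (a + ?y) u - f' (a + ?z) u) - h * d v\<bar> \<le> 2 * (e' * (h * C))" by linarith
    also have "\<dots> = h * (e / 2)" using \<open>0 < C\<close> by (simp add: e'_def)
    finally have "\<bar>(f' (a + ?y) u - f' (a + ?z) u) / h - d v\<bar> \<le> e / 2"
      using h by (simp add: abs_le_iff field_simps)
    moreover have "(f (a + h *\<^sub>R u + h *\<^sub>R v) - f (a + h *\<^sub>R u) - f (a + h *\<^sub>R v) + f a) / h\<^sup>2 =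
        (f' (a + ?y) u - f' (a + ?z) u) / h"
    proof -
      have "f (a + h *\<^sub>R u + h *\<^sub>R v) - f (a + h *\<^sub>R u) - f (a + h *\<^sub>R v) + f a = F h - F 0"
        by (simp add: F_def)
      then show ?thesis using t(3) h by (simp add: power2_eq_square add.assoc)
    qed
    ultimately show ?case using \<open>0 < e\<close> by (simp add: dist_real_def)
  qed
qed

lemma mixed_derivatives_commute:
  fixes f :: "'a::euclidean_space \<Rightarrow> real"
  assumes "open S" "a \<in> S" "Cinf_on S f"
  shows "frechet_derivative (\<lambda>x. frechet_derivative f (at x) u) (at a) v =
         frechet_derivative (\<lambda>x. frechet_derivative f (at x) v) (at a) u"
proof (rule tendsto_unique)
  note second_difference_tendsto[OF assms(1,2) Cinf_on_has_derivative[OF assms(3)]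
      Cinf_on_has_derivative[OF Cinf_on_frechet_derivative[OF assms(1,3)] assms(2)]]
  from this[of u v] this[of v u]
  show "((\<lambda>h. (f (a + h *\<^sub>R u + h *\<^sub>R v) - f (a + h *\<^sub>R u) - f (a + h *\<^sub>R v) + f a) / h\<^sup>2) \<longlongrightarrow>
      frechet_derivative (\<lambda>x. frechet_derivative f (at x) u) (at a) v) (at_right 0)"
    "((\<lambda>h. (f (a + h *\<^sub>R u + h *\<^sub>R v) - f (a + h *\<^sub>R u) - f (a + h *\<^sub>R v) + f a) / h\<^sup>2) \<longlongrightarrow>
      frechet_derivative (\<lambda>x. frechet_derivative f (at x) v) (at a) u) (at_right 0)"
    by (simp_all add: algebra_simps)
qed simp


text \<open>Differentiation under the integral sign turns \<open>f\<close> into a partial derivative of \<open>f\<close> and produces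
  one more factor \<open>t\<close> by the chain rule. The weight \<open>t ^ n\<close> keeps the statement stable under this
  step of the induction.\<close>

lemma Ck_on_ray_integral:
  fixes f :: "'a::euclidean_space \<Rightarrow> real"
  assumes "open S" "convex S" "a \<in> S"
  shows "Ck_on k S f \<Longrightarrow> Ck_on k S (\<lambda>x. integral (cbox 0 1) (\<lambda>t::real. t ^ n * f (a + t *\<^sub>R (x - a))))"
proof (induction k arbitrary: f n)
  have ray: "a + t *\<^sub>R (x - a) \<in> S" if "x \<in> S" "t \<in> cbox 0 1" for x t
  proof -
    have "a + t *\<^sub>R (x - a) = (1 - t) *\<^sub>R a + t *\<^sub>R x" by (simp add: algebra_simps)
    then show ?thesis using convexD[OF assms(2,3) that(1), of "1 - t" t] that(2) by simp
  qed
  have cont: "continuous_on (S \<times> cbox 0 1) (\<lambda>(x, t). t ^ n * g (a + t *\<^sub>R (x - a)))"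
    if "continuous_on S g" for g :: "'a \<Rightarrow> real" and n
    using ray unfolding split_beta
    by (intro continuous_intros continuous_on_compose2[OF that]) auto
  {
    case 0
    show ?case unfolding Ck_on.simps
      by (rule integral_continuous_on_param, rule cont) (use 0 in simp)
  next
    case (Suc k)
    let ?f' = "\<lambda>x. frechet_derivative f (at x)"
    note f' = Ck_on_has_derivative[OF Suc.prems] Ck_on_partial_derivative[OF Suc.prems]
    define D where "D x t = (\<Sum>i\<in>Basis. (t ^ Suc n * ?f' (a + t *\<^sub>R (x - a)) i) *\<^sub>R blinfun_inner_left i)"
      for x and t :: real
    have D: "blinfun_apply (D x t) v = t ^ Suc n * ?f' (a + t *\<^sub>R (x - a)) v"
      if "x \<in> S" "t \<in> cbox 0 1" for x t v
    proof -
      have "?f' (a + t *\<^sub>R (x - a)) v = (\<Sum>i\<in>Basis. (v \<bullet> i) * ?f' (a + t *\<^sub>R (x - a)) i)"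
        using has_derivative_linear[OF f'(1)[OF ray[OF that]]]
        by (subst (1) euclidean_representation[of v, symmetric]) (simp add: linear_sum linear_scale)
      then show ?thesis
        by (simp add: D_def blinfun.sum_left blinfun.scaleR_left sum_distrib_left mult_ac)
    qed
    have contD: "continuous_on (S \<times> cbox 0 1) (\<lambda>(x, t). D x t)"
    proof -
      have "continuous_on (S \<times> cbox 0 1) (\<lambda>(x, t). t ^ Suc n * ?f' (a + t *\<^sub>R (x - a)) i)" if "i \<in> Basis" for i
        by (rule cont) (rule Ck_on_imp_continuous_on[OF f'(2)[OF that]])
      then show ?thesis unfolding D_def split_beta
        by (intro continuous_on_sum continuous_on_scaleR continuous_on_const) auto
    qed
    have intD: "(\<lambda>t. D x t) integrable_on cbox 0 1" if "x \<in> S" for x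
    proof (rule integrable_continuous)
      have "continuous_on (cbox 0 1) (\<lambda>t. case (x, t) of (x, t) \<Rightarrow> D x t)"
        by (rule continuous_on_compose2[OF contD]) (use that in \<open>auto intro!: continuous_intros\<close>)
      then show "continuous_on (cbox 0 1) (D x)" by simp
    qed
    show ?case
    proof (rule Ck_on_SucI[OF assms(1)])
      fix x assume "x \<in> S"
      have "((\<lambda>x. integral (cbox 0 1) (\<lambda>t::real. t ^ n * f (a + t *\<^sub>R (x - a)))) has_derivative
        blinfun_apply (integral (cbox 0 1) (D x))) (at x within S)"
      proof (rule leibniz_rule[OF _ _ contD \<open>x \<in> S\<close> assms(2)])
        fix y and t :: real assume y: "y \<in> S" "t \<in> cbox 0 1"
        have "((\<lambda>x. f (a + t *\<^sub>R (x - a))) has_derivative (\<lambda>v. ?f' (a + t *\<^sub>R (y - a)) (t *\<^sub>R v))) (at y)"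
          using y
          by (intro has_derivative_compose[where g = f and f = "\<lambda>x. a + t *\<^sub>R (x - a)"
                and f' = "\<lambda>v. t *\<^sub>R v" and g' = "?f' (a + t *\<^sub>R (y - a))"] f'(1) ray)
            (auto intro!: derivative_eq_intros)
        moreover have "?f' (a + t *\<^sub>R (y - a)) (t *\<^sub>R v) = t * ?f' (a + t *\<^sub>R (y - a)) v" for v
          using linear_scale[OF has_derivative_linear[OF f'(1)[OF ray[OF y]]]] by simp
        ultimately have "((\<lambda>x. f (a + t *\<^sub>R (x - a))) has_derivative
            (\<lambda>v. t * ?f' (a + t *\<^sub>R (y - a)) v)) (at y)" by simp
        from has_derivative_mult_right[OF this, of "t ^ n"]
        have "((\<lambda>x. t ^ n * f (a + t *\<^sub>R (x - a))) has_derivative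
            (\<lambda>v. t ^ n * (t * ?f' (a + t *\<^sub>R (y - a)) v))) (at y)" .
        moreover have "(\<lambda>v. t ^ n * (t * ?f' (a + t *\<^sub>R (y - a)) v)) = blinfun_apply (D y t)"
          by (simp add: fun_eq_iff D[OF y])
        ultimately have "((\<lambda>x. t ^ n * f (a + t *\<^sub>R (x - a))) has_derivative blinfun_apply (D y t)) (at y)"
          by simp
        then show "((\<lambda>x. t ^ n * f (a + t *\<^sub>R (x - a))) has_derivative blinfun_apply (D y t)) (at y within S)"
          by (rule has_derivative_at_withinI)
      next
        fix y assume y: "y \<in> S"
        show "(\<lambda>t. t ^ n * f (a + t *\<^sub>R (y - a))) integrable_on cbox 0 1"
        proof (rule integrable_continuous)
          have "continuous_on (cbox 0 1) (\<lambda>t. case (y, t) of (y, t) \<Rightarrow> t ^ n * f (a + t *\<^sub>R (y - a)))"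
            by (rule continuous_on_compose2[OF cont[OF Ck_on_imp_continuous_on[OF Suc.prems]]])
              (use y in \<open>auto intro!: continuous_intros\<close>)
          then show "continuous_on (cbox 0 1) (\<lambda>t. t ^ n * f (a + t *\<^sub>R (y - a)))" by simp
        qed
      qed
      then show "((\<lambda>x. integral (cbox 0 1) (\<lambda>t::real. t ^ n * f (a + t *\<^sub>R (x - a)))) has_derivative
        blinfun_apply (integral (cbox 0 1) (D x))) (at x)"
        unfolding at_within_open[OF \<open>x \<in> S\<close> assms(1)] .
    next
      fix i :: 'a assume i: "i \<in> Basis"
      have eq: "blinfun_apply (integral (cbox 0 1) (D x)) i =
          integral (cbox 0 1) (\<lambda>t. t ^ Suc n * ?f' (a + t *\<^sub>R (x - a)) i)" if "x \<in> S" for x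
        unfolding blinfun_apply_integral[OF intD[OF that]]
        by (rule integral_cong) (rule D[OF that])
      have "Ck_on k S (\<lambda>x. integral (cbox 0 1) (\<lambda>t::real. t ^ Suc n * ?f' (a + t *\<^sub>R (x - a)) i))"
        by (rule Suc.IH) (rule f'(2)[OF i])
      then show "Ck_on k S (\<lambda>x. blinfun_apply (integral (cbox 0 1) (D x)) i)"
        by (rule iffD2[OF Ck_on_cong[OF assms(1)], rotated]) (rule eq)
    qed
  }
qed

text \<open>The difference \<open>f x - f a\<close> is the integral of the derivative of \<open>f\<close> along the segment from \<open>a\<close> to
  \<open>x\<close>, and this derivative is linear in \<open>x - a\<close>.\<close>

lemma Hadamard_decomposition:
  fixes f :: "'a::euclidean_space \<Rightarrow> real"
  assumes "open S" "convex S" "a \<in> S" "Cinf_on S f"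
  obtains h where "\<And>i. i \<in> Basis \<Longrightarrow> Cinf_on S (h i)"
    and "\<And>x. x \<in> S \<Longrightarrow> f x = f a + (\<Sum>i\<in>Basis. ((x - a) \<bullet> i) * h i x)"
proof
  let ?f' = "\<lambda>x. frechet_derivative f (at x)"
  define h where "h i x = integral (cbox 0 1) (\<lambda>t::real. t ^ 0 * ?f' (a + t *\<^sub>R (x - a)) i)" for i x
  have f': "Cinf_on S (\<lambda>x. ?f' x i)" for i
    by (rule Cinf_on_frechet_derivative[OF assms(1,4)])
  then show "Cinf_on S (h i)" for i
    unfolding Cinf_on_def h_def using Ck_on_ray_integral[OF assms(1-3)] by blast
  have contf': "continuous_on S (\<lambda>x. ?f' x i)" for i
    using f' unfolding Cinf_on_def by (metis Ck_on.simps(1))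
  show "f x = f a + (\<Sum>i\<in>Basis. ((x - a) \<bullet> i) * h i x)" if "x \<in> S" for x
  proof -
    let ?y = "\<lambda>t. a + t *\<^sub>R (x - a)"
    have ray: "?y t \<in> S" if "t \<in> cbox 0 1" for t
    proof -
      have "a + t *\<^sub>R (x - a) = (1 - t) *\<^sub>R a + t *\<^sub>R x" by (simp add: algebra_simps)
      then show ?thesis using convexD[OF assms(2,3) \<open>x \<in> S\<close>, of "1 - t" t] that by simp
    qed
    have lin: "linear (?f' (?y t))" if "t \<in> cbox 0 1" for t
      by (rule has_derivative_linear[OF Cinf_on_has_derivative[OF assms(4) ray[OF that]]])
    have "((\<lambda>t. ?f' (?y t) (x - a)) has_integral f (?y 1) - f (?y 0)) {0..1}"
    proof (rule fundamental_theorem_of_calculus)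
      fix t :: real assume t: "t \<in> {0..1}"
      have "((\<lambda>t. f (?y t)) has_derivative (\<lambda>s. ?f' (?y t) (s *\<^sub>R (x - a)))) (at t)"
        using t
        by (intro has_derivative_compose[where g = f and f = ?y and f' = "\<lambda>s. s *\<^sub>R (x - a)"
              and g' = "?f' (?y t)"] Cinf_on_has_derivative[OF assms(4)] ray)
          (auto intro!: derivative_eq_intros)
      then show "((\<lambda>t. f (?y t)) has_vector_derivative ?f' (?y t) (x - a)) (at t within {0..1})"
        using linear_scale[OF lin] t
        by (simp add: has_vector_derivative_def has_derivative_at_withinI)
    qed simp
    then have "f x - f a = integral (cbox 0 1) (\<lambda>t. ?f' (?y t) (x - a))"
      by (simp add: integral_unique)
    also have "\<dots> = integral (cbox 0 1) (\<lambda>t. \<Sum>i\<in>Basis. ((x - a) \<bullet> i) * ?f' (?y t) i)"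
    proof (rule integral_cong)
      fix t :: real assume "t \<in> cbox 0 1"
      then show "?f' (?y t) (x - a) = (\<Sum>i\<in>Basis. ((x - a) \<bullet> i) * ?f' (?y t) i)"
        using lin[of t]
        by (subst (1) euclidean_representation[of "x - a", symmetric]) (simp add: linear_sum linear_scale)
    qed
    also have "\<dots> = (\<Sum>i\<in>Basis. integral (cbox 0 1) (\<lambda>t. ((x - a) \<bullet> i) * ?f' (?y t) i))"
      by (intro integral_sum integrable_continuous continuous_intros continuous_on_compose2[OF contf'])
        (use ray in auto)
    finally show ?thesis by (simp add: h_def)
  qed
qed

section \<open>Smooth functions and tangent vectors on a manifold\<close>

lemma sum_fun_apply: "(\<Sum>i\<in>I. F i) x = (\<Sum>i\<in>I. F i x)"
  by (induction I rule: infinite_finite_induct) auto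

lemma sum_Basis_vec: "(\<Sum>b\<in>(Basis :: (real^'n) set). F b) = (\<Sum>i\<in>UNIV. F (axis i 1))"
proof -
  have "(Basis :: (real^'n) set) = (\<lambda>i. axis i 1) ` UNIV"
    by (auto simp: Basis_vec_def)
  moreover have "inj (\<lambda>i. axis i 1 :: real^'n)" by (auto simp: inj_on_def axis_eq_axis)
  ultimately show ?thesis using sum.reindex[of "\<lambda>i. axis i 1 :: real^'n" UNIV F] by (simp add: o_def)
qed

lemma scalev_apply [simp]: "scalev c v f = c * v f"
  by (simp add: scalev_def)

lemma scalef_apply: "scalef h Y q = scalev (h q) (Y q)"
  by (simp add: scalef_def)

definition chart_vector :: "('m \<Rightarrow> real^3) \<Rightarrow> 'm tvec \<Rightarrow> real^3" where
  "chart_vector \<psi> v = (\<chi> i. v (\<lambda>q. \<psi> q $ i))"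

locale smooth_atlas =
  fixes A :: "('m::t2_space) chart set"
  assumes atlas: "oriented_atlas A"
begin

lemma chart_exists:
  obtains U \<psi> where "(U, \<psi>) \<in> A" "p \<in> U"
proof -
  have "p \<in> (\<Union>(U, \<psi>)\<in>A. U)" using atlas by (simp add: oriented_atlas_def)
  then show ?thesis using that by auto
qed

lemma chart_open: "(U, \<psi>) \<in> A \<Longrightarrow> open U"
  and chart_open_range: "(U, \<psi>) \<in> A \<Longrightarrow> open (\<psi> ` U)"
  and chart_homeomorphism: "(U, \<psi>) \<in> A \<Longrightarrow> homeomorphism U (\<psi> ` U) \<psi> (inv_into U \<psi>)"
  using atlas[unfolded oriented_atlas_def, THEN conjunct2, THEN conjunct1, rule_format, of "(U, \<psi>)"]
  by simp_all

lemma chart_transition: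
  "(U, \<psi>) \<in> A \<Longrightarrow> (U', \<psi>') \<in> A \<Longrightarrow> Cinf_on (\<psi> ` (U \<inter> U')) (\<psi>' \<circ> inv_into U \<psi>)"
  using atlas[unfolded oriented_atlas_def, THEN conjunct2, THEN conjunct2, rule_format, of "(U, \<psi>)"]
  by auto

lemma chart_inverse: "(U, \<psi>) \<in> A \<Longrightarrow> q \<in> U \<Longrightarrow> inv_into U \<psi> (\<psi> q) = q"
  by (rule homeomorphism_apply1[OF chart_homeomorphism])

lemma chart_inverse_image: "(U, \<psi>) \<in> A \<Longrightarrow> W \<subseteq> U \<Longrightarrow> y \<in> \<psi> ` W \<Longrightarrow> inv_into U \<psi> y \<in> W"
  by (auto simp: chart_inverse subsetD)

lemma chart_open_image:
  assumes "(U, \<psi>) \<in> A" "open W" "W \<subseteq> U"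
  shows "open (\<psi> ` W)"
proof -
  have "openin (top_of_set (\<psi> ` U)) (\<psi> ` W)"
    using homeomorphism_imp_open_map[OF chart_homeomorphism[OF assms(1)], of W] assms(2,3)
    by (simp add: open_subset)
  then show ?thesis using openin_open_trans chart_open_range[OF assms(1)] by blast
qed

lemma chart_continuous_on: "(U, \<psi>) \<in> A \<Longrightarrow> continuous_on U \<psi>"
  by (rule homeomorphism_cont1[OF chart_homeomorphism])

lemma smooth_fun_on_subset: "smooth_fun_on A W f \<Longrightarrow> V \<subseteq> W \<Longrightarrow> smooth_fun_on A V f"
  unfolding smooth_fun_on_def by (auto intro: Cinf_on_subset[OF _ image_mono])

lemma smooth_fun_on_cong:
  assumes "open W" "\<And>q. q \<in> W \<Longrightarrow> f q = g q"
  shows "smooth_fun_on A W f \<longleftrightarrow> smooth_fun_on A W g"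
proof -
  have "Cinf_on (\<psi> ` (U \<inter> W)) (f \<circ> inv_into U \<psi>) \<longleftrightarrow> Cinf_on (\<psi> ` (U \<inter> W)) (g \<circ> inv_into U \<psi>)"
    if "(U, \<psi>) \<in> A" for U \<psi>
  proof (rule Cinf_on_cong)
    show "open (\<psi> ` (U \<inter> W))" using chart_open_image[OF that] chart_open[OF that] assms(1) by auto
    show "(f \<circ> inv_into U \<psi>) y = (g \<circ> inv_into U \<psi>) y" if "y \<in> \<psi> ` (U \<inter> W)" for y
      using chart_inverse_image[OF \<open>(U, \<psi>) \<in> A\<close> _ that] assms(2) by simp
  qed
  then show ?thesis unfolding smooth_fun_on_def by blast
qed

lemma smooth_fun_on_local:
  assumes "\<And>q. q \<in> W \<Longrightarrow> smooth_fun_at A q f"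
  shows "smooth_fun_on A W f"
  unfolding smooth_fun_on_def Cinf_on_def
proof (safe intro!: Ck_on_local)
  fix U \<psi> k q
  assume U: "(U, \<psi>) \<in> A" and q: "q \<in> U" "q \<in> W"
  from assms[OF q(2)] obtain V where V: "open V" "q \<in> V" "smooth_fun_on A V f"
    unfolding smooth_fun_at_def by blast
  have "open (\<psi> ` (U \<inter> V))" using chart_open_image[OF U] chart_open[OF U] V(1) by auto
  moreover have "Ck_on k (\<psi> ` (U \<inter> V)) (f \<circ> inv_into U \<psi>)"
    using V(3) U unfolding smooth_fun_on_def Cinf_on_def by blast
  ultimately show "\<exists>T. open T \<and> \<psi> q \<in> T \<and> Ck_on k T (f \<circ> inv_into U \<psi>)"
    using V(2) q(1) by blast
qed

text \<open>Smoothness can be tested in a single chart because the transition maps are smooth.\<close>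

lemma smooth_fun_on_chart_iff:
  assumes "(U, \<psi>) \<in> A" "open W" "W \<subseteq> U"
  shows "smooth_fun_on A W f \<longleftrightarrow> Cinf_on (\<psi> ` W) (f \<circ> inv_into U \<psi>)"
proof
  assume "smooth_fun_on A W f"
  with assms(1) have "Cinf_on (\<psi> ` (U \<inter> W)) (f \<circ> inv_into U \<psi>)"
    unfolding smooth_fun_on_def by auto
  then show "Cinf_on (\<psi> ` W) (f \<circ> inv_into U \<psi>)"
    by (simp only: Int_absorb1[OF assms(3)])
next
  assume f: "Cinf_on (\<psi> ` W) (f \<circ> inv_into U \<psi>)"
  show "smooth_fun_on A W f"
    unfolding smooth_fun_on_def
  proof safe
    fix U' \<psi>' assume U': "(U', \<psi>') \<in> A"
    let ?S = "\<psi>' ` (U' \<inter> W)"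
    have S: "open ?S" using chart_open_image[OF U'] chart_open[OF U'] assms(2) by auto
    have T: "open (\<psi> ` W)" by (rule chart_open_image[OF assms])
    have inv: "inv_into U' \<psi>' y \<in> U' \<inter> W" if "y \<in> ?S" for y
      using chart_inverse_image[OF U' _ that] by auto
    have "Cinf_on ?S (\<lambda>y. (f \<circ> inv_into U \<psi>) ((\<psi> \<circ> inv_into U' \<psi>') y))"
    proof (rule Cinf_on_compose[OF S T _ _ f])
      show "(\<psi> \<circ> inv_into U' \<psi>') ` ?S \<subseteq> \<psi> ` W" using inv by auto
      show "Cinf_on ?S (\<psi> \<circ> inv_into U' \<psi>')"
        by (rule Cinf_on_subset[OF chart_transition[OF U' assms(1)]]) (use assms(3) in auto)
    qed
    moreover have "(f \<circ> inv_into U \<psi>) ((\<psi> \<circ> inv_into U' \<psi>') y) = (f \<circ> inv_into U' \<psi>') y"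
      if "y \<in> ?S" for y
      using inv[OF that] assms(3) chart_inverse[OF assms(1)] by auto
    ultimately show "Cinf_on ?S (f \<circ> inv_into U' \<psi>')"
      using Cinf_on_cong[OF S, of "\<lambda>y. (f \<circ> inv_into U \<psi>) ((\<psi> \<circ> inv_into U' \<psi>') y)"] by simp
  qed
qed

lemma smooth_fun_atE:
  assumes "(U, \<psi>) \<in> A" "p \<in> U" "smooth_fun_at A p f" "open V" "p \<in> V"
  obtains W where "open W" "p \<in> W" "W \<subseteq> U" "W \<subseteq> V" "open (\<psi> ` W)" "Cinf_on (\<psi> ` W) (f \<circ> inv_into U \<psi>)"
    "smooth_fun_on A W f"
proof -
  obtain W' where W': "open W'" "p \<in> W'" "smooth_fun_on A W' f"
    using assms(3) unfolding smooth_fun_at_def by blast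
  show ?thesis
  proof (rule that)
    show W: "open (W' \<inter> U \<inter> V)" "p \<in> W' \<inter> U \<inter> V" "W' \<inter> U \<inter> V \<subseteq> U" "W' \<inter> U \<inter> V \<subseteq> V"
      using W' assms chart_open[OF assms(1)] by auto
    show "open (\<psi> ` (W' \<inter> U \<inter> V))" by (rule chart_open_image[OF assms(1) W(1,3)])
    show sm: "smooth_fun_on A (W' \<inter> U \<inter> V) f" by (rule smooth_fun_on_subset[OF W'(3)]) auto
    show "Cinf_on (\<psi> ` (W' \<inter> U \<inter> V)) (f \<circ> inv_into U \<psi>)"
      using sm smooth_fun_on_chart_iff[OF assms(1) W(1,3)] by blast
  qed
qed

lemma smooth_fun_atI:
  "(U, \<psi>) \<in> A \<Longrightarrow> open W \<Longrightarrow> W \<subseteq> U \<Longrightarrow> p \<in> W \<Longrightarrow> Cinf_on (\<psi> ` W) (f \<circ> inv_into U \<psi>)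
    \<Longrightarrow> smooth_fun_at A p f"
  unfolding smooth_fun_at_def using smooth_fun_on_chart_iff by blast

lemma smooth_fun_at_cong:
  assumes "\<forall>\<^sub>F q in nhds p. f q = g q"
  shows "smooth_fun_at A p f \<longleftrightarrow> smooth_fun_at A p g"
proof -
  have *: "smooth_fun_at A p g" if eq: "\<forall>\<^sub>F q in nhds p. f q = g q" and "smooth_fun_at A p f" for f g
  proof -
    obtain V where V: "open V" "p \<in> V" "\<And>q. q \<in> V \<Longrightarrow> f q = g q"
      using eq unfolding eventually_nhds by blast
    obtain W where W: "open W" "p \<in> W" "smooth_fun_on A W f"
      using \<open>smooth_fun_at A p f\<close> unfolding smooth_fun_at_def by blast
    have "smooth_fun_on A (V \<inter> W) f" by (rule smooth_fun_on_subset[OF W(3)]) auto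
    then have "smooth_fun_on A (V \<inter> W) g" using smooth_fun_on_cong[of "V \<inter> W" f g] V W by auto
    then show ?thesis unfolding smooth_fun_at_def using V W by blast
  qed
  show ?thesis using *[OF assms] *[of g f] assms by (auto simp: eq_commute)
qed

lemma smooth_fun_at_eventually:
  "smooth_fun_at A p f \<Longrightarrow> \<forall>\<^sub>F q in nhds p. smooth_fun_at A q f"
  unfolding smooth_fun_at_def eventually_nhds by auto

lemma smooth_fun_at_const: "smooth_fun_at A p (\<lambda>q. c)"
proof -
  obtain U \<psi> where U: "(U, \<psi>) \<in> A" "p \<in> U" by (rule chart_exists)
  have "Cinf_on (\<psi> ` U) (\<lambda>y. c)"
    by (intro Cinf_on_const chart_open_image[OF U(1)] chart_open[OF U(1)] subset_refl)
  then show ?thesis using smooth_fun_atI[OF U(1) chart_open[OF U(1)] subset_refl U(2)] by (simp add: o_def)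
qed

lemma
  assumes "smooth_fun_at A p f" "smooth_fun_at A p g"
  shows smooth_fun_at_plus: "smooth_fun_at A p (\<lambda>q. f q + g q)"
    and smooth_fun_at_mult: "smooth_fun_at A p (\<lambda>q. f q * g q)"
proof -
  obtain U \<psi> where U: "(U, \<psi>) \<in> A" "p \<in> U" by (rule chart_exists)
  obtain W1 where W1: "open W1" "p \<in> W1" "W1 \<subseteq> U" "W1 \<subseteq> UNIV" "open (\<psi> ` W1)" "Cinf_on (\<psi> ` W1) (f \<circ> inv_into U \<psi>)"
    "smooth_fun_on A W1 f"
    by (rule smooth_fun_atE[OF U assms(1) open_UNIV UNIV_I])
  obtain W where W: "open W" "p \<in> W" "W \<subseteq> U" "W \<subseteq> W1" "open (\<psi> ` W)" "Cinf_on (\<psi> ` W) (g \<circ> inv_into U \<psi>)"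
    "smooth_fun_on A W g"
    by (rule smooth_fun_atE[OF U assms(2) W1(1,2)])
  have f: "Cinf_on (\<psi> ` W) (f \<circ> inv_into U \<psi>)"
    by (rule Cinf_on_subset[OF W1(6)]) (use W in auto)
  have "Cinf_on (\<psi> ` W) (\<lambda>y. (f \<circ> inv_into U \<psi>) y + (g \<circ> inv_into U \<psi>) y)"
    "Cinf_on (\<psi> ` W) (\<lambda>y. (f \<circ> inv_into U \<psi>) y * (g \<circ> inv_into U \<psi>) y)"
    by (rule Cinf_on_add[OF W(5) f W(6)], rule Cinf_on_mult[OF W(5) f W(6)])
  then show "smooth_fun_at A p (\<lambda>q. f q + g q)" "smooth_fun_at A p (\<lambda>q. f q * g q)"
    using smooth_fun_atI[OF U(1) W(1,3,2)] by (simp_all add: o_def)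
qed

lemma smooth_fun_at_cmult: "smooth_fun_at A p f \<Longrightarrow> smooth_fun_at A p (\<lambda>q. c * f q)"
  by (rule smooth_fun_at_mult[OF smooth_fun_at_const])

lemma smooth_fun_at_diff:
  "smooth_fun_at A p f \<Longrightarrow> smooth_fun_at A p g \<Longrightarrow> smooth_fun_at A p (\<lambda>q. f q - g q)"
  using smooth_fun_at_plus[OF _ smooth_fun_at_cmult[of p g "-1"]] by simp

lemma smooth_fun_at_sum:
  "(\<And>i. i \<in> I \<Longrightarrow> smooth_fun_at A p (f i)) \<Longrightarrow> smooth_fun_at A p (\<lambda>q. \<Sum>i\<in>I. f i q)"
  by (induction I rule: infinite_finite_induct) (auto intro: smooth_fun_at_const smooth_fun_at_plus)

lemma smooth_fun_at_coordinate:
  assumes "(U, \<psi>) \<in> A" "p \<in> U"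
  shows "smooth_fun_at A p (\<lambda>q. \<psi> q $ i)"
proof (rule smooth_fun_atI[OF assms(1) chart_open[OF assms(1)] subset_refl assms(2)])
  have o: "open (\<psi> ` U)" using chart_open_image[OF assms(1)] chart_open[OF assms(1)] by blast
  have "Cinf_on (\<psi> ` U) (\<lambda>y. y $ i)"
    by (rule Cinf_on_bounded_linear[OF o bounded_linear_vec_nth])
  moreover have "y $ i = ((\<lambda>q. \<psi> q $ i) \<circ> inv_into U \<psi>) y" if "y \<in> \<psi> ` U" for y
    using that chart_inverse[OF assms(1)] by auto
  ultimately show "Cinf_on (\<psi> ` U) ((\<lambda>q. \<psi> q $ i) \<circ> inv_into U \<psi>)"
    using Cinf_on_cong[OF o, of "\<lambda>y. y $ i"] by blast
qed

lemma tangent_iff: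
  "v \<in> tangent A p \<longleftrightarrow>
    (\<forall>f g. smooth_fun_at A p f \<longrightarrow> smooth_fun_at A p g \<longrightarrow>
      ((\<forall>\<^sub>F q in nhds p. f q = g q) \<longrightarrow> v f = v g) \<and>
      v (\<lambda>q. f q + g q) = v f + v g \<and>
      v (\<lambda>q. f q * g q) = v f * g p + f p * v g) \<and>
    (\<forall>c f. smooth_fun_at A p f \<longrightarrow> v (\<lambda>q. c * f q) = c * v f) \<and>
    (\<forall>f. \<not> smooth_fun_at A p f \<longrightarrow> v f = 0)"
  unfolding tangent_def plus_fun_def times_fun_def mem_Collect_eq ..

lemma tangentI:
  assumes "\<And>f g. smooth_fun_at A p f \<Longrightarrow> smooth_fun_at A p g \<Longrightarrow> \<forall>\<^sub>F q in nhds p. f q = g q \<Longrightarrow> v f = v g"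
    and "\<And>f g. smooth_fun_at A p f \<Longrightarrow> smooth_fun_at A p g \<Longrightarrow> v (\<lambda>q. f q + g q) = v f + v g"
    and "\<And>f g. smooth_fun_at A p f \<Longrightarrow> smooth_fun_at A p g \<Longrightarrow> v (\<lambda>q. f q * g q) = v f * g p + f p * v g"
    and "\<And>c f. smooth_fun_at A p f \<Longrightarrow> v (\<lambda>q. c * f q) = c * v f"
    and "\<And>f. \<not> smooth_fun_at A p f \<Longrightarrow> v f = 0"
  shows "v \<in> tangent A p"
  unfolding tangent_iff by (intro conjI allI impI) (rule assms; assumption)+

context
  fixes v p assumes v: "v \<in> tangent A p"
begin

lemmas tangent_rules = v[unfolded tangent_iff]

lemma tangent_nonsmooth: "\<not> smooth_fun_at A p f \<Longrightarrow> v f = 0"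
  by (rule tangent_rules[THEN conjunct2, THEN conjunct2, rule_format])

lemma tangent_cong:
  assumes "\<forall>\<^sub>F q in nhds p. f q = g q"
  shows "v f = v g"
proof (cases "smooth_fun_at A p f")
  case True
  moreover have "smooth_fun_at A p g" using True smooth_fun_at_cong[OF assms] by simp
  ultimately show ?thesis
    using tangent_rules[THEN conjunct1, rule_format, THEN conjunct1, rule_format] assms by blast
next
  case False
  moreover have "\<not> smooth_fun_at A p g" using False smooth_fun_at_cong[OF assms] by simp
  ultimately show ?thesis by (simp add: tangent_nonsmooth)
qed

lemma tangent_add: "smooth_fun_at A p f \<Longrightarrow> smooth_fun_at A p g \<Longrightarrow> v (\<lambda>q. f q + g q) = v f + v g"
  using tangent_rules[THEN conjunct1, rule_format, of f g] by simp

lemma tangent_mult: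
  "smooth_fun_at A p f \<Longrightarrow> smooth_fun_at A p g \<Longrightarrow> v (\<lambda>q. f q * g q) = v f * g p + f p * v g"
  using tangent_rules[THEN conjunct1, rule_format, of f g] by simp

lemma tangent_cmult: "smooth_fun_at A p f \<Longrightarrow> v (\<lambda>q. c * f q) = c * v f"
  by (rule tangent_rules[THEN conjunct2, THEN conjunct1, rule_format])

lemma tangent_const: "v (\<lambda>q. c) = 0"
proof -
  have "v (\<lambda>q. 1 * 1) = v (\<lambda>q. 1) * 1 + 1 * v (\<lambda>q. 1)"
    by (rule tangent_mult) (rule smooth_fun_at_const)+
  then have "v (\<lambda>q. 1) = 0" by simp
  then show ?thesis using tangent_cmult[OF smooth_fun_at_const, of c 1] by simp
qed

lemma tangent_diff:
  "smooth_fun_at A p f \<Longrightarrow> smooth_fun_at A p g \<Longrightarrow> v (\<lambda>q. f q - g q) = v f - v g"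
  using tangent_add[OF _ smooth_fun_at_cmult[of p g "-1"]] tangent_cmult[of g "-1"] by simp

lemma tangent_sum:
  "(\<And>i. i \<in> I \<Longrightarrow> smooth_fun_at A p (f i)) \<Longrightarrow> v (\<lambda>q. \<Sum>i\<in>I. f i q) = (\<Sum>i\<in>I. v (f i))"
  by (induction I rule: infinite_finite_induct)
    (auto simp: tangent_const tangent_add smooth_fun_at_sum)

end

lemma tangent_plus_mem:
  assumes "u \<in> tangent A p" "v \<in> tangent A p"
  shows "u + v \<in> tangent A p"
  using tangent_cong[OF assms(1)] tangent_cong[OF assms(2)]
  by (intro tangentI) (auto simp: tangent_add[OF assms(1)] tangent_add[OF assms(2)]
      tangent_mult[OF assms(1)] tangent_mult[OF assms(2)] tangent_cmult[OF assms(1)] tangent_cmult[OF assms(2)]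
      tangent_nonsmooth[OF assms(1)] tangent_nonsmooth[OF assms(2)] algebra_simps)

lemma tangent_scalev_mem:
  assumes "u \<in> tangent A p"
  shows "scalev c u \<in> tangent A p"
  using tangent_cong[OF assms(1)]
  by (intro tangentI) (auto simp: tangent_add[OF assms(1)] tangent_mult[OF assms(1)] tangent_cmult[OF assms(1)]
      tangent_nonsmooth[OF assms(1)] algebra_simps)

lemma tangent_zero_mem: "0 \<in> tangent A p"
  by (intro tangentI) auto

lemma tangent_sum_mem: "(\<And>i. i \<in> I \<Longrightarrow> v i \<in> tangent A p) \<Longrightarrow> (\<Sum>i\<in>I. v i) \<in> tangent A p"
  by (induction I rule: infinite_finite_induct) (auto intro: tangent_zero_mem tangent_plus_mem)

lemma diff_eq_plus_scalev: "u - v = u + scalev (- 1) v"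
  by (simp add: fun_eq_iff)

lemma uminus_eq_scalev: "- v = scalev (- 1) v"
  by (simp add: fun_eq_iff)

lemma tangent_diff_mem: "u \<in> tangent A p \<Longrightarrow> v \<in> tangent A p \<Longrightarrow> u - v \<in> tangent A p"
  unfolding diff_eq_plus_scalev by (intro tangent_plus_mem tangent_scalev_mem)

text \<open>The partial derivatives of a chart as vector fields, meaningful on its domain \<open>U\<close>. The value 0 on
  functions that are not smooth near \<open>q\<close> is the one that tangent vectors take there.\<close>

definition coord_field :: "'m set \<Rightarrow> ('m \<Rightarrow> real^3) \<Rightarrow> 3 \<Rightarrow> 'm vfield" where
  "coord_field U \<psi> i q f = (if smooth_fun_at A q f
     then frechet_derivative (f \<circ> inv_into U \<psi>) (at (\<psi> q)) (axis i 1) else 0)"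

lemma smooth_fun_at_has_derivative:
  assumes "(U, \<psi>) \<in> A" "p \<in> U" "smooth_fun_at A p f"
  shows "((f \<circ> inv_into U \<psi>) has_derivative frechet_derivative (f \<circ> inv_into U \<psi>) (at (\<psi> p))) (at (\<psi> p))"
proof -
  obtain W where W: "open W" "p \<in> W" "W \<subseteq> U" "W \<subseteq> UNIV" "open (\<psi> ` W)"
    "Cinf_on (\<psi> ` W) (f \<circ> inv_into U \<psi>)" "smooth_fun_on A W f"
    by (rule smooth_fun_atE[OF assms open_UNIV UNIV_I])
  show ?thesis by (rule Cinf_on_has_derivative[OF W(6)]) (use W(2) in blast)
qed

lemma coord_field_tangent:
  assumes U: "(U, \<psi>) \<in> A" "p \<in> U"
  shows "coord_field U \<psi> i p \<in> tangent A p"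
proof (rule tangentI)
  let ?c = "\<lambda>f. f \<circ> inv_into U \<psi>"
  let ?D = "\<lambda>f. frechet_derivative (?c f) (at (\<psi> p))"
  fix f g assume sm: "smooth_fun_at A p f" "smooth_fun_at A p g"
  note f = smooth_fun_at_has_derivative[OF U sm(1)]
  note g = smooth_fun_at_has_derivative[OF U sm(2)]
  have "?D (\<lambda>q. f q + g q) = (\<lambda>y. ?D f y + ?D g y)"
    using frechet_derivative_at[OF has_derivative_add[OF f g]] by (simp add: o_def)
  then show "coord_field U \<psi> i p (\<lambda>q. f q + g q) = coord_field U \<psi> i p f + coord_field U \<psi> i p g"
    using sm by (simp add: coord_field_def smooth_fun_at_plus)
  have "?D (\<lambda>q. f q * g q) = (\<lambda>y. f p * ?D g y + ?D f y * g p)"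
    using frechet_derivative_at[OF has_derivative_mult[OF f g]] chart_inverse[OF U] by (simp add: o_def)
  then show "coord_field U \<psi> i p (\<lambda>q. f q * g q) = coord_field U \<psi> i p f * g p + f p * coord_field U \<psi> i p g"
    using sm by (simp add: coord_field_def smooth_fun_at_mult)
  show "coord_field U \<psi> i p (\<lambda>q. c * f q) = c * coord_field U \<psi> i p f" for c
  proof -
    have "?D (\<lambda>q. c * f q) = (\<lambda>y. c * ?D f y)"
      using frechet_derivative_at[OF has_derivative_mult_right[OF f, of c]] by (simp add: o_def)
    then show ?thesis using sm by (simp add: coord_field_def smooth_fun_at_cmult)
  qed
  show "coord_field U \<psi> i p f = coord_field U \<psi> i p g" if eq: "\<forall>\<^sub>F q in nhds p. f q = g q"
  proof -
    obtain V where V: "open V" "p \<in> V" "\<And>q. q \<in> V \<Longrightarrow> f q = g q"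
      using eq unfolding eventually_nhds by blast
    have "?D f = ?D g"
    proof (rule frechet_derivative_cong_open)
      show "open (\<psi> ` (U \<inter> V))" using chart_open_image[OF U(1)] chart_open[OF U(1)] V(1) by auto
      show "\<psi> p \<in> \<psi> ` (U \<inter> V)" using U(2) V(2) by auto
      show "?c f y = ?c g y" if "y \<in> \<psi> ` (U \<inter> V)" for y
        using chart_inverse_image[OF U(1) _ that] V(3) by simp
    qed
    then show ?thesis using sm by (simp add: coord_field_def)
  qed
qed (simp add: coord_field_def)

lemma coord_field_smooth:
  assumes U: "(U, \<psi>) \<in> A" "p \<in> U" and f: "smooth_fun_at A p f"
  shows "smooth_fun_at A p (\<lambda>q. coord_field U \<psi> i q f)"
proof -
  obtain W where W: "open W" "p \<in> W" "W \<subseteq> U" "W \<subseteq> UNIV" "open (\<psi> ` W)"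
    "Cinf_on (\<psi> ` W) (f \<circ> inv_into U \<psi>)" "smooth_fun_on A W f"
    by (rule smooth_fun_atE[OF U f open_UNIV UNIV_I])
  show ?thesis
  proof (rule smooth_fun_atI[OF U(1) W(1,3,2)])
    have "((\<lambda>q. coord_field U \<psi> i q f) \<circ> inv_into U \<psi>) y =
        frechet_derivative (f \<circ> inv_into U \<psi>) (at y) (axis i 1)" if y: "y \<in> \<psi> ` W" for y
    proof -
      obtain q where "q \<in> W" "y = \<psi> q" using y by auto
      moreover have "smooth_fun_at A q f" using \<open>q \<in> W\<close> W(1,7) unfolding smooth_fun_at_def by blast
      ultimately show ?thesis using chart_inverse[OF U(1)] W(3) by (auto simp: coord_field_def)
    qed
    then show "Cinf_on (\<psi> ` W) ((\<lambda>q. coord_field U \<psi> i q f) \<circ> inv_into U \<psi>)"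
      using Cinf_on_cong[OF W(5), of "(\<lambda>q. coord_field U \<psi> i q f) \<circ> inv_into U \<psi>"]
        Cinf_on_frechet_derivative[OF W(5,6)] by simp
  qed
qed

lemma coord_field_coordinate:
  assumes U: "(U, \<psi>) \<in> A" "p \<in> U"
  shows "coord_field U \<psi> i p (\<lambda>q. \<psi> q $ j) = (if i = j then 1 else 0)"
proof -
  have "frechet_derivative ((\<lambda>q. \<psi> q $ j) \<circ> inv_into U \<psi>) (at (\<psi> p)) = frechet_derivative (\<lambda>y. y $ j) (at (\<psi> p))"
  proof (rule frechet_derivative_cong_open)
    show "open (\<psi> ` U)" using chart_open_image[OF U(1)] chart_open[OF U(1)] by auto
    show "((\<lambda>q. \<psi> q $ j) \<circ> inv_into U \<psi>) y = y $ j" if "y \<in> \<psi> ` U" for y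
      using that chart_inverse[OF U(1)] by auto
  qed (use U in auto)
  also have "\<dots> = (\<lambda>y. y $ j)"
    using frechet_derivative_at[OF bounded_linear_imp_has_derivative[OF bounded_linear_vec_nth]] by metis
  finally show ?thesis
    using smooth_fun_at_coordinate[OF U] by (simp add: coord_field_def axis_def)
qed

text \<open>A derivation applied to the Hadamard decomposition of \<open>f\<close> at \<open>p\<close> sees only the values at \<open>p\<close> of the
  coefficient functions, since the coordinate differences vanish there. Applied to the coordinate
  derivations themselves, this identifies those values.\<close>

lemma tangent_expansion_apply:
  assumes U: "(U, \<psi>) \<in> A" "p \<in> U" and v: "v \<in> tangent A p" and f: "smooth_fun_at A p f"
  shows "v f = (\<Sum>i\<in>UNIV. v (\<lambda>q. \<psi> q $ i) * coord_field U \<psi> i p f)"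
proof -
  let ?c = "f \<circ> inv_into U \<psi>"
  obtain W where W: "open W" "p \<in> W" "W \<subseteq> U" "W \<subseteq> UNIV" "open (\<psi> ` W)" "Cinf_on (\<psi> ` W) ?c" "smooth_fun_on A W f"
    by (rule smooth_fun_atE[OF U f open_UNIV UNIV_I])
  obtain r where r: "0 < r" "ball (\<psi> p) r \<subseteq> \<psi> ` W"
    using openE[OF W(5), of "\<psi> p"] W(2) by blast
  define B where "B = ball (\<psi> p) r"
  have B: "open B" "convex B" "\<psi> p \<in> B" "B \<subseteq> \<psi> ` W" using r by (auto simp: B_def)
  have "Cinf_on B ?c" by (rule Cinf_on_subset[OF W(6) B(4)])
  from Hadamard_decomposition[OF B(1-3) this] obtain h where
    h: "\<And>b. b \<in> Basis \<Longrightarrow> Cinf_on B (h b)" and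
    dec: "\<And>y. y \<in> B \<Longrightarrow> ?c y = ?c (\<psi> p) + (\<Sum>b\<in>Basis. ((y - \<psi> p) \<bullet> b) * h b y)" by blast
  \<comment> \<open>The coefficient functions are pulled back to the manifold; only their germs at \<open>p\<close> matter.\<close>
  define H where "H i q = h (axis i 1) (\<psi> q)" for i q
  define V where "V = U \<inter> \<psi> -` B"
  have V: "open V" "p \<in> V" "V \<subseteq> U" "\<psi> ` V = B"
    using continuous_open_preimage[OF chart_continuous_on[OF U(1)] chart_open[OF U(1)] B(1)] U(2) B(3,4) W(3)
    by (auto simp: V_def)
  have H: "smooth_fun_at A p (H i)" for i
  proof (rule smooth_fun_atI[OF U(1) V(1,3,2)])
    have "(H i \<circ> inv_into U \<psi>) y = h (axis i 1) y" if "y \<in> B" for y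
      using that V(3,4) chart_inverse[OF U(1)] by (auto simp: H_def)
    then show "Cinf_on (\<psi> ` V) (H i \<circ> inv_into U \<psi>)"
      unfolding V(4) using Cinf_on_cong[OF B(1), of "H i \<circ> inv_into U \<psi>"] h by simp
  qed
  have "\<forall>\<^sub>F q in nhds p. f q = f p + (\<Sum>i\<in>UNIV. (\<psi> q $ i - \<psi> p $ i) * H i q)"
    unfolding eventually_nhds
  proof (intro exI conjI ballI)
    fix q assume "q \<in> V"
    then have "\<psi> q \<in> B" "q \<in> U" using V by auto
    from dec[OF this(1)] show "f q = f p + (\<Sum>i\<in>UNIV. (\<psi> q $ i - \<psi> p $ i) * H i q)"
      using chart_inverse[OF U(1)] U(2) \<open>q \<in> U\<close>
      by (simp add: sum_Basis_vec inner_axis H_def)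
  qed (use V in auto)
  note near = this
  have key: "w f = (\<Sum>i\<in>UNIV. w (\<lambda>q. \<psi> q $ i) * H i p)" if w: "w \<in> tangent A p" for w
  proof -
    note sm = smooth_fun_at_const smooth_fun_at_coordinate[OF U] H smooth_fun_at_diff smooth_fun_at_mult
      smooth_fun_at_sum
    have "w f = w (\<lambda>q. f p + (\<Sum>i\<in>UNIV. (\<psi> q $ i - \<psi> p $ i) * H i q))"
      by (rule tangent_cong[OF w near])
    also have "\<dots> = (\<Sum>i\<in>UNIV. w (\<lambda>q. (\<psi> q $ i - \<psi> p $ i) * H i q))"
      by (simp add: tangent_add[OF w] tangent_const[OF w] tangent_sum[OF w] sm)
    also have "\<dots> = (\<Sum>i\<in>UNIV. w (\<lambda>q. \<psi> q $ i) * H i p)"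
      by (simp add: tangent_mult[OF w] tangent_diff[OF w] tangent_const[OF w] sm)
    finally show ?thesis .
  qed
  have "coord_field U \<psi> i p f = H i p" for i
    using key[OF coord_field_tangent[OF U]] by (simp add: coord_field_coordinate[OF U] if_distrib if_distribR cong: if_cong)
  then show ?thesis using key[OF v] by simp
qed

lemma tangent_expansion:
  assumes U: "(U, \<psi>) \<in> A" "p \<in> U" and v: "v \<in> tangent A p"
  shows "v = (\<Sum>i\<in>UNIV. scalev (v (\<lambda>q. \<psi> q $ i)) (coord_field U \<psi> i p))"
proof
  fix f
  show "v f = (\<Sum>i\<in>UNIV. scalev (v (\<lambda>q. \<psi> q $ i)) (coord_field U \<psi> i p)) f"
  proof (cases "smooth_fun_at A p f")
    case True
    then show ?thesis using tangent_expansion_apply[OF assms] by (simp add: sum_fun_apply)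
  next
    case False
    then show ?thesis using tangent_nonsmooth[OF v] by (simp add: sum_fun_apply coord_field_def)
  qed
qed

lemma chart_vector_eq_0:
  assumes "(U, \<psi>) \<in> A" "p \<in> U" "v \<in> tangent A p" "chart_vector \<psi> v = 0"
  shows "v = 0"
proof
  fix f
  have "v (\<lambda>q. \<psi> q $ i) = 0" for i
    using assms(4) by (auto simp: chart_vector_def vec_eq_iff)
  then show "v f = 0 f"
    using tangent_expansion_apply[OF assms(1-3)] tangent_nonsmooth[OF assms(3)]
    by (cases "smooth_fun_at A p f") auto
qed

lemma chart_vector_derivative:
  assumes U: "(U, \<psi>) \<in> A" "p \<in> U" and v: "v \<in> tangent A p" and f: "smooth_fun_at A p f"
  shows "v f = frechet_derivative (f \<circ> inv_into U \<psi>) (at (\<psi> p)) (chart_vector \<psi> v)"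
proof -
  let ?D = "frechet_derivative (f \<circ> inv_into U \<psi>) (at (\<psi> p))"
  have "chart_vector \<psi> v = (\<Sum>i\<in>UNIV. v (\<lambda>q. \<psi> q $ i) *\<^sub>R axis i 1)"
    by (simp add: chart_vector_def vec_eq_iff axis_def if_distrib cong: if_cong)
  then have "?D (chart_vector \<psi> v) = (\<Sum>i\<in>UNIV. v (\<lambda>q. \<psi> q $ i) * ?D (axis i 1))"
    using has_derivative_linear[OF smooth_fun_at_has_derivative[OF U f]]
    by (simp add: linear_sum linear_scale)
  then show ?thesis
    using tangent_expansion_apply[OF U v f] f by (simp add: coord_field_def)
qed

end

section \<open>Vector fields\<close>

context smooth_atlas
begin

text \<open>Smoothness is a local condition, so smooth vector fields are characterized by their action on
  germs. In this form their closure properties reduce to those of smooth functions.\<close>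

lemma vfield_on_iff_pointwise:
  assumes "open W"
  shows "vfield_on A W X \<longleftrightarrow>
    (\<forall>q\<in>W. X q \<in> tangent A q \<and> (\<forall>f. smooth_fun_at A q f \<longrightarrow> smooth_fun_at A q (\<lambda>r. X r f)))"
proof (intro iffI ballI conjI allI impI)
  fix q f
  assume X: "vfield_on A W X" and q: "q \<in> W"
  show "X q \<in> tangent A q" using X q by (simp add: vfield_on_def)
  assume "smooth_fun_at A q f"
  then obtain V where V: "open V" "q \<in> V" "smooth_fun_on A V f" unfolding smooth_fun_at_def by auto
  have "open (V \<inter> W)" "V \<inter> W \<subseteq> W" "smooth_fun_on A (V \<inter> W) f"
    using V assms smooth_fun_on_subset[OF V(3)] by auto
  then have "smooth_fun_on A (V \<inter> W) (\<lambda>r. X r f)" using X by (simp add: vfield_on_def)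
  then show "smooth_fun_at A q (\<lambda>r. X r f)"
    using V q \<open>open (V \<inter> W)\<close> unfolding smooth_fun_at_def by auto
next
  assume *: "\<forall>q\<in>W. X q \<in> tangent A q \<and> (\<forall>f. smooth_fun_at A q f \<longrightarrow> smooth_fun_at A q (\<lambda>r. X r f))"
  show "vfield_on A W X"
    unfolding vfield_on_def
  proof (intro conjI ballI allI impI)
    fix V f assume V: "open V" "V \<subseteq> W" "smooth_fun_on A V f"
    show "smooth_fun_on A V (\<lambda>q. X q f)"
    proof (rule smooth_fun_on_local)
      fix q assume "q \<in> V"
      moreover have "smooth_fun_at A q f" using V(1,3) \<open>q \<in> V\<close> by (auto simp: smooth_fun_at_def)
      ultimately show "smooth_fun_at A q (\<lambda>q. X q f)" using * V(2) by auto
    qed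
  qed (use * in auto)
qed

lemma vfield_at_iff:
  "vfield_at A p X \<longleftrightarrow> (\<forall>\<^sub>F q in nhds p. X q \<in> tangent A q \<and>
     (\<forall>f. smooth_fun_at A q f \<longrightarrow> smooth_fun_at A q (\<lambda>r. X r f)))"
  unfolding vfield_at_def eventually_nhds by (simp add: vfield_on_iff_pointwise cong: conj_cong)

lemma vfield_at_pointwise:
  assumes "vfield_at A p X"
  shows "X p \<in> tangent A p \<and> (\<forall>f. smooth_fun_at A p f \<longrightarrow> smooth_fun_at A p (\<lambda>r. X r f))"
  using eventually_nhds_x_imp_x[OF assms[unfolded vfield_at_iff]] .

lemma vfield_at_tangent: "vfield_at A p X \<Longrightarrow> X p \<in> tangent A p"
  and vfield_at_smooth: "vfield_at A p X \<Longrightarrow> smooth_fun_at A p f \<Longrightarrow> smooth_fun_at A p (\<lambda>q. X q f)"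
  by (auto dest: vfield_at_pointwise)

lemma vfield_on_iff:
  assumes "open W"
  shows "vfield_on A W X \<longleftrightarrow> (\<forall>q\<in>W. vfield_at A q X)"
proof
  show "\<forall>q\<in>W. vfield_at A q X" if "vfield_on A W X" using that assms by (auto simp: vfield_at_def)
  show "vfield_on A W X" if "\<forall>q\<in>W. vfield_at A q X"
    unfolding vfield_on_iff_pointwise[OF assms] using that vfield_at_pointwise by blast
qed

lemma vfield_at_eventually: "vfield_at A p X \<Longrightarrow> \<forall>\<^sub>F q in nhds p. vfield_at A q X"
  unfolding vfield_at_iff by (simp add: eventually_eventually)

lemma vfield_at_tangent_eventually:
  "vfield_at A p X \<Longrightarrow> \<forall>\<^sub>F q in nhds p. X q \<in> tangent A q"
  by (rule eventually_mono[OF vfield_at_eventually vfield_at_tangent])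

lemma vfield_at_add:
  assumes "vfield_at A p X" "vfield_at A p Y"
  shows "vfield_at A p (X + Y)"
  unfolding vfield_at_iff
  using vfield_at_eventually[OF assms(1)] vfield_at_eventually[OF assms(2)]
proof eventually_elim
  case (elim q)
  note pointwise = vfield_at_pointwise[OF elim(1)] vfield_at_pointwise[OF elim(2)]
  show ?case using pointwise by (simp add: tangent_plus_mem smooth_fun_at_plus)
qed

lemma vfield_at_scalef:
  assumes "smooth_fun_at A p h" "vfield_at A p X"
  shows "vfield_at A p (scalef h X)"
  unfolding vfield_at_iff
  using smooth_fun_at_eventually[OF assms(1)] vfield_at_eventually[OF assms(2)]
proof eventually_elim
  case (elim q)
  note pointwise = vfield_at_pointwise[OF elim(2)]
  show ?case using pointwise elim(1) by (simp add: tangent_scalev_mem smooth_fun_at_mult scalef_apply)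
qed

lemma vfield_at_zero: "vfield_at A p 0"
  unfolding vfield_at_iff by (simp add: tangent_zero_mem smooth_fun_at_const)

lemma vfield_at_sum: "(\<And>i. i \<in> I \<Longrightarrow> vfield_at A p (Y i)) \<Longrightarrow> vfield_at A p (\<Sum>i\<in>I. Y i)"
  by (induction I rule: infinite_finite_induct) (auto intro: vfield_at_zero vfield_at_add)

lemma vfield_at_coord_field:
  assumes "(U, \<psi>) \<in> A" "p \<in> U"
  shows "vfield_at A p (coord_field U \<psi> i)"
proof -
  have "\<forall>\<^sub>F q in nhds p. q \<in> U" using eventually_nhds_in_open[OF chart_open[OF assms(1)] assms(2)] .
  then show ?thesis unfolding vfield_at_iff
    by eventually_elim (simp add: coord_field_tangent[OF assms(1)] coord_field_smooth[OF assms(1)])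
qed

text \<open>A tangent vector extends with constant coefficients in a chart, so the choice made by \<open>ext\<close> succeeds.\<close>

lemma ext_spec:
  assumes v: "v \<in> tangent A p"
  shows "vfield_at A p (ext A p v)" and "ext A p v p = v"
proof -
  obtain U \<psi> where U: "(U, \<psi>) \<in> A" "p \<in> U" by (rule chart_exists)
  let ?V = "\<Sum>i\<in>UNIV. scalef (\<lambda>_. v (\<lambda>q. \<psi> q $ i)) (coord_field U \<psi> i)"
  have "vfield_at A p ?V"
    by (intro vfield_at_sum vfield_at_scalef smooth_fun_at_const vfield_at_coord_field U)
  moreover have "?V p = v"
    using tangent_expansion[OF U v] by (simp add: sum_fun_apply scalef_apply)
  ultimately have "vfield_at A p (ext A p v) \<and> ext A p v p = v"
    unfolding ext_def by (intro someI[of "\<lambda>V. vfield_at A p V \<and> V p = v"]) auto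
  then show "vfield_at A p (ext A p v)" "ext A p v p = v" by auto
qed

context
  fixes Y p assumes Y: "vfield_at A p Y"
begin

lemma vfield_apply_add:
  assumes "smooth_fun_at A p f" "smooth_fun_at A p g"
  shows "\<forall>\<^sub>F q in nhds p. Y q (\<lambda>r. f r + g r) = Y q f + Y q g"
  using vfield_at_tangent_eventually[OF Y] smooth_fun_at_eventually[OF assms(1)] smooth_fun_at_eventually[OF assms(2)]
  by eventually_elim (simp add: tangent_add)

lemma vfield_apply_mult:
  assumes "smooth_fun_at A p f" "smooth_fun_at A p g"
  shows "\<forall>\<^sub>F q in nhds p. Y q (\<lambda>r. f r * g r) = Y q f * g q + f q * Y q g"
  using vfield_at_tangent_eventually[OF Y] smooth_fun_at_eventually[OF assms(1)] smooth_fun_at_eventually[OF assms(2)]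
  by eventually_elim (simp add: tangent_mult)

lemma vfield_apply_cmult:
  assumes "smooth_fun_at A p f"
  shows "\<forall>\<^sub>F q in nhds p. Y q (\<lambda>r. c * f r) = c * Y q f"
  using vfield_at_tangent_eventually[OF Y] smooth_fun_at_eventually[OF assms(1)]
  by eventually_elim (simp add: tangent_cmult)

lemma vfield_apply_cong:
  assumes "\<forall>\<^sub>F q in nhds p. f q = g q"
  shows "\<forall>\<^sub>F q in nhds p. Y q f = Y q g"
proof -
  have "\<forall>\<^sub>F q in nhds p. \<forall>\<^sub>F r in nhds q. f r = g r" using assms by (simp add: eventually_eventually)
  then show ?thesis using vfield_at_tangent_eventually[OF Y]
    by eventually_elim (simp add: tangent_cong)
qed

end

lemma bracket_tangent:
  assumes X: "vfield_at A p X" and Y: "vfield_at A p Y"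
  shows "bracket A X Y p \<in> tangent A p"
proof (rule tangentI)
  note Xp = vfield_at_tangent[OF X] and Yp = vfield_at_tangent[OF Y]
  fix f g assume sm: "smooth_fun_at A p f" "smooth_fun_at A p g"
  note smX = vfield_at_smooth[OF X sm(1)] vfield_at_smooth[OF X sm(2)]
  note smY = vfield_at_smooth[OF Y sm(1)] vfield_at_smooth[OF Y sm(2)]
  show "bracket A X Y p (\<lambda>q. f q + g q) = bracket A X Y p f + bracket A X Y p g"
    using sm tangent_cong[OF Xp vfield_apply_add[OF Y sm]] tangent_cong[OF Yp vfield_apply_add[OF X sm]]
    by (simp add: bracket_def smooth_fun_at_plus tangent_add[OF Xp smY] tangent_add[OF Yp smX])
  show "bracket A X Y p (\<lambda>q. f q * g q) = bracket A X Y p f * g p + f p * bracket A X Y p g"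
    using sm tangent_cong[OF Xp vfield_apply_mult[OF Y sm]] tangent_cong[OF Yp vfield_apply_mult[OF X sm]]
    by (simp add: bracket_def smooth_fun_at_mult smX smY tangent_add[OF Xp] tangent_add[OF Yp]
        tangent_mult[OF Xp] tangent_mult[OF Yp] algebra_simps)
  show "bracket A X Y p (\<lambda>q. c * f q) = c * bracket A X Y p f" for c
    using sm(1) tangent_cong[OF Xp vfield_apply_cmult[OF Y sm(1)]] tangent_cong[OF Yp vfield_apply_cmult[OF X sm(1)]]
    by (simp add: bracket_def smooth_fun_at_cmult tangent_cmult[OF Xp smY(1)] tangent_cmult[OF Yp smX(1)] algebra_simps)
  show "bracket A X Y p f = bracket A X Y p g" if "\<forall>\<^sub>F q in nhds p. f q = g q"
    using sm tangent_cong[OF Xp vfield_apply_cong[OF Y that]] tangent_cong[OF Yp vfield_apply_cong[OF X that]]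
    by (simp add: bracket_def)
qed (simp add: bracket_def)

lemma vfield_at_bracket:
  assumes X: "vfield_at A p X" and Y: "vfield_at A p Y"
  shows "vfield_at A p (bracket A X Y)"
  unfolding vfield_at_iff
  using vfield_at_eventually[OF X] vfield_at_eventually[OF Y]
proof eventually_elim
  case (elim q)
  have "smooth_fun_at A q (\<lambda>r. bracket A X Y r f)" if f: "smooth_fun_at A q f" for f
  proof -
    have "\<forall>\<^sub>F r in nhds q. X r (\<lambda>s. Y s f) - Y r (\<lambda>s. X s f) = bracket A X Y r f"
      using smooth_fun_at_eventually[OF f] by eventually_elim (simp add: bracket_def)
    from smooth_fun_at_cong[OF this] show ?thesis
      using vfield_at_smooth[OF elim(1) vfield_at_smooth[OF elim(2) f]]
        vfield_at_smooth[OF elim(2) vfield_at_smooth[OF elim(1) f]] smooth_fun_at_diff by blast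
  qed
  then show ?case using bracket_tangent[OF elim] by auto
qed

lemma bracket_apply:
  "smooth_fun_at A p f \<Longrightarrow> bracket A X Y p f = X p (\<lambda>q. Y q f) - Y p (\<lambda>q. X q f)"
  by (simp add: bracket_def)

lemma bracket_antisym: "bracket A Y X p = - bracket A X Y p"
  by (simp add: bracket_def fun_eq_iff)

lemma bracket_add_right:
  assumes X: "vfield_at A p X" and Y: "vfield_at A p Y" and Z: "vfield_at A p Z"
  shows "bracket A X (Y + Z) p = bracket A X Y p + bracket A X Z p"
proof
  fix f
  show "bracket A X (Y + Z) p f = (bracket A X Y p + bracket A X Z p) f"
    using tangent_add[OF vfield_at_tangent[OF X] vfield_at_smooth[OF Y] vfield_at_smooth[OF Z], of f]
    by (simp add: bracket_def)
qed

lemma bracket_scalef_right: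
  assumes X: "vfield_at A p X" and Y: "vfield_at A p Y" and h: "smooth_fun_at A p h"
  shows "bracket A X (scalef h Y) p = scalev (X p h) (Y p) + scalev (h p) (bracket A X Y p)"
proof
  fix f
  show "bracket A X (scalef h Y) p f = (scalev (X p h) (Y p) + scalev (h p) (bracket A X Y p)) f"
    using tangent_mult[OF vfield_at_tangent[OF X] h vfield_at_smooth[OF Y], of f]
      tangent_nonsmooth[OF vfield_at_tangent[OF Y], of f]
    by (simp add: bracket_def scalef_apply algebra_simps)
qed

lemma bracket_Jacobi:
  assumes X: "vfield_at A p X" and Y: "vfield_at A p Y" and Z: "vfield_at A p Z"
  shows "bracket A X (bracket A Y Z) p = bracket A (bracket A X Y) Z p + bracket A Y (bracket A X Z) p"
proof
  fix f
  show "bracket A X (bracket A Y Z) p f = (bracket A (bracket A X Y) Z p + bracket A Y (bracket A X Z) p) f"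
  proof (cases "smooth_fun_at A p f")
    case True
    have ev: "\<forall>\<^sub>F q in nhds p. bracket A V W q f = V q (\<lambda>r. W r f) - W q (\<lambda>r. V r f)" for V W
      using smooth_fun_at_eventually[OF True] by eventually_elim (simp add: bracket_def)
    have br: "u (\<lambda>q. bracket A V W q f) = u (\<lambda>q. V q (\<lambda>r. W r f)) - u (\<lambda>q. W q (\<lambda>r. V r f))"
      if u: "u \<in> tangent A p" and V: "vfield_at A p V" and W: "vfield_at A p W" for u V W
      using tangent_cong[OF u ev[of V W]]
        tangent_diff[OF u vfield_at_smooth[OF V vfield_at_smooth[OF W True]] vfield_at_smooth[OF W vfield_at_smooth[OF V True]]]
      by simp
    show ?thesis
      using br[OF vfield_at_tangent[OF X] Y Z] br[OF vfield_at_tangent[OF Y] X Z] br[OF vfield_at_tangent[OF Z] X Y]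
      by (simp add: bracket_apply[OF True] bracket_apply[OF vfield_at_smooth[OF X True]]
          bracket_apply[OF vfield_at_smooth[OF Y True]] bracket_apply[OF vfield_at_smooth[OF Z True]])
  qed (simp add: bracket_def)
qed

lemma smooth_fun_at_indicator:
  "open W \<Longrightarrow> p \<in> W \<Longrightarrow> smooth_fun_at A p (\<lambda>q. if q \<in> W then 1 else 0)"
  using smooth_fun_at_cong[of "\<lambda>q. 1" "\<lambda>q. if q \<in> W then 1 else 0" p] smooth_fun_at_const[of p 1]
    eventually_nhds_in_open[of W p] by (auto elim: eventually_mono)

text \<open>Multiplication by the indicator function of a small neighbourhood, which is smooth near \<open>p\<close> and has
  value 1 there, removes the difference between \<open>Y\<close> and \<open>Z\<close> without changing \<open>\<Phi>\<close>.\<close>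

lemma tensorial_local:
  fixes \<Phi> :: "'m vfield \<Rightarrow> real"
  assumes scale: "\<And>f Y. smooth_fun_at A p f \<Longrightarrow> vfield_at A p Y \<Longrightarrow> \<Phi> (scalef f Y) = f p * \<Phi> Y"
    and "vfield_at A p Y" "vfield_at A p Z" "\<forall>\<^sub>F q in nhds p. Y q = Z q"
  shows "\<Phi> Y = \<Phi> Z"
proof -
  obtain W where W: "open W" "p \<in> W" "\<And>q. q \<in> W \<Longrightarrow> Y q = Z q"
    using assms(4) unfolding eventually_nhds by auto
  let ?f = "\<lambda>q. if q \<in> W then 1 else 0"
  have "scalef ?f Y = scalef ?f Z" using W(3) by (auto simp: scalef_apply fun_eq_iff)
  then show ?thesis
    using scale[OF smooth_fun_at_indicator[OF W(1,2)] assms(2)] scale[OF smooth_fun_at_indicator[OF W(1,2)] assms(3)] W(2)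
    by simp
qed

text \<open>In a coordinate frame near \<open>p\<close>, linearity over smooth functions expresses \<open>\<Phi> Y\<close> by the components of
  \<open>Y\<close> at \<open>p\<close>.\<close>

lemma tensorial:
  fixes \<Phi> :: "'m vfield \<Rightarrow> real"
  assumes add: "\<And>Y Z. vfield_at A p Y \<Longrightarrow> vfield_at A p Z \<Longrightarrow> \<Phi> (Y + Z) = \<Phi> Y + \<Phi> Z"
    and scale: "\<And>f Y. smooth_fun_at A p f \<Longrightarrow> vfield_at A p Y \<Longrightarrow> \<Phi> (scalef f Y) = f p * \<Phi> Y"
    and Y: "vfield_at A p Y" and Z: "vfield_at A p Z" and eq: "Y p = Z p"
  shows "\<Phi> Y = \<Phi> Z"
proof -
  obtain U \<psi> where U: "(U, \<psi>) \<in> A" "p \<in> U" by (rule chart_exists)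
  have zero: "\<Phi> 0 = 0" using add[OF vfield_at_zero vfield_at_zero] by simp
  have sum: "\<Phi> (\<Sum>i\<in>I. V i) = (\<Sum>i\<in>I. \<Phi> (V i))" if "\<And>i. vfield_at A p (V i)" for I :: "3 set" and V
  proof -
    have "finite I" by simp
    then show ?thesis
    proof (induction I rule: finite_induct)
      case empty
      then show ?case by (simp only: sum.empty zero)
    next
      case (insert i I)
      have "\<Phi> (V i + (\<Sum>i\<in>I. V i)) = \<Phi> (V i) + \<Phi> (\<Sum>i\<in>I. V i)"
        by (rule add[OF that vfield_at_sum]) (rule that)
      then show ?case unfolding sum.insert[OF insert.hyps] insert.IH .
    qed
  qed
  have "\<Phi> V = (\<Sum>i\<in>UNIV. V p (\<lambda>q. \<psi> q $ i) * \<Phi> (coord_field U \<psi> i))" if V: "vfield_at A p V" for V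
  proof -
    let ?V = "\<Sum>i\<in>UNIV. scalef (\<lambda>r. V r (\<lambda>q. \<psi> q $ i)) (coord_field U \<psi> i)"
    note sm = vfield_at_smooth[OF V smooth_fun_at_coordinate[OF U]]
    note vf = vfield_at_scalef[OF sm vfield_at_coord_field[OF U]]
    have "\<forall>\<^sub>F q in nhds p. V q = ?V q"
      using vfield_at_tangent_eventually[OF V] eventually_nhds_in_open[OF chart_open[OF U(1)] U(2)]
    proof eventually_elim
      case (elim q)
      show ?case using tangent_expansion[OF U(1) elim(2,1)] by (simp add: sum_fun_apply scalef_apply)
    qed
    then have "\<Phi> V = \<Phi> ?V" by (intro tensorial_local[OF scale V]) (auto intro: vfield_at_sum vf)
    then show ?thesis by (simp add: sum[OF vf] scale[OF sm vfield_at_coord_field[OF U]])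
  qed
  from this[OF Y] this[OF Z] show ?thesis by (simp add: eq)
qed

end

section \<open>Affine connections and the tensoriality of curvature\<close>

locale atlas_with_connection = smooth_atlas A for A :: "('m::t2_space) chart set" +
  fixes D :: "'m connection"
  assumes connection: "affine_connection A D"
begin

context
  fixes p u Y
  assumes u: "u \<in> tangent A p" and Y: "vfield_at A p Y"
begin

lemma D_tangent: "D p u Y \<in> tangent A p"
  and D_plus_left: "v \<in> tangent A p \<Longrightarrow> D p (u + v) Y = D p u Y + D p v Y"
  and D_scale_left: "D p (scalev c u) Y = scalev c (D p u Y)"
  and D_plus: "vfield_at A p Z \<Longrightarrow> D p u (Y + Z) = D p u Y + D p u Z"
  and D_Leibniz: "smooth_fun_at A p f \<Longrightarrow> D p u (scalef f Y) = scalev (u f) (Y p) + scalev (f p) (D p u Y)"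
  using connection[unfolded affine_connection_def, THEN conjunct1, rule_format, OF u u Y Y smooth_fun_at_const]
    connection[unfolded affine_connection_def, THEN conjunct1, rule_format, OF u _ Y Y smooth_fun_at_const]
    connection[unfolded affine_connection_def, THEN conjunct1, rule_format, OF u u Y _ smooth_fun_at_const]
    connection[unfolded affine_connection_def, THEN conjunct1, rule_format, OF u u Y Y]
  by auto

end

lemma vfield_at_D:
  assumes "vfield_at A p U" "vfield_at A p Y"
  shows "vfield_at A p (\<lambda>q. D q (U q) Y)"
proof -
  obtain W where W: "open W" "p \<in> W" "\<And>q. q \<in> W \<Longrightarrow> vfield_at A q U \<and> vfield_at A q Y"
    using eventually_conj[OF vfield_at_eventually[OF assms(1)] vfield_at_eventually[OF assms(2)]]
    unfolding eventually_nhds by auto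
  then have "vfield_on A W U" "vfield_on A W Y" by (simp_all add: vfield_on_iff)
  then have "vfield_on A W (\<lambda>q. D q (U q) Y)"
    using connection W(1) unfolding affine_connection_def by auto
  then show ?thesis using W(1,2) unfolding vfield_at_def by auto
qed

text \<open>The Leibniz rule for the indicator function of a neighbourhood, whose derivative at \<open>p\<close> vanishes.\<close>

lemma D_local:
  assumes u: "u \<in> tangent A p" and Y: "vfield_at A p Y" and Z: "vfield_at A p Z" and eq: "\<forall>\<^sub>F q in nhds p. Y q = Z q"
  shows "D p u Y = D p u Z"
proof -
  obtain W where W: "open W" "p \<in> W" "\<And>q. q \<in> W \<Longrightarrow> Y q = Z q"
    using eq unfolding eventually_nhds by auto
  let ?f = "\<lambda>q. if q \<in> W then 1 else 0 :: real"
  have sm: "smooth_fun_at A p ?f" by (rule smooth_fun_at_indicator[OF W(1,2)])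
  have "u ?f = u (\<lambda>q. 1)"
    by (rule tangent_cong[OF u]) (use eventually_nhds_in_open[OF W(1,2)] in \<open>auto elim: eventually_mono\<close>)
  then have "u ?f = 0" by (simp add: tangent_const[OF u])
  moreover have "scalef ?f Y = scalef ?f Z" using W(3) by (auto simp: scalef_apply fun_eq_iff)
  moreover have "D p u (scalef ?f Y) = D p u Y" "D p u (scalef ?f Z) = D p u Z"
    using D_Leibniz[OF u Y sm] D_Leibniz[OF u Z sm] W(2) \<open>u ?f = 0\<close> by (auto simp: fun_eq_iff)
  ultimately show ?thesis by simp
qed

lemma D_diff_left:
  "u \<in> tangent A p \<Longrightarrow> v \<in> tangent A p \<Longrightarrow> vfield_at A p Y \<Longrightarrow> D p (u - v) Y = D p u Y - D p v Y"
  unfolding diff_eq_plus_scalev by (simp add: D_plus_left D_scale_left tangent_scalev_mem)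

lemma D_uminus_left: "u \<in> tangent A p \<Longrightarrow> vfield_at A p Y \<Longrightarrow> D p (- u) Y = - D p u Y"
  unfolding uminus_eq_scalev by (simp add: D_scale_left)

lemma curvature_antisym:
  assumes "vfield_at A p U" "vfield_at A p V" "vfield_at A p W"
  shows "curvature A D V U W p = - curvature A D U V W p"
  using D_uminus_left[OF bracket_tangent[OF assms(1,2)] assms(3)]
  by (simp add: curvature_def bracket_antisym[of V U] fun_eq_iff)

lemma curvature_plus_last:
  assumes U: "vfield_at A p U" and V: "vfield_at A p V" and Y: "vfield_at A p Y" and Z: "vfield_at A p Z"
  shows "curvature A D U V (Y + Z) p = curvature A D U V Y p + curvature A D U V Z p"
proof -
  have *: "D p (V' p) (\<lambda>q. D q (U' q) (Y + Z)) = D p (V' p) (\<lambda>q. D q (U' q) Y) + D p (V' p) (\<lambda>q. D q (U' q) Z)"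
    if U': "vfield_at A p U'" and V': "vfield_at A p V'" for U' V'
  proof -
    have "\<forall>\<^sub>F q in nhds p. D q (U' q) (Y + Z) = ((\<lambda>q. D q (U' q) Y) + (\<lambda>q. D q (U' q) Z)) q"
      using vfield_at_tangent_eventually[OF U'] vfield_at_eventually[OF Y] vfield_at_eventually[OF Z]
      by eventually_elim (simp add: D_plus)
    then show ?thesis
      using D_local[OF vfield_at_tangent[OF V'] vfield_at_D[OF U' vfield_at_add[OF Y Z]]
          vfield_at_add[OF vfield_at_D[OF U' Y] vfield_at_D[OF U' Z]]]
        D_plus[OF vfield_at_tangent[OF V'] vfield_at_D[OF U' Y] vfield_at_D[OF U' Z]] by simp
  qed
  show ?thesis
    by (simp add: curvature_def *[OF U V] *[OF V U] D_plus[OF bracket_tangent[OF U V] Y Z])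
qed

text \<open>The second derivatives of \<open>f\<close> that arise from the two iterated covariant derivatives differ by the
  derivative of \<open>f\<close> along \<open>[U, V]\<close>, which the third term of the curvature removes; the products of
  first derivatives are symmetric in \<open>U\<close> and \<open>V\<close>.\<close>

lemma curvature_scalef_last:
  assumes U: "vfield_at A p U" and V: "vfield_at A p V" and Y: "vfield_at A p Y" and f: "smooth_fun_at A p f"
  shows "curvature A D U V (scalef f Y) p = scalev (f p) (curvature A D U V Y p)"
proof -
  have *: "D p (V' p) (\<lambda>q. D q (U' q) (scalef f Y)) =
      scalev (V' p (\<lambda>q. U' q f)) (Y p) + scalev (U' p f) (D p (V' p) Y)
      + (scalev (V' p f) (D p (U' p) Y) + scalev (f p) (D p (V' p) (\<lambda>q. D q (U' q) Y)))"
    if U': "vfield_at A p U'" and V': "vfield_at A p V'" for U' V'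
  proof -
    note sm = vfield_at_smooth[OF U' f]
    note vf = vfield_at_scalef[OF sm Y] vfield_at_scalef[OF f vfield_at_D[OF U' Y]]
    have "\<forall>\<^sub>F q in nhds p. D q (U' q) (scalef f Y) = (scalef (\<lambda>q. U' q f) Y + scalef f (\<lambda>q. D q (U' q) Y)) q"
      using vfield_at_tangent_eventually[OF U'] vfield_at_eventually[OF Y] smooth_fun_at_eventually[OF f]
      by eventually_elim (simp add: D_Leibniz scalef_apply)
    then have "D p (V' p) (\<lambda>q. D q (U' q) (scalef f Y)) = D p (V' p) (scalef (\<lambda>q. U' q f) Y + scalef f (\<lambda>q. D q (U' q) Y))"
      using D_local[OF vfield_at_tangent[OF V'] vfield_at_D[OF U' vfield_at_scalef[OF f Y]] vfield_at_add[OF vf]] by simp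
    then show ?thesis
      using D_plus[OF vfield_at_tangent[OF V'] vf] D_Leibniz[OF vfield_at_tangent[OF V'] Y sm]
        D_Leibniz[OF vfield_at_tangent[OF V'] vfield_at_D[OF U' Y] f] by simp
  qed
  show ?thesis
    by (simp add: curvature_def *[OF U V] *[OF V U] D_Leibniz[OF bracket_tangent[OF U V] Y f]
        bracket_apply[OF f] fun_eq_iff algebra_simps)
qed

lemma curvature_plus_middle:
  assumes U: "vfield_at A p U" and V: "vfield_at A p V" and V': "vfield_at A p V'" and W: "vfield_at A p W"
  shows "curvature A D U (V + V') W p = curvature A D U V W p + curvature A D U V' W p"
proof -
  have "\<forall>\<^sub>F q in nhds p. D q ((V + V') q) W = ((\<lambda>q. D q (V q) W) + (\<lambda>q. D q (V' q) W)) q"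
    using vfield_at_tangent_eventually[OF V] vfield_at_tangent_eventually[OF V'] vfield_at_eventually[OF W]
    by eventually_elim (simp add: D_plus_left)
  then have "D p (U p) (\<lambda>q. D q ((V + V') q) W) = D p (U p) (\<lambda>q. D q (V q) W) + D p (U p) (\<lambda>q. D q (V' q) W)"
    using D_local[OF vfield_at_tangent[OF U] vfield_at_D[OF vfield_at_add[OF V V'] W]
        vfield_at_add[OF vfield_at_D[OF V W] vfield_at_D[OF V' W]]]
      D_plus[OF vfield_at_tangent[OF U] vfield_at_D[OF V W] vfield_at_D[OF V' W]] by simp
  then show ?thesis
    using bracket_add_right[OF U V V'] D_plus_left[OF bracket_tangent[OF U V] W bracket_tangent[OF U V']]
      D_plus_left[OF vfield_at_tangent[OF V] vfield_at_D[OF U W] vfield_at_tangent[OF V']]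
    by (simp add: curvature_def)
qed

lemma curvature_scalef_middle:
  assumes U: "vfield_at A p U" and V: "vfield_at A p V" and W: "vfield_at A p W" and f: "smooth_fun_at A p f"
  shows "curvature A D U (scalef f V) W p = scalev (f p) (curvature A D U V W p)"
proof -
  have "\<forall>\<^sub>F q in nhds p. D q (scalef f V q) W = scalef f (\<lambda>q. D q (V q) W) q"
    using vfield_at_tangent_eventually[OF V] vfield_at_eventually[OF W]
    by eventually_elim (simp add: D_scale_left scalef_apply)
  then have 1: "D p (U p) (\<lambda>q. D q (scalef f V q) W) =
      scalev (U p f) (D p (V p) W) + scalev (f p) (D p (U p) (\<lambda>q. D q (V q) W))"
    using D_local[OF vfield_at_tangent[OF U] vfield_at_D[OF vfield_at_scalef[OF f V] W]
        vfield_at_scalef[OF f vfield_at_D[OF V W]]]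
      D_Leibniz[OF vfield_at_tangent[OF U] vfield_at_D[OF V W] f] by simp
  have 2: "D p (scalef f V p) (\<lambda>q. D q (U q) W) = scalev (f p) (D p (V p) (\<lambda>q. D q (U q) W))"
    using D_scale_left[OF vfield_at_tangent[OF V] vfield_at_D[OF U W]] by (simp add: scalef_apply)
  have 3: "D p (bracket A U (scalef f V) p) W = scalev (U p f) (D p (V p) W) + scalev (f p) (D p (bracket A U V p) W)"
    using vfield_at_tangent[OF V] bracket_tangent[OF U V] W
    by (simp add: bracket_scalef_right[OF U V f] D_plus_left D_scale_left tangent_scalev_mem)
  show ?thesis unfolding curvature_def 1 2 3 by (simp add: fun_eq_iff algebra_simps)
qed

text \<open>Exchanging the first two arguments by antisymmetry reduces the first argument to the middle one.\<close>

lemma curvature_tensorial: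
  assumes U: "vfield_at A p U" "vfield_at A p U'" "U p = U' p"
    and V: "vfield_at A p V" "vfield_at A p V'" "V p = V' p"
    and W: "vfield_at A p W" "vfield_at A p W'" "W p = W' p"
  shows "curvature A D U V W p = curvature A D U' V' W' p"
proof
  fix f
  have last: "curvature A D U V W p f = curvature A D U V W' p f"
    by (rule tensorial[of p "\<lambda>W. curvature A D U V W p f"])
      (simp_all add: curvature_plus_last curvature_scalef_last U V W)
  have middle: "curvature A D U V W' p f = curvature A D U V' W' p f"
    by (rule tensorial[of p "\<lambda>V. curvature A D U V W' p f"])
      (simp_all add: curvature_plus_middle curvature_scalef_middle U V W)
  have "curvature A D V' U W' p f = curvature A D V' U' W' p f"
    by (rule tensorial[of p "\<lambda>U. curvature A D V' U W' p f"])
      (simp_all add: curvature_plus_middle curvature_scalef_middle U V W)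
  then have "curvature A D U V' W' p f = curvature A D U' V' W' p f"
    using curvature_antisym[OF U(1) V(2) W(2)] curvature_antisym[OF U(2) V(2) W(2)]
    by simp
  with last middle show "curvature A D U V W p f = curvature A D U' V' W' p f" by simp
qed

end

section \<open>Compatible metrics\<close>

lemma linear_real4_real3_kernel:
  fixes L :: "real^4 \<Rightarrow> real^3"
  assumes "linear L"
  obtains c where "c \<noteq> 0" "L c = 0"
proof -
  have "\<not> inj L"
  proof
    assume "inj L"
    then have "dim (L ` UNIV) = dim (UNIV :: (real^4) set)"
      using dim_image_eq[OF assms, of UNIV] by (simp add: inj_on_def)
    moreover have "dim (L ` UNIV) \<le> 3" using dim_subset_UNIV[of "L ` UNIV"] by simp
    ultimately show False by simp
  qed
  then show ?thesis using that linear_injective_0[OF assms] by auto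
qed

locale compatible_contact = smooth_atlas A for A :: "('m::t2_space) chart set" +
  fixes \<xi> :: "'m \<Rightarrow> 'm tvec set" and g :: "'m metric" and \<alpha> :: "'m form1"
    and J :: "'m \<Rightarrow> 'm tvec \<Rightarrow> 'm tvec" and \<theta>' :: real and X :: "'m vfield" and D :: "'m connection"
  assumes compatible: "compatible_metric A \<xi> g \<alpha> J \<theta>' X"
    and levi_civita: "levi_civita A g D"
begin

sublocale atlas_with_connection A D
  using levi_civita by unfold_locales (simp add: levi_civita_def)

abbreviation T :: "'m \<Rightarrow> 'm tvec set" where "T \<equiv> tangent A"

lemma metric: "riemannian_metric A g" and alpha_contact: "contact_form_for A \<xi> \<alpha>"
  and reeb: "reeb_field A \<alpha> X" and theta_pos: "0 < \<theta>'" and complex: "complex_structure_on A \<xi> J"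
  and compatible_eq: "u \<in> T p \<Longrightarrow> v \<in> T p \<Longrightarrow>
    g p u v = 1 / \<theta>' * ext_deriv A \<alpha> p u (J_ext \<alpha> X J p v) + \<alpha> p u * \<alpha> p v"
  using compatible unfolding compatible_metric_def by auto

lemmas tangent_mem = tangent_plus_mem tangent_scalev_mem tangent_diff_mem

lemma metric_rules:
  assumes "u \<in> T p" "v \<in> T p" "w \<in> T p"
  shows "g p (u + v) w = g p u w + g p v w \<and> g p (scalev c u) w = c * g p u w \<and>
        g p u v = g p v u \<and> (u \<noteq> 0 \<longrightarrow> 0 < g p u u)"
  using metric[unfolded riemannian_metric_def, THEN conjunct1, rule_format, OF assms] .

lemma g_sym: "u \<in> T p \<Longrightarrow> v \<in> T p \<Longrightarrow> g p u v = g p v u"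
  using metric_rules[of u p v v] by blast

lemma g_plus_left: "u \<in> T p \<Longrightarrow> v \<in> T p \<Longrightarrow> w \<in> T p \<Longrightarrow> g p (u + v) w = g p u w + g p v w"
  using metric_rules[of u p v w] by blast

lemma g_scale_left: "u \<in> T p \<Longrightarrow> w \<in> T p \<Longrightarrow> g p (scalev c u) w = c * g p u w"
  using metric_rules[of u p u w] by blast

lemma g_plus_right: "u \<in> T p \<Longrightarrow> v \<in> T p \<Longrightarrow> w \<in> T p \<Longrightarrow> g p w (u + v) = g p w u + g p w v"
  by (simp add: g_sym[of w] g_plus_left tangent_plus_mem)

lemma g_scale_right: "u \<in> T p \<Longrightarrow> w \<in> T p \<Longrightarrow> g p w (scalev c u) = c * g p w u"
  by (simp add: g_sym[of w] g_scale_left tangent_scalev_mem)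

lemma g_diff_left: "u \<in> T p \<Longrightarrow> v \<in> T p \<Longrightarrow> w \<in> T p \<Longrightarrow> g p (u - v) w = g p u w - g p v w"
  unfolding diff_eq_plus_scalev by (simp add: g_plus_left g_scale_left tangent_scalev_mem)

lemma g_diff_right: "u \<in> T p \<Longrightarrow> v \<in> T p \<Longrightarrow> w \<in> T p \<Longrightarrow> g p w (u - v) = g p w u - g p w v"
  by (simp add: g_sym[of w] g_diff_left tangent_diff_mem)

lemma g_uminus_left: "u \<in> T p \<Longrightarrow> w \<in> T p \<Longrightarrow> g p (- u) w = - g p u w"
  unfolding uminus_eq_scalev by (simp add: g_scale_left)

lemma g_uminus_right: "u \<in> T p \<Longrightarrow> w \<in> T p \<Longrightarrow> g p w (- u) = - g p w u"
  unfolding uminus_eq_scalev by (simp add: g_scale_right)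

lemmas g_linear = g_plus_left g_plus_right g_scale_left g_scale_right g_diff_left g_diff_right
  g_uminus_left g_uminus_right

lemma g_definite: "u \<in> T p \<Longrightarrow> g p u u = 0 \<Longrightarrow> u = 0"
  using metric_rules[of u p u u] by auto

lemma g_nonneg: "u \<in> T p \<Longrightarrow> 0 \<le> g p u u"
  using metric_rules[of u p u u] g_scale_left[of 0 p 0 0] tangent_zero_mem[of p]
  by (cases "u = 0") (auto simp: scalev_def zero_fun_def)

lemma g_smooth:
  assumes "vfield_at A p Y" "vfield_at A p Z"
  shows "smooth_fun_at A p (\<lambda>q. g q (Y q) (Z q))"
proof -
  obtain W where W: "open W" "p \<in> W" "\<And>q. q \<in> W \<Longrightarrow> vfield_at A q Y \<and> vfield_at A q Z"
    using eventually_conj[OF vfield_at_eventually[OF assms(1)] vfield_at_eventually[OF assms(2)]]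
    unfolding eventually_nhds by auto
  then have "vfield_on A W Y" "vfield_on A W Z" by (simp_all add: vfield_on_iff)
  then have "smooth_fun_on A W (\<lambda>q. g q (Y q) (Z q))"
    using metric W(1) unfolding riemannian_metric_def by simp
  then show ?thesis using W(1,2) unfolding smooth_fun_at_def by auto
qed

lemma torsion_free:
  "vfield_at A p Y \<Longrightarrow> vfield_at A p Z \<Longrightarrow> bracket A Y Z p = D p (Y p) Z - D p (Z p) Y"
  using levi_civita unfolding levi_civita_def by simp

lemma D_metric:
  "vfield_at A p Y \<Longrightarrow> vfield_at A p Z \<Longrightarrow> u \<in> T p \<Longrightarrow>
    u (\<lambda>q. g q (Y q) (Z q)) = g p (D p u Y) (Z p) + g p (Y p) (D p u Z)"
  using levi_civita unfolding levi_civita_def by simp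

lemma X_vfield: "vfield_at A p X"
  using reeb vfield_on_iff[OF open_UNIV] unfolding reeb_field_def by simp

lemma X_tangent: "X p \<in> T p"
  by (rule vfield_at_tangent[OF X_vfield])

lemma xi_iff_alpha: "v \<in> \<xi> p \<longleftrightarrow> v \<in> T p \<and> \<alpha> p v = 0"
  using alpha_contact unfolding contact_form_for_def by auto

lemma xi_tangent: "v \<in> \<xi> p \<Longrightarrow> v \<in> T p"
  by (simp add: xi_iff_alpha)

lemma alpha_X: "\<alpha> p (X p) = 1"
  using reeb unfolding reeb_field_def by simp

lemma alpha_plus: "u \<in> T p \<Longrightarrow> v \<in> T p \<Longrightarrow> \<alpha> p (u + v) = \<alpha> p u + \<alpha> p v"
  and alpha_scale: "u \<in> T p \<Longrightarrow> \<alpha> p (scalev c u) = c * \<alpha> p u"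
  using alpha_contact unfolding contact_form_for_def contact_form_def one_form_def by auto

text \<open>The compatibility equation with \<open>X\<close> as its first argument: the \<open>d\<alpha>\<close> term vanishes by the Reeb
  condition.\<close>

lemma alpha_eq_g:
  assumes v: "v \<in> T p"
  shows "\<alpha> p v = g p (X p) v"
proof -
  have mem: "v - scalev (\<alpha> p v) (X p) \<in> T p" by (intro tangent_mem v X_tangent)
  have "\<alpha> p (v - scalev (\<alpha> p v) (X p)) = 0"
    unfolding diff_eq_plus_scalev
    by (simp add: alpha_plus alpha_scale v X_tangent tangent_scalev_mem alpha_X)
  with mem have "v - scalev (\<alpha> p v) (X p) \<in> \<xi> p" by (simp add: xi_iff_alpha)
  then have "J_ext \<alpha> X J p v \<in> T p"
    using complex xi_tangent unfolding complex_structure_on_def J_ext_def by blast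
  then have "ext_deriv A \<alpha> p (X p) (J_ext \<alpha> X J p v) = 0"
    using reeb unfolding reeb_field_def by simp
  then show ?thesis using compatible_eq[OF X_tangent v] by (simp add: alpha_X)
qed

lemma xi_iff: "v \<in> \<xi> p \<longleftrightarrow> v \<in> T p \<and> g p (X p) v = 0"
  using alpha_eq_g xi_iff_alpha by auto

lemma g_X_X: "g p (X p) (X p) = 1"
  using alpha_eq_g[OF X_tangent] alpha_X by simp

text \<open>The endomorphism \<open>u \<mapsto> \<nabla>\<^sub>u X\<close>. Up to sign it is the shape operator of \<open>\<xi>\<close>; it is not symmetric, as
  \<open>\<xi>\<close> is not integrable.\<close>

definition S :: "'m \<Rightarrow> 'm tvec \<Rightarrow> 'm tvec" where
  "S p u = D p u X"

lemma S_tangent: "u \<in> T p \<Longrightarrow> S p u \<in> T p"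
  unfolding S_def by (rule D_tangent[OF _ X_vfield])

lemma S_plus: "u \<in> T p \<Longrightarrow> v \<in> T p \<Longrightarrow> S p (u + v) = S p u + S p v"
  unfolding S_def by (rule D_plus_left[OF _ X_vfield])

lemma S_scale: "u \<in> T p \<Longrightarrow> S p (scalev c u) = scalev c (S p u)"
  unfolding S_def by (rule D_scale_left[OF _ X_vfield])

lemma S_diff: "u \<in> T p \<Longrightarrow> v \<in> T p \<Longrightarrow> S p (u - v) = S p u - S p v"
  unfolding S_def by (rule D_diff_left[OF _ _ X_vfield])

lemma S_vfield: "vfield_at A p Y \<Longrightarrow> vfield_at A p (\<lambda>q. S q (Y q))"
  unfolding S_def by (rule vfield_at_D[OF _ X_vfield])

lemma g_X_S:
  assumes u: "u \<in> T p"
  shows "g p (X p) (S p u) = 0"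
proof -
  have "u (\<lambda>q. g q (X q) (X q)) = 0" by (simp add: g_X_X tangent_const[OF u])
  then show ?thesis
    using D_metric[OF X_vfield X_vfield u] g_sym[OF X_tangent S_tangent[OF u]] by (simp add: S_def)
qed

lemma S_xi: "u \<in> T p \<Longrightarrow> S p u \<in> \<xi> p"
  by (simp add: xi_iff S_tangent g_X_S)

text \<open>As \<open>\<alpha>\<close> is dual to \<open>X\<close>, the derivatives of \<open>\<alpha>(V)\<close> and \<open>\<alpha>(U)\<close> split into a term with \<open>\<nabla>X\<close> and a term
  with the covariant derivative of the extension. The latter add up to \<open>\<alpha>([U, V])\<close> because the
  connection is torsion free, so the result does not depend on the extensions.\<close>

lemma dalpha_eq:
  assumes u: "u \<in> T p" and v: "v \<in> T p"
  shows "ext_deriv A \<alpha> p u v = g p (S p u) v - g p (S p v) u"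
proof -
  define U V where "U = ext A p u" and "V = ext A p v"
  have U: "vfield_at A p U" "U p = u" and V: "vfield_at A p V" "V p = v"
    using ext_spec[OF u] ext_spec[OF v] by (simp_all add: U_def V_def)
  have *: "w (\<lambda>q. \<alpha> q (Y q)) = g p (S p w) (Y p) + g p (X p) (D p w Y)"
    if w: "w \<in> T p" and Y: "vfield_at A p Y" for w Y
  proof -
    have "\<forall>\<^sub>F q in nhds p. \<alpha> q (Y q) = g q (X q) (Y q)"
      using vfield_at_tangent_eventually[OF Y] by eventually_elim (rule alpha_eq_g)
    then show ?thesis
      using tangent_cong[OF w] D_metric[OF X_vfield Y w] by (simp add: S_def)
  qed
  have "\<alpha> p (bracket A U V p) = g p (X p) (D p u V) - g p (X p) (D p v U)"
    using alpha_eq_g[OF bracket_tangent[OF U(1) V(1)]] torsion_free[OF U(1) V(1)]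
      g_diff_right[OF D_tangent[OF u V(1)] D_tangent[OF v U(1)] X_tangent] U(2) V(2) by simp
  then show ?thesis
    using *[OF u V(1)] *[OF v U(1)] by (simp add: ext_deriv_def U_def[symmetric] V_def[symmetric] U(2) V(2))
qed

text \<open>The Reeb condition \<open>d\<alpha>(X, v) = 0\<close> reads \<open>g(\<nabla>\<^sub>X X, v) = g(\<nabla>\<^sub>v X, X)\<close>, and the right-hand side vanishes
  because \<open>X\<close> has constant length.\<close>

lemma X_geodesic: "S p (X p) = 0"
proof -
  have "g p (S p (X p)) v = 0" if v: "v \<in> T p" for v
  proof -
    have "ext_deriv A \<alpha> p (X p) v = 0" using reeb v unfolding reeb_field_def by simp
    then show ?thesis
      using dalpha_eq[OF X_tangent v] g_X_S[OF v] g_sym[OF X_tangent S_tangent[OF v]] by simp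
  qed
  from this[OF S_tangent[OF X_tangent]] show ?thesis by (rule g_definite[OF S_tangent[OF X_tangent]])
qed

context
  fixes p u assumes u: "u \<in> \<xi> p"
begin

lemma J_xi: "J p u \<in> \<xi> p" and J_J: "J p (J p u) = - u"
  using complex u unfolding complex_structure_on_def by auto

lemma dalpha_J_right:
  assumes v: "v \<in> T p"
  shows "ext_deriv A \<alpha> p v (J p u) = \<theta>' * g p v u"
proof -
  have "scalev 0 (X p) = 0" by (simp add: fun_eq_iff)
  moreover have "\<alpha> p u = 0" using u by (simp add: xi_iff_alpha)
  ultimately have "J_ext \<alpha> X J p u = J p u" by (simp add: J_ext_def)
  then show ?thesis using compatible_eq[OF v xi_tangent[OF u]] \<open>\<alpha> p u = 0\<close> theta_pos by simp
qed

end

lemma dalpha_J_left: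
  assumes u: "u \<in> \<xi> p" and v: "v \<in> T p"
  shows "ext_deriv A \<alpha> p (J p u) v = - \<theta>' * g p u v"
  using dalpha_J_right[OF u v] dalpha_eq[OF v xi_tangent[OF J_xi[OF u]]] dalpha_eq[OF xi_tangent[OF J_xi[OF u]] v]
    g_sym[OF v xi_tangent[OF u]] by simp

lemma g_J_J:
  assumes "u \<in> \<xi> p" "v \<in> \<xi> p"
  shows "g p (J p u) (J p v) = g p u v"
proof -
  have "\<theta>' * g p (J p u) (J p v) = ext_deriv A \<alpha> p (J p u) (J p (J p v))"
    using dalpha_J_right[OF J_xi[OF assms(2)] xi_tangent[OF J_xi[OF assms(1)]]] by simp
  also have "\<dots> = - \<theta>' * g p u (- v)"
    using dalpha_J_left[OF assms(1) xi_tangent[OF J_xi[OF J_xi[OF assms(2)]]]] J_J[OF assms(2)] by simp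
  also have "\<dots> = \<theta>' * g p u v" using assms by (simp add: g_uminus_right xi_tangent)
  finally show ?thesis using theta_pos by simp
qed

lemma g_J_self:
  assumes u: "u \<in> \<xi> p"
  shows "g p u (J p u) = 0"
proof -
  have "g p (J p u) (J p (J p u)) = g p u (J p u)" by (rule g_J_J[OF u J_xi[OF u]])
  then show ?thesis
    using u g_sym[OF xi_tangent[OF u] xi_tangent[OF J_xi[OF u]]]
    by (simp add: J_J g_uminus_right xi_tangent J_xi)
qed

lemma g_zero: "v \<in> T p \<Longrightarrow> g p 0 v = 0"
  using g_scale_left[OF tangent_zero_mem, of v p 0] by (simp add: scalev_def zero_fun_def)

text \<open>Four nonzero pairwise orthogonal tangent vectors would have independent coordinate vectors in
  \<open>\<real>\<^sup>3\<close>.\<close>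

lemma orthogonal_frame_complete:
  assumes e: "e \<in> \<xi> p" "g p e e = 1" and w: "w \<in> T p"
    and orth: "g p w (X p) = 0" "g p w e = 0" "g p w (J p e) = 0"
  shows "w = 0"
proof (rule ccontr)
  assume "w \<noteq> 0"
  obtain U \<psi> where U: "(U, \<psi>) \<in> A" "p \<in> U" by (rule chart_exists)
  let ?v = "\<lambda>c :: real^4. scalev (c$1) (X p) + scalev (c$2) e + scalev (c$3) (J p e) + scalev (c$4) w"
  note mem = X_tangent[of p] xi_tangent[OF e(1)] xi_tangent[OF J_xi[OF e(1)]] w tangent_mem
  have "linear (\<lambda>c. chart_vector \<psi> (?v c))"
    by (rule linearI) (simp_all add: chart_vector_def vec_eq_iff algebra_simps)
  then obtain c where c: "c \<noteq> 0" "chart_vector \<psi> (?v c) = 0"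
    by (rule linear_real4_real3_kernel)
  have v0: "?v c = 0" by (rule chart_vector_eq_0[OF U _ c(2)]) (simp add: mem)
  have "g p e (X p) = 0" "g p (J p e) (X p) = 0" "g p (J p e) e = 0" "g p (J p e) (J p e) = 1"
    using e J_xi[OF e(1)] g_J_self[OF e(1)] g_J_J[OF e(1) e(1)] g_sym[OF mem(1,2)] g_sym[OF mem(1,3)] g_sym[OF mem(2,3)]
    by (simp_all add: xi_iff)
  moreover note orth e(2) g_X_X[of p] g_sym[OF mem(1,2)] g_sym[OF mem(1,3)] g_sym[OF mem(2,3)]
    g_sym[OF mem(1,4)] g_sym[OF mem(2,4)] g_sym[OF mem(3,4)]
  ultimately have "g p (?v c) (X p) = c$1" "g p (?v c) e = c$2" "g p (?v c) (J p e) = c$3"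
    "g p (?v c) w = c$4 * g p w w"
    by (simp_all add: g_linear mem)
  moreover have "g p w w \<noteq> 0" using g_definite[OF w] \<open>w \<noteq> 0\<close> by auto
  ultimately have "c$1 = 0" "c$2 = 0" "c$3 = 0" "c$4 = 0"
    unfolding v0 by (simp_all add: g_zero mem)
  then have "c = 0" by (simp add: vec_eq_iff forall_4)
  with c(1) show False by simp
qed

lemma xi_expansion:
  assumes e: "e \<in> \<xi> p" "g p e e = 1" and v: "v \<in> \<xi> p"
  shows "v = scalev (g p v e) e + scalev (g p v (J p e)) (J p e)"
proof -
  note mem = X_tangent[of p] xi_tangent[OF e(1)] xi_tangent[OF J_xi[OF e(1)]] xi_tangent[OF v] tangent_mem
  have orth: "g p e (X p) = 0" "g p (J p e) (X p) = 0" "g p (J p e) e = 0" "g p e (J p e) = 0" "g p (J p e) (J p e) = 1"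
    "g p v (X p) = 0"
    using e v J_xi[OF e(1)] g_J_self[OF e(1)] g_J_J[OF e(1) e(1)] g_sym[OF mem(1,2)] g_sym[OF mem(1,3)] g_sym[OF mem(2,3)]
      g_sym[OF mem(1,4)]
    by (simp_all add: xi_iff)
  let ?w = "v - (scalev (g p v e) e + scalev (g p v (J p e)) (J p e))"
  have "?w = 0"
    by (rule orthogonal_frame_complete[OF e]) (simp_all add: g_linear mem orth e(2))
  then show ?thesis by simp
qed

lemma xi_Parseval:
  assumes e: "e \<in> \<xi> p" "g p e e = 1" and u: "u \<in> \<xi> p" and v: "v \<in> T p"
  shows "g p u v = g p u e * g p e v + g p u (J p e) * g p (J p e) v"
  using arg_cong[OF xi_expansion[OF e u], of "\<lambda>u. g p u v"] v
    xi_tangent[OF e(1)] xi_tangent[OF J_xi[OF e(1)]]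
  by (simp add: g_linear tangent_mem)

text \<open>Any local extension of \<open>v\<close> is projected to \<open>\<xi>\<close> along \<open>X\<close>.\<close>

lemma section_exists:
  assumes v: "v \<in> \<xi> p"
  shows "\<exists>V. vfield_at A p V \<and> (\<forall>\<^sub>F q in nhds p. V q \<in> \<xi> q) \<and> V p = v"
proof -
  define V0 where "V0 = ext A p v"
  have V0: "vfield_at A p V0" "V0 p = v" using ext_spec[OF xi_tangent[OF v]] by (simp_all add: V0_def)
  define V where "V = V0 + scalef (\<lambda>q. - 1 * g q (X q) (V0 q)) X"
  have "vfield_at A p V"
    unfolding V_def by (intro vfield_at_add vfield_at_scalef smooth_fun_at_cmult g_smooth X_vfield V0)
  moreover have "\<forall>\<^sub>F q in nhds p. V q \<in> \<xi> q"
    using vfield_at_tangent_eventually[OF V0(1)]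
    by eventually_elim (simp add: V_def scalef_apply xi_iff tangent_mem X_tangent g_linear g_X_X)
  moreover have "V p = v"
    using v by (simp add: V_def scalef_apply V0(2) xi_iff fun_eq_iff)
  ultimately show ?thesis by blast
qed

lemma J_vfield:
  assumes "vfield_at A p V" "\<forall>\<^sub>F q in nhds p. V q \<in> \<xi> q"
  shows "vfield_at A p (\<lambda>q. J q (V q))"
proof -
  obtain W where W: "open W" "p \<in> W" "\<And>q. q \<in> W \<Longrightarrow> vfield_at A q V \<and> V q \<in> \<xi> q"
    using eventually_conj[OF vfield_at_eventually[OF assms(1)] assms(2)]
    unfolding eventually_nhds by auto
  then have "vfield_on A W V" "\<forall>q\<in>W. V q \<in> \<xi> q" by (simp_all add: vfield_on_iff)
  then have "vfield_on A W (\<lambda>q. J q (V q))"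
    using complex W(1) unfolding complex_structure_on_def by simp
  then show ?thesis using W(1,2) unfolding vfield_at_def by auto
qed

text \<open>The Reeb condition in the form \<open>X(\<alpha>(Y)) = \<alpha>([X, Y])\<close>, with \<open>g(X, \<cdot>)\<close> in place of \<open>\<alpha>\<close>.\<close>

lemma X_g_X:
  assumes Y: "vfield_at A p Y"
  shows "X p (\<lambda>q. g q (X q) (Y q)) = g p (X p) (bracket A X Y p)"
proof -
  have "D p (X p) X = 0" using X_geodesic by (simp add: S_def)
  moreover have "g p (X p) (D p (Y p) X) = 0" using g_X_S[OF vfield_at_tangent[OF Y]] by (simp add: S_def)
  ultimately show ?thesis
    using D_metric[OF X_vfield Y X_tangent] torsion_free[OF X_vfield Y] vfield_at_tangent[OF Y]
    by (simp add: g_diff_right D_tangent X_vfield X_tangent Y g_zero)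
qed

text \<open>On sections of \<open>\<xi>\<close> the formula for the exterior derivative reduces to \<open>d\<alpha>(Y, Z) = - \<alpha>([Y, Z])\<close>.\<close>

lemma g_X_bracket:
  assumes Y: "vfield_at A p Y" "\<forall>\<^sub>F q in nhds p. Y q \<in> \<xi> q" and Z: "vfield_at A p Z" "\<forall>\<^sub>F q in nhds p. Z q \<in> \<xi> q"
  shows "g p (X p) (bracket A Y Z p) = - ext_deriv A \<alpha> p (Y p) (Z p)"
proof -
  have *: "g p (X p) (D p u V) = - g p (S p u) (V p)"
    if V: "vfield_at A p V" "\<forall>\<^sub>F q in nhds p. V q \<in> \<xi> q" and u: "u \<in> T p" for V u
  proof -
    have "\<forall>\<^sub>F q in nhds p. g q (X q) (V q) = 0" using V(2) by eventually_elim (simp add: xi_iff)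
    then have "u (\<lambda>q. g q (X q) (V q)) = u (\<lambda>q. 0)" by (rule tangent_cong[OF u])
    then show ?thesis using D_metric[OF X_vfield V(1) u] tangent_const[OF u, where c = 0] by (simp add: S_def)
  qed
  note Yp = vfield_at_tangent[OF Y(1)] and Zp = vfield_at_tangent[OF Z(1)]
  show ?thesis
    using *[OF Z Yp] *[OF Y Zp]
    by (simp add: torsion_free[OF Y(1) Z(1)] g_diff_right D_tangent Y Z Yp Zp X_tangent dalpha_eq)
qed

lemma bracket_X_section:
  assumes Y: "vfield_at A p Y" "\<forall>\<^sub>F q in nhds p. Y q \<in> \<xi> q"
  shows "\<forall>\<^sub>F q in nhds p. bracket A X Y q \<in> \<xi> q"
proof -
  have "\<forall>\<^sub>F q in nhds p. \<forall>\<^sub>F r in nhds q. Y r \<in> \<xi> r" using Y(2) by (simp add: eventually_eventually)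
  then show ?thesis using vfield_at_eventually[OF Y(1)]
  proof eventually_elim
    case (elim q)
    have "\<forall>\<^sub>F r in nhds q. g r (X r) (Y r) = 0" using elim(1) by eventually_elim (simp add: xi_iff)
    then have "X q (\<lambda>r. g r (X r) (Y r)) = X q (\<lambda>r. 0)" by (rule tangent_cong[OF X_tangent])
    then show ?case
      using X_g_X[OF elim(2)] tangent_const[OF X_tangent, where c = 0]
      by (simp add: xi_iff bracket_tangent X_vfield elim(2))
  qed
qed

lemma X_norm_sq:
  assumes "vfield_at A p Y"
  shows "X p (\<lambda>q. g q (Y q) (Y q)) = 2 * g p (D p (X p) Y) (Y p)"
  using D_metric[OF assms assms X_tangent] g_sym[OF D_tangent[OF X_tangent assms] vfield_at_tangent[OF assms]]
  by simp

lemma g_bracket_X_self: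
  assumes Y: "vfield_at A p Y"
  shows "g p (bracket A X Y p) (Y p) = g p (D p (X p) Y) (Y p) - g p (S p (Y p)) (Y p)"
  using vfield_at_tangent[OF Y]
  by (simp only: torsion_free[OF X_vfield Y] S_def[symmetric] g_diff_left D_tangent[OF X_tangent Y] S_tangent)

text \<open>The trace is the divergence of \<open>X\<close>, which vanishes because the Reeb flow preserves \<open>d\<alpha>\<close>, that is,
  \<open>\<theta>'\<close> times the area form of \<open>\<xi>\<close>. Infinitesimally, for a section \<open>V\<close> with \<open>N = |V|\<^sup>2\<close> one has
  \<open>\<alpha>([V, J V]) = - \<theta>' N\<close>, and differentiating this along \<open>X\<close> by the Jacobi identity gives
  \<open>X(N) = g([X, V], V) + g([X, J V], J V)\<close>. Here the terms \<open>g(\<nabla>\<^sub>X V, V)\<close> and \<open>g(\<nabla>\<^sub>X (J V), J V)\<close> contribute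
  \<open>X(N) / 2\<close> each, since \<open>J\<close> is isometric.\<close>

lemma trace_S_zero:
  assumes v: "v \<in> \<xi> p"
  shows "g p (S p v) v + g p (S p (J p v)) (J p v) = 0"
proof -
  obtain V where V: "vfield_at A p V" "\<forall>\<^sub>F q in nhds p. V q \<in> \<xi> q" "V p = v"
    using section_exists[OF v] by blast
  define W where "W = (\<lambda>q. J q (V q))"
  have W: "vfield_at A p W" "\<forall>\<^sub>F q in nhds p. W q \<in> \<xi> q" "W p = J p v"
    using J_vfield[OF V(1,2)] V(2,3) by (auto simp: W_def elim: eventually_mono intro: J_xi)
  note Wp = vfield_at_tangent[OF W(1)]
  note vec = X_vfield[of p]
  define N where "N = (\<lambda>q. g q (V q) (V q))"
  have N: "smooth_fun_at A p N" unfolding N_def by (rule g_smooth[OF V(1) V(1)])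
  have "\<forall>\<^sub>F q in nhds p. g q (W q) (W q) = N q"
    using V(2) by eventually_elim (simp add: W_def N_def g_J_J)
  then have XN: "X p N = 2 * g p (D p (X p) V) (V p)" "X p N = 2 * g p (D p (X p) W) (W p)"
    using X_norm_sq[OF V(1)] X_norm_sq[OF W(1)] tangent_cong[OF X_tangent, where f = "\<lambda>q. g q (W q) (W q)" and g = N]
    by (simp_all add: N_def)
  have "\<forall>\<^sub>F q in nhds p. g q (X q) (bracket A V W q) = (- \<theta>') * N q"
  proof -
    have "\<forall>\<^sub>F q in nhds p. \<forall>\<^sub>F r in nhds q. V r \<in> \<xi> r" "\<forall>\<^sub>F q in nhds p. \<forall>\<^sub>F r in nhds q. W r \<in> \<xi> r"
      using V(2) W(2) by (simp_all add: eventually_eventually)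
    then show ?thesis using vfield_at_eventually[OF V(1)] vfield_at_eventually[OF W(1)] V(2)
    proof eventually_elim
      case (elim q)
      have "ext_deriv A \<alpha> q (V q) (W q) = \<theta>' * N q"
        unfolding W_def N_def by (rule dalpha_J_right[OF elim(5) xi_tangent[OF elim(5)]])
      then show ?case using g_X_bracket[OF elim(3,1,4,2)] by simp
    qed
  qed
  then have "X p (\<lambda>q. g q (X q) (bracket A V W q)) = X p (\<lambda>q. (- \<theta>') * N q)"
    by (rule tangent_cong[OF X_tangent])
  then have "- \<theta>' * X p N = g p (X p) (bracket A X (bracket A V W) p)"
    using X_g_X[OF vfield_at_bracket[OF V(1) W(1)]] tangent_cmult[OF X_tangent N, where c = "- \<theta>'"] by simp
  also have "\<dots> = g p (X p) (bracket A (bracket A X V) W p) + g p (X p) (bracket A V (bracket A X W) p)"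
    by (simp add: bracket_Jacobi[OF vec V(1) W(1)] g_plus_right bracket_tangent vfield_at_bracket vec V W X_tangent)
  also have "\<dots> = - ext_deriv A \<alpha> p (bracket A X V p) (J p v) - ext_deriv A \<alpha> p (V p) (bracket A X W p)"
    using g_X_bracket[OF vfield_at_bracket[OF vec V(1)] bracket_X_section[OF V(1,2)] W(1,2)]
      g_X_bracket[OF V(1,2) vfield_at_bracket[OF vec W(1)] bracket_X_section[OF W(1,2)]] W(3) by simp
  also have "ext_deriv A \<alpha> p (bracket A X V p) (J p v) = \<theta>' * g p (bracket A X V p) (V p)"
    using dalpha_J_right[OF v bracket_tangent[OF vec V(1)]] V(3) by simp
  also have "ext_deriv A \<alpha> p (V p) (bracket A X W p) = \<theta>' * g p (W p) (bracket A X W p)"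
  proof -
    \<comment> \<open>As \<open>W = J V\<close>, the field \<open>V\<close> is \<open>J (- W)\<close>, so that compatibility applies to the first argument.\<close>
    have "V p = - J p (W p)" using J_J[OF v] by (simp add: W(3) V(3))
    then have "ext_deriv A \<alpha> p (V p) (bracket A X W p) = ext_deriv A \<alpha> p (J p (scalev (-1) (W p))) (bracket A X W p)"
      using complex J_xi[OF v] unfolding complex_structure_on_def W(3) by (simp add: uminus_eq_scalev)
    also have "\<dots> = - \<theta>' * g p (scalev (-1) (W p)) (bracket A X W p)"
    proof (rule dalpha_J_left)
      show "scalev (-1) (W p) \<in> \<xi> p"
        using J_xi[OF v] by (simp add: W(3) xi_iff tangent_mem g_linear X_tangent)
    qed (rule bracket_tangent[OF vec W(1)])
    finally show ?thesis by (simp add: g_scale_left Wp bracket_tangent vec W(1))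
  qed
  finally have "- \<theta>' * X p N = - \<theta>' * (g p (bracket A X V p) (V p) + g p (W p) (bracket A X W p))"
    by (simp add: algebra_simps)
  then have "X p N = g p (bracket A X V p) (V p) + g p (W p) (bracket A X W p)"
    using theta_pos by simp
  also have "g p (W p) (bracket A X W p) = g p (bracket A X W p) (W p)"
    by (rule g_sym[OF Wp bracket_tangent[OF vec W(1)]])
  finally show ?thesis
    using XN g_bracket_X_self[OF V(1)] g_bracket_X_self[OF W(1)] by (simp add: V(3) W(3))
qed

end

section \<open>Sectional curvatures of planes containing the Reeb direction\<close>

context compatible_contact
begin

lemma D_zero: "u \<in> T p \<Longrightarrow> D p u 0 = 0"
  using D_plus[OF _ vfield_at_zero vfield_at_zero, of u p] by simp

lemma bracket_section_X:
  assumes U: "vfield_at A p U"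
  shows "bracket A U X p = S p (U p) - D p (X p) U"
  unfolding S_def by (rule torsion_free[OF U X_vfield])

text \<open>Because \<open>X\<close> is geodesic, \<open>\<nabla>\<^sub>U \<nabla>\<^sub>X X\<close> vanishes, and the curvature term reduces to
  \<open>- \<nabla>\<^sub>X (S U) - S [U, X]\<close>.\<close>

lemma g_curvature_X:
  assumes U: "vfield_at A p U"
  shows "g p (curvature A D U X X p) (U p) =
    - X p (\<lambda>q. g q (S q (U q)) (U q)) + g p (S p (U p)) (D p (X p) U) - g p (S p (bracket A U X p)) (U p)"
proof -
  note Up = vfield_at_tangent[OF U]
  have zero: "(\<lambda>q. D q (X q) X) = 0" using X_geodesic by (simp add: S_def fun_eq_iff)
  have "curvature A D U X X p = - D p (X p) (\<lambda>q. S q (U q)) - S p (bracket A U X p)"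
    unfolding curvature_def zero D_zero[OF Up] by (simp add: S_def)
  then have "g p (curvature A D U X X p) (U p) =
      - g p (D p (X p) (\<lambda>q. S q (U q))) (U p) - g p (S p (bracket A U X p)) (U p)"
    using D_tangent[OF X_tangent S_vfield[OF U]] S_tangent[OF bracket_tangent[OF U X_vfield]] Up
    by (simp only: g_diff_left g_uminus_left uminus_eq_scalev tangent_scalev_mem g_scale_left)
  then show ?thesis
    using D_metric[OF S_vfield[OF U] U X_tangent] by simp
qed

text \<open>By tensoriality the extensions of \<open>u\<close> and \<open>X p\<close> chosen in the definition of sectional curvature may
  be replaced by \<open>U\<close> and the Reeb field itself.\<close>

lemma sectional_X:
  assumes u: "u \<in> \<xi> p" "g p u u = 1" and U: "vfield_at A p U" "U p = u"
  shows "sectional A g D p u (X p) = g p (curvature A D U X X p) u"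
proof -
  note ext = ext_spec[OF xi_tangent[OF u(1)]] ext_spec[OF X_tangent[of p]]
  have "curvature A D (ext A p u) (ext A p (X p)) (ext A p (X p)) p = curvature A D U X X p"
    by (rule curvature_tensorial) (simp_all add: ext U X_vfield)
  moreover have "g p u (X p) = 0"
    using u(1) g_sym[OF xi_tangent[OF u(1)] X_tangent] by (simp add: xi_iff)
  ultimately show ?thesis by (simp add: sectional_def Let_def u(2) g_X_X)
qed

text \<open>The frame \<open>V\<close>, \<open>J V\<close> is orthonormal at \<open>p\<close> only: elsewhere the two fields are orthogonal of equal
  length, and this suffices, as the derivative of the common length enters with the factor
  \<open>tr S = 0\<close>.\<close>

lemma Reeb_Ricci:
  assumes e: "e \<in> \<xi> p" "g p e e = 1"
  defines "s \<equiv> \<lambda>u v. g p (S p u) v"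
  shows "sectional A g D p e (X p) + sectional A g D p (J p e) (X p) =
    2 * (s e e * s (J p e) (J p e) - s e (J p e) * s (J p e) e)"
proof -
  obtain V where V: "vfield_at A p V" "\<forall>\<^sub>F q in nhds p. V q \<in> \<xi> q" "V p = e"
    using section_exists[OF e(1)] by blast
  define W where "W = (\<lambda>q. J q (V q))"
  have W: "vfield_at A p W" "\<forall>\<^sub>F q in nhds p. W q \<in> \<xi> q" "W p = J p e"
    using J_vfield[OF V(1,2)] V(2,3) by (auto simp: W_def elim: eventually_mono intro: J_xi)
  define f where "f = J p e"
  note fxi = J_xi[OF e(1), folded f_def]
  have Wf: "W p = f" using W(3) by (simp add: f_def)
  have f: "g p f f = 1" using g_J_J[OF e(1) e(1)] e(2) by (simp add: f_def)
  note mem = xi_tangent[OF e(1)] xi_tangent[OF fxi]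
  have par: "g p u v = g p u e * g p e v + g p u f * g p f v" if "u \<in> \<xi> p" "v \<in> T p" for u v
    using xi_Parseval[OF e that] by (simp add: f_def)
  \<comment> \<open>The matrix of \<open>\<nabla>\<^sub>X\<close> on the frame; it is a multiple of the identity plus an antisymmetric matrix.\<close>
  define a b c d where "a = g p (D p (X p) V) e" and "b = g p (D p (X p) V) f"
    and "c = g p (D p (X p) W) e" and "d = g p (D p (X p) W) f"
  have DV: "D p (X p) V \<in> T p" and DW: "D p (X p) W \<in> T p"
    by (rule D_tangent[OF X_tangent V(1)], rule D_tangent[OF X_tangent W(1)])
  have Dxi: "D p (X p) Y \<in> \<xi> p" if Y: "vfield_at A p Y" "\<forall>\<^sub>F q in nhds p. Y q \<in> \<xi> q" for Y
  proof -
    have "\<forall>\<^sub>F q in nhds p. g q (X q) (Y q) = 0" using Y(2) by eventually_elim (simp add: xi_iff)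
    then have "X p (\<lambda>q. g q (X q) (Y q)) = X p (\<lambda>q. 0)" by (rule tangent_cong[OF X_tangent])
    then show ?thesis
      using D_metric[OF X_vfield Y(1) X_tangent] tangent_const[OF X_tangent, where c = 0] X_geodesic
      by (simp add: xi_iff D_tangent X_tangent Y(1) S_def g_zero vfield_at_tangent)
  qed
  have ad: "a = d"
  proof -
    have "\<forall>\<^sub>F q in nhds p. g q (V q) (V q) = g q (W q) (W q)"
      using V(2) by eventually_elim (simp add: W_def g_J_J)
    then show ?thesis
      using tangent_cong[OF X_tangent] X_norm_sq[OF V(1)] X_norm_sq[OF W(1)]
      by (simp add: a_def d_def V(3) Wf)
  qed
  have bc: "b + c = 0"
  proof -
    have "\<forall>\<^sub>F q in nhds p. g q (V q) (W q) = 0"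
      using V(2) by eventually_elim (simp add: W_def g_J_self)
    then have "X p (\<lambda>q. g q (V q) (W q)) = X p (\<lambda>q. 0)" by (rule tangent_cong[OF X_tangent])
    then show ?thesis
      using D_metric[OF V(1) W(1) X_tangent] tangent_const[OF X_tangent, where c = 0] g_sym[OF mem(1) DW]
      by (simp add: b_def c_def V(3) Wf)
  qed
  have tr: "s e e + s f f = 0" using trace_S_zero[OF e(1)] by (simp add: s_def f_def)
  have X_tr: "X p (\<lambda>q. g q (S q (V q)) (V q)) + X p (\<lambda>q. g q (S q (W q)) (W q)) = 0"
  proof -
    have "\<forall>\<^sub>F q in nhds p. g q (S q (V q)) (V q) + g q (S q (W q)) (W q) = 0"
      using V(2) by eventually_elim (simp add: W_def trace_S_zero)
    then have "X p (\<lambda>q. g q (S q (V q)) (V q) + g q (S q (W q)) (W q)) = X p (\<lambda>q. 0)"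
      by (rule tangent_cong[OF X_tangent])
    then show ?thesis
      using tangent_add[OF X_tangent g_smooth[OF S_vfield[OF V(1)] V(1)] g_smooth[OF S_vfield[OF W(1)] W(1)]]
        tangent_const[OF X_tangent, where c = 0] by simp
  qed
  have K: "sectional A g D p (Y p) (X p) = - X p (\<lambda>q. g q (S q (Y q)) (Y q)) + g p (S p (Y p)) (D p (X p) Y)
      + g p (S p (D p (X p) Y)) (Y p) - g p (S p (S p (Y p))) (Y p)"
    if Y: "vfield_at A p Y" "\<forall>\<^sub>F q in nhds p. Y q \<in> \<xi> q" "g p (Y p) (Y p) = 1" for Y
  proof -
    have Yp: "Y p \<in> \<xi> p" using Y(2) by (rule eventually_nhds_x_imp_x)
    note m = xi_tangent[OF Yp] D_tangent[OF X_tangent Y(1)] S_tangent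
    have "S p (bracket A Y X p) = S p (S p (Y p)) - S p (D p (X p) Y)"
      unfolding bracket_section_X[OF Y(1)] by (rule S_diff) (simp_all add: m)
    then have "g p (S p (bracket A Y X p)) (Y p) = g p (S p (S p (Y p))) (Y p) - g p (S p (D p (X p) Y)) (Y p)"
      by (simp only: g_diff_left m)
    then show ?thesis using sectional_X[OF Yp Y(3,1)] g_curvature_X[OF Y(1)] by simp
  qed
  have s_exp: "s u v = g p u e * s e v + g p u f * s f v" if "u \<in> \<xi> p" "v \<in> T p" for u v
  proof -
    have "S p u = scalev (g p u e) (S p e) + scalev (g p u f) (S p f)"
      using arg_cong[OF xi_expansion[OF e that(1)], of "S p"] mem
      by (simp add: S_plus S_scale tangent_mem f_def)
    then show ?thesis using mem that by (simp only: s_def g_plus_left g_scale_left S_tangent tangent_scalev_mem)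
  qed
  have 1: "g p (S p e) (D p (X p) V) = a * s e e + b * s e f" "g p (S p f) (D p (X p) W) = c * s f e + d * s f f"
    using par[OF S_xi DV, of e] par[OF S_xi DW, of f] mem g_sym[OF DV mem(1)] g_sym[OF DV mem(2)]
      g_sym[OF DW mem(1)] g_sym[OF DW mem(2)]
    by (simp_all add: s_def a_def b_def c_def d_def mult.commute)
  have 2: "g p (S p (D p (X p) V)) e = a * s e e + b * s f e" "g p (S p (D p (X p) W)) f = c * s e f + d * s f f"
    using s_exp[OF Dxi[OF V(1,2)] mem(1)] s_exp[OF Dxi[OF W(1,2)] mem(2)]
    by (simp_all add: a_def b_def c_def d_def s_def)
  have 3: "g p (S p (S p e)) e = s e e * s e e + s e f * s f e" "g p (S p (S p f)) f = s f e * s e f + s f f * s f f"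
    using s_exp[OF S_xi[OF mem(1)] mem(1)] s_exp[OF S_xi[OF mem(2)] mem(2)]
    by (simp_all add: s_def)
  have "sectional A g D p e (X p) + sectional A g D p f (X p) =
      (a * s e e + b * s e f) + (a * s e e + b * s f e) + (c * s f e + d * s f f) + (c * s e f + d * s f f)
      - (s e e * s e e + s e f * s f e) - (s f e * s e f + s f f * s f f)"
    using K[OF V(1,2)] K[OF W(1,2)] e(2) f X_tr unfolding V(3) Wf 1 2 3 by simp
  also have "\<dots> = 2 * a * (s e e + s f f) + (b + c) * (s e f + s f e) - (s e e)\<^sup>2 - 2 * s e f * s f e - (s f f)\<^sup>2"
    by (simp add: ad power2_eq_square algebra_simps)
  also have "\<dots> = 2 * a * (s e e + s f f) + (b + c) * (s e f + s f e) +
      2 * (s e e * s f f - s e f * s f e) - (s e e + s f f)\<^sup>2"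
    by (simp add: power2_eq_square algebra_simps)
  also have "\<dots> = 2 * (s e e * s f f - s e f * s f e)" by (simp only: tr bc) simp
  finally show ?thesis by (simp add: f_def)
qed

text \<open>The derivative of the constant function \<open>g(V, X) = 0\<close> in direction \<open>u\<close>.\<close>

lemma second_fundamental_form_eq:
  assumes u: "u \<in> \<xi> p" and v: "v \<in> \<xi> p"
  shows "second_fundamental_form A \<xi> g D X p u v = - g p (S p u) v"
proof -
  define V where "V = section_ext A \<xi> p v"
  have V: "vfield_at A p V \<and> (\<forall>\<^sub>F q in nhds p. V q \<in> \<xi> q) \<and> V p = v"
    unfolding V_def section_ext_def by (rule someI_ex[OF section_exists[OF v]])
  then have V: "vfield_at A p V" "\<forall>\<^sub>F q in nhds p. V q \<in> \<xi> q" "V p = v" by auto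
  note ut = xi_tangent[OF u]
  have "\<forall>\<^sub>F q in nhds p. g q (V q) (X q) = 0"
    using V(2) by eventually_elim (metis g_sym X_tangent xi_iff)
  then have "u (\<lambda>q. g q (V q) (X q)) = u (\<lambda>q. 0)" by (rule tangent_cong[OF ut])
  then have "g p (D p u V) (X p) + g p v (S p u) = 0"
    using D_metric[OF V(1) X_vfield ut] tangent_const[OF ut, where c = 0] by (simp add: S_def V(3))
  then show ?thesis
    using g_sym[OF xi_tangent[OF v] S_tangent[OF ut]]
    by (simp add: second_fundamental_form_def V_def[symmetric])
qed

text \<open>The chosen orthonormal basis is related to \<open>e\<close>, \<open>J e\<close> by an orthogonal matrix, which enters the
  determinant of the bilinear form \<open>- g(S u, v)\<close> through the square of its own determinant.\<close>

lemma extrinsic_curvature_eq: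
  assumes e: "e \<in> \<xi> p" "g p e e = 1"
  defines "s \<equiv> \<lambda>u v. g p (S p u) v"
  shows "extrinsic_curvature A \<xi> g D X p = s e e * s (J p e) (J p e) - s e (J p e) * s (J p e) e"
proof -
  define f where "f = J p e"
  note fxi = J_xi[OF e(1), folded f_def]
  note mem = xi_tangent[OF e(1)] xi_tangent[OF fxi]
  have orth: "g p e f = 0" "g p f e = 0" "g p f f = 1"
    using g_J_J[OF e(1) e(1)] e(2) g_J_self[OF e(1)] g_sym[OF mem] by (simp_all add: f_def)
  define b where "b = (SOME b. orthonormal_basis \<xi> g p b)"
  have "orthonormal_basis \<xi> g p (\<lambda>i. if i = 1 then e else f)"
    using e fxi orth exhaust_2 by (auto simp: orthonormal_basis_def)
  then have "orthonormal_basis \<xi> g p b" unfolding b_def by (rule someI[of "orthonormal_basis \<xi> g p"])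
  then have b: "b i \<in> \<xi> p" "g p (b i) (b j) = (if i = j then 1 else 0)" for i j
    by (simp_all add: orthonormal_basis_def)
  define x y where "x i = g p (b i) e" and "y i = g p (b i) f" for i
  have exp: "b i = scalev (x i) e + scalev (y i) f" for i
    using xi_expansion[OF e b(1)] by (simp add: x_def y_def f_def)
  have II: "second_fundamental_form A \<xi> g D X p (b i) (b j) =
      - (x i * x j * s e e + x i * y j * s e f + y i * x j * s f e + y i * y j * s f f)" for i j
  proof -
    have "second_fundamental_form A \<xi> g D X p (b i) (b j) = - g p (S p (b i)) (b j)"
      by (rule second_fundamental_form_eq[OF b(1) b(1)])
    also have "\<dots> = - (x i * x j * s e e + x i * y j * s e f + y i * x j * s f e + y i * y j * s f f)"
      unfolding exp[of i] exp[of j]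
      using mem by (simp add: S_plus S_scale S_tangent tangent_mem g_linear s_def algebra_simps)
    finally show ?thesis .
  qed
  have gb: "g p (b i) (b j) = x i * x j + y i * y j" for i j
    unfolding exp[of i] exp[of j] using mem e(2) by (simp add: tangent_mem g_linear orth)
  have "x 1 * x 1 + y 1 * y 1 = 1" "x 2 * x 2 + y 2 * y 2 = 1" "x 1 * x 2 + y 1 * y 2 = 0"
    using gb[of 1 1] gb[of 2 2] gb[of 1 2] b(2)[of 1 1] b(2)[of 2 2] b(2)[of 1 2] by simp_all
  moreover have "(x 1 * y 2 - y 1 * x 2)\<^sup>2 =
      (x 1 * x 1 + y 1 * y 1) * (x 2 * x 2 + y 2 * y 2) - (x 1 * x 2 + y 1 * y 2)\<^sup>2"
    by (simp add: power2_eq_square algebra_simps)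
  ultimately have "(x 1 * y 2 - y 1 * x 2)\<^sup>2 = 1" by simp
  moreover have "extrinsic_curvature A \<xi> g D X p =
      (x 1 * y 2 - y 1 * x 2)\<^sup>2 * (s e e * s f f - s e f * s f e)"
    by (simp add: extrinsic_curvature_def Let_def b_def[symmetric] det_2 II power2_eq_square algebra_simps)
  ultimately show ?thesis by (simp add: f_def)
qed

text \<open>With entries \<open>s\<close> of the trace-free matrix of \<open>S\<close>, four times its determinant is
  \<open>(s(e, J e) - s(J e, e))\<^sup>2 - 4 s(e, e)\<^sup>2 - (s(e, J e) + s(J e, e))\<^sup>2\<close>, and the first square is \<open>\<theta>'\<^sup>2\<close> by
  the value of \<open>d\<alpha>(e, J e)\<close>.\<close>

lemma extrinsic_curvature_le:
  assumes e: "e \<in> \<xi> p" "g p e e = 1"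
  shows "extrinsic_curvature A \<xi> g D X p \<le> \<theta>'\<^sup>2 / 4"
proof -
  define s where "s = (\<lambda>u v. g p (S p u) v)"
  have \<theta>: "s e (J p e) - s (J p e) e = \<theta>'"
    using dalpha_J_right[OF e(1) xi_tangent[OF e(1)]] dalpha_eq[OF xi_tangent[OF e(1)] xi_tangent[OF J_xi[OF e(1)]]] e(2)
    by (simp add: s_def)
  have "s (J p e) (J p e) = - s e e" using trace_S_zero[OF e(1)] by (simp add: s_def)
  then have "4 * extrinsic_curvature A \<xi> g D X p = - 4 * (s e e)\<^sup>2 - 4 * s e (J p e) * s (J p e) e"
    using extrinsic_curvature_eq[OF e] by (simp add: s_def power2_eq_square)
  also have "\<dots> = \<theta>'\<^sup>2 - 4 * (s e e)\<^sup>2 - (s e (J p e) + s (J p e) e)\<^sup>2"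
    unfolding \<theta>[symmetric] by (simp add: power2_eq_square algebra_simps)
  finally show ?thesis using zero_le_power2[of "s e e"] zero_le_power2[of "s e (J p e) + s (J p e) e"] by linarith
qed

end

section \<open>Tensors along the flow of a vector field\<close>

locale smooth_flow = smooth_atlas A for A :: "('m::t2_space) chart set" +
  fixes X :: "'m vfield" and \<phi> :: "real \<Rightarrow> 'm \<Rightarrow> 'm"
  assumes flow: "flow_of A X \<phi>" and X_field: "vfield_on A UNIV X"
begin

lemma flow_vfield: "vfield_at A p X"
  using X_field vfield_on_iff[OF open_UNIV] by simp

lemma flow_0: "\<phi> 0 p = p"
  using flow unfolding flow_of_def by simp

lemma flow_continuous: "continuous_on UNIV (\<lambda>(t, p). \<phi> t p)"
  using flow unfolding flow_of_def by simp

lemma flow_continuous_compose: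
  assumes "continuous_on S a" "continuous_on S b"
  shows "continuous_on S (\<lambda>x. \<phi> (a x) (b x))"
  using continuous_on_compose2[OF flow_continuous continuous_on_Pair[OF assms]] by simp

lemma flow_derivative:
  "smooth_fun_at A (\<phi> t p) f \<Longrightarrow> ((\<lambda>s. f (\<phi> s p)) has_real_derivative X (\<phi> t p) f) (at t)"
  using flow[unfolded flow_of_def, THEN conjunct2, THEN conjunct2, THEN conjunct2, THEN conjunct2, rule_format] .

definition flow_chart_domain :: "'m set \<Rightarrow> ('m \<Rightarrow> real^3) \<Rightarrow> 'm set \<Rightarrow> (real \<times> (real^3)) set" where
  "flow_chart_domain U \<psi> U' = {(t, x). x \<in> \<psi> ` U \<and> \<phi> t (inv_into U \<psi> x) \<in> U'}"

lemma flow_chart_smooth: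
  "(U, \<psi>) \<in> A \<Longrightarrow> (U', \<psi>') \<in> A \<Longrightarrow>
    Cinf_on (flow_chart_domain U \<psi> U') (\<lambda>(t, x). \<psi>' (\<phi> t (inv_into U \<psi> x)))"
  using flow[unfolded flow_of_def, THEN conjunct2, THEN conjunct1, rule_format, of "(U, \<psi>)"]
  unfolding flow_chart_domain_def by auto

lemma flow_chart_domain_open:
  assumes "(U, \<psi>) \<in> A" "open V"
  shows "open (flow_chart_domain U \<psi> V)"
proof -
  have inv: "continuous_on (\<psi> ` U) (inv_into U \<psi>)"
    by (rule homeomorphism_cont2[OF chart_homeomorphism[OF assms(1)]])
  have "continuous_on (UNIV \<times> \<psi> ` U) (\<lambda>z. \<phi> (fst z) (inv_into U \<psi> (snd z)))"
    by (intro flow_continuous_compose continuous_on_fst continuous_on_id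
        continuous_on_compose2[OF inv] continuous_on_snd) auto
  then have "open ((UNIV \<times> \<psi> ` U) \<inter> (\<lambda>z. \<phi> (fst z) (inv_into U \<psi> (snd z))) -` V)"
    by (rule continuous_open_preimage) (simp_all add: open_Times chart_open_range[OF assms(1)] assms(2))
  also have "(UNIV \<times> \<psi> ` U) \<inter> (\<lambda>z. \<phi> (fst z) (inv_into U \<psi> (snd z))) -` V = flow_chart_domain U \<psi> V"
    by (auto simp: flow_chart_domain_def)
  finally show ?thesis .
qed

lemma open_flow_preimage:
  assumes "open V"
  shows "open (\<phi> t -` V)"
proof -
  have "continuous_on UNIV (\<lambda>q. \<phi> t q)"
    by (rule flow_continuous_compose[OF continuous_on_const continuous_on_id])
  from continuous_open_preimage[OF this open_UNIV assms] show ?thesis by simp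
qed

text \<open>In charts, \<open>\<phi>\<^sub>t\<close> is the restriction to a time slice of the jointly smooth flow map.\<close>

lemma smooth_compose_flow:
  assumes f: "smooth_fun_at A (\<phi> t p) f"
  shows "smooth_fun_at A p (f \<circ> \<phi> t)"
proof -
  obtain U \<psi> where U: "(U, \<psi>) \<in> A" "p \<in> U" by (rule chart_exists)
  obtain U' \<psi>' where U': "(U', \<psi>') \<in> A" "\<phi> t p \<in> U'" by (rule chart_exists)
  obtain V where V: "open V" "\<phi> t p \<in> V" "V \<subseteq> U'" "V \<subseteq> UNIV" "open (\<psi>' ` V)"
    "Cinf_on (\<psi>' ` V) (f \<circ> inv_into U' \<psi>')" "smooth_fun_on A V f"
    by (rule smooth_fun_atE[OF U' f open_UNIV UNIV_I])
  define W where "W = U \<inter> \<phi> t -` V"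
  have W: "open W" "W \<subseteq> U" "p \<in> W"
    using open_flow_preimage[OF V(1)] chart_open[OF U(1)] U(2) V(2) by (auto simp: W_def)
  have oW: "open (\<psi> ` W)" by (rule chart_open_image[OF U(1) W(1,2)])
  define G where "G = (\<lambda>(t, x). \<psi>' (\<phi> t (inv_into U \<psi> x)))"
  have inv: "inv_into U \<psi> x \<in> W" if "x \<in> \<psi> ` W" for x
    by (rule chart_inverse_image[OF U(1) W(2) that])
  have "Cinf_on (\<psi> ` W) (\<lambda>x. (t, x))"
  proof -
    have "Cinf_on (\<psi> ` W) (\<lambda>x. (t, 0) + (0, x))"
      by (intro Cinf_on_add[OF oW] Cinf_on_const[OF oW] Cinf_on_bounded_linear[OF oW])
        (intro bounded_linear_Pair bounded_linear_zero bounded_linear_ident)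
    then show ?thesis by simp
  qed
  moreover have "Cinf_on (flow_chart_domain U \<psi> V) G"
    unfolding G_def
    by (rule Cinf_on_subset[OF flow_chart_smooth[OF U(1) U'(1)]]) (use V(3) in \<open>auto simp: flow_chart_domain_def\<close>)
  moreover have "Pair t ` \<psi> ` W \<subseteq> flow_chart_domain U \<psi> V"
    using inv W(2) by (auto simp: flow_chart_domain_def W_def chart_inverse[OF U(1)])
  ultimately have 1: "Cinf_on (\<psi> ` W) (\<lambda>x. G (t, x))"
    using Cinf_on_compose[OF oW flow_chart_domain_open[OF U(1) V(1)], of "Pair t" G] by simp
  have "(\<lambda>x. G (t, x)) ` \<psi> ` W \<subseteq> \<psi>' ` V"
    by (auto simp: G_def W_def chart_inverse[OF U(1)])
  from Cinf_on_compose[OF oW V(5) this 1 V(6)]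
  have "Cinf_on (\<psi> ` W) (\<lambda>x. (f \<circ> inv_into U' \<psi>') (G (t, x)))" .
  moreover have "(f \<circ> inv_into U' \<psi>') (G (t, x)) = ((f \<circ> \<phi> t) \<circ> inv_into U \<psi>) x" if "x \<in> \<psi> ` W" for x
    using inv[OF that] V(3) chart_inverse[OF U'(1)] by (auto simp: G_def W_def)
  ultimately have "Cinf_on (\<psi> ` W) ((f \<circ> \<phi> t) \<circ> inv_into U \<psi>)"
    using Cinf_on_cong[OF oW, of "\<lambda>x. (f \<circ> inv_into U' \<psi>') (G (t, x))"] by simp
  then show ?thesis by (rule smooth_fun_atI[OF U(1) W])
qed

lemma pushforward_tangent:
  assumes v: "v \<in> tangent A p"
  shows "pushforward A (\<phi> t) p v \<in> tangent A (\<phi> t p)"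
proof (rule tangentI)
  fix f g assume sm: "smooth_fun_at A (\<phi> t p) f" "smooth_fun_at A (\<phi> t p) g"
  note smp = sm[THEN smooth_compose_flow]
  show "pushforward A (\<phi> t) p v (\<lambda>q. f q + g q) = pushforward A (\<phi> t) p v f + pushforward A (\<phi> t) p v g"
    using sm tangent_add[OF v smp] by (simp add: pushforward_def smooth_fun_at_plus o_def)
  show "pushforward A (\<phi> t) p v (\<lambda>q. f q * g q) =
      pushforward A (\<phi> t) p v f * g (\<phi> t p) + f (\<phi> t p) * pushforward A (\<phi> t) p v g"
    using sm tangent_mult[OF v smp] by (simp add: pushforward_def smooth_fun_at_mult o_def)
  show "pushforward A (\<phi> t) p v (\<lambda>q. c * f q) = c * pushforward A (\<phi> t) p v f" for c
    using sm tangent_cmult[OF v smp(1), where c = c] by (simp add: pushforward_def smooth_fun_at_cmult o_def)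
  show "pushforward A (\<phi> t) p v f = pushforward A (\<phi> t) p v g" if eq: "\<forall>\<^sub>F q in nhds (\<phi> t p). f q = g q"
  proof -
    obtain V where V: "open V" "\<phi> t p \<in> V" "\<And>q. q \<in> V \<Longrightarrow> f q = g q"
      using eq unfolding eventually_nhds by auto
    have "\<forall>\<^sub>F q in nhds p. (f \<circ> \<phi> t) q = (g \<circ> \<phi> t) q"
      unfolding eventually_nhds using open_flow_preimage[OF V(1), of t] V(2,3)
      by (intro exI[of _ "\<phi> t -` V"]) auto
    then show ?thesis using tangent_cong[OF v] sm by (simp add: pushforward_def)
  qed
qed (simp add: pushforward_def)

lemma flow_eventually_in:
  assumes "open V" "p \<in> V"
  shows "\<forall>\<^sub>F t in nhds 0. \<phi> t p \<in> V"
proof -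
  have "continuous_on UNIV (\<lambda>t. \<phi> t p)"
    by (rule flow_continuous_compose[OF continuous_on_id continuous_on_const])
  from continuous_open_preimage[OF this open_UNIV assms(1)] have "open ((\<lambda>t. \<phi> t p) -` V)"
    by simp
  then show ?thesis unfolding eventually_nhds
    by (intro exI[of _ "(\<lambda>t. \<phi> t p) -` V"]) (simp add: flow_0 assms(2))
qed

lemma pushforward_0:
  assumes "v \<in> tangent A p"
  shows "pushforward A (\<phi> 0) p v = v"
proof
  fix f :: "'m \<Rightarrow> real"
  have "f \<circ> \<phi> 0 = f" by (simp add: fun_eq_iff flow_0)
  then show "pushforward A (\<phi> 0) p v f = v f"
    using tangent_nonsmooth[OF assms] by (simp add: pushforward_def flow_0)
qed

text \<open>In a chart, the components of the push-forward of \<open>v\<close> are space derivatives of the flow, and \<open>X\<close> is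
  the time derivative of the flow; the equation is the symmetry of mixed partial derivatives.\<close>

lemma pushforward_component_derivative:
  assumes U: "(U, \<psi>) \<in> A" "p \<in> U" and v: "v \<in> tangent A p"
  shows "((\<lambda>t. pushforward A (\<phi> t) p v (\<lambda>q. \<psi> q $ i)) has_real_derivative v (\<lambda>q. X q (\<lambda>r. \<psi> r $ i))) (at 0)"
proof -
  define O' where "O' = flow_chart_domain U \<psi> U"
  define G where "G z = \<psi> (\<phi> (fst z) (inv_into U \<psi> (snd z))) $ i" for z
  define e where "e = chart_vector \<psi> v"
  define x0 where "x0 = \<psi> p"
  have O': "open O'" unfolding O'_def by (rule flow_chart_domain_open[OF U(1) chart_open[OF U(1)]])
  have G: "Cinf_on O' G"
  proof -
    have "Cinf_on O' (\<lambda>z. (case z of (t, x) \<Rightarrow> \<psi> (\<phi> t (inv_into U \<psi> x))) $ i)"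
      using flow_chart_smooth[OF U(1) U(1)] unfolding O'_def[symmetric] Cinf_on_def
      by (auto intro: Ck_on_bounded_linear_compose[OF O' bounded_linear_vec_nth])
    then show ?thesis unfolding G_def split_beta .
  qed
  have dom: "(t, \<psi> q) \<in> O'" if "q \<in> U" "\<phi> t q \<in> U" for t q
    using that chart_inverse[OF U(1)] by (auto simp: O'_def flow_chart_domain_def)
  have near: "\<forall>\<^sub>F t in nhds 0. \<phi> t p \<in> U" by (rule flow_eventually_in[OF chart_open[OF U(1)] U(2)])
  have slice: "((\<lambda>x. H (t, x)) has_derivative (\<lambda>y. frechet_derivative H (at (t, x)) (0, y))) (at x)"
    if "Cinf_on O' H" "(t, x) \<in> O'" for H :: "real \<times> (real^3) \<Rightarrow> real" and t x
    by (rule has_derivative_compose[where g = H and f = "\<lambda>x. (t, x)" and f' = "\<lambda>y. (0, y)"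
          and g' = "frechet_derivative H (at (t, x))"])
      (auto intro!: derivative_eq_intros Cinf_on_has_derivative[OF that])
  have slice_t: "((\<lambda>t. H (t, x)) has_real_derivative frechet_derivative H (at (t, x)) (1, 0)) (at t)"
    if "Cinf_on O' H" "(t, x) \<in> O'" for H :: "real \<times> (real^3) \<Rightarrow> real" and t x
  proof -
    note d = Cinf_on_has_derivative[OF that]
    have "((\<lambda>t. H (t, x)) has_derivative (\<lambda>y. frechet_derivative H (at (t, x)) (y, 0))) (at t)"
      by (rule has_derivative_compose[where g = H and f = "\<lambda>t. (t, x)" and f' = "\<lambda>y. (y, 0)"
          and g' = "frechet_derivative H (at (t, x))"]) (auto intro!: derivative_eq_intros d)
    moreover have "(\<lambda>y. frechet_derivative H (at (t, x)) (y, 0)) = (*) (frechet_derivative H (at (t, x)) (1, 0))"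
    proof
      show "frechet_derivative H (at (t, x)) (y, 0) = frechet_derivative H (at (t, x)) (1, 0) * y" for y
        using linear_scale[OF has_derivative_linear[OF d], of y "(1, 0)"] by (simp add: mult.commute)
    qed
    ultimately show ?thesis by (simp only: has_field_derivative_def)
  qed
  define Ge where "Ge z = frechet_derivative G (at z) (0, e)" for z
  define Gt where "Gt z = frechet_derivative G (at z) (1, 0)" for z
  have Ge: "Cinf_on O' Ge" and Gt: "Cinf_on O' Gt"
    unfolding Ge_def Gt_def by (rule Cinf_on_frechet_derivative[OF O' G])+
  have "pushforward A (\<phi> t) p v (\<lambda>q. \<psi> q $ i) = Ge (t, x0)" if t: "\<phi> t p \<in> U" for t
  proof -
    note sm = smooth_fun_at_coordinate[OF U(1) t, of i]
    have "pushforward A (\<phi> t) p v (\<lambda>q. \<psi> q $ i) = v ((\<lambda>q. \<psi> q $ i) \<circ> \<phi> t)"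
      using sm by (simp add: pushforward_def)
    also have "\<dots> = frechet_derivative (((\<lambda>q. \<psi> q $ i) \<circ> \<phi> t) \<circ> inv_into U \<psi>) (at x0) e"
      unfolding x0_def e_def by (rule chart_vector_derivative[OF U v smooth_compose_flow[OF sm]])
    also have "((\<lambda>q. \<psi> q $ i) \<circ> \<phi> t) \<circ> inv_into U \<psi> = (\<lambda>x. G (t, x))"
      by (auto simp: G_def)
    also have "frechet_derivative (\<lambda>x. G (t, x)) (at x0) e = Ge (t, x0)"
      using frechet_derivative_at[OF slice[OF G dom[OF U(2) t]]] by (simp add: Ge_def x0_def fun_eq_iff)
    finally show ?thesis .
  qed
  then have comp: "\<forall>\<^sub>F t in nhds 0. pushforward A (\<phi> t) p v (\<lambda>q. \<psi> q $ i) = Ge (t, x0)"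
    using near by (auto elim: eventually_mono)
  have dom0: "(0, \<psi> q) \<in> O'" if "q \<in> U" for q using dom[of q 0] that by (simp add: flow_0)
  have Xi: "X q (\<lambda>r. \<psi> r $ i) = Gt (0, \<psi> q)" if q: "q \<in> U" for q
  proof -
    have "((\<lambda>s. \<psi> (\<phi> s q) $ i) has_real_derivative X q (\<lambda>r. \<psi> r $ i)) (at 0)"
      using flow_derivative[of 0 q "\<lambda>r. \<psi> r $ i"] smooth_fun_at_coordinate[OF U(1) q] by (simp add: flow_0)
    moreover have "((\<lambda>s. \<psi> (\<phi> s q) $ i) has_real_derivative Gt (0, \<psi> q)) (at 0)"
      using slice_t[OF G dom0[OF q]] chart_inverse[OF U(1) q] by (simp add: G_def Gt_def)
    ultimately show ?thesis by (rule DERIV_unique)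
  qed
  have "v (\<lambda>q. X q (\<lambda>r. \<psi> r $ i)) =
      frechet_derivative ((\<lambda>q. X q (\<lambda>r. \<psi> r $ i)) \<circ> inv_into U \<psi>) (at x0) e"
    unfolding x0_def e_def
    by (rule chart_vector_derivative[OF U v vfield_at_smooth[OF flow_vfield smooth_fun_at_coordinate[OF U]]])
  also have "frechet_derivative ((\<lambda>q. X q (\<lambda>r. \<psi> r $ i)) \<circ> inv_into U \<psi>) (at x0) =
      frechet_derivative (\<lambda>x. Gt (0, x)) (at x0)"
    by (rule frechet_derivative_cong_open[OF chart_open_range[OF U(1)]])
      (use U chart_inverse[OF U(1)] Xi in \<open>auto simp: x0_def\<close>)
  also have "frechet_derivative (\<lambda>x. Gt (0, x)) (at x0) e = frechet_derivative Gt (at (0, x0)) (0, e)"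
    using frechet_derivative_at[OF slice[OF Gt dom0[OF U(2)]]] by (simp add: x0_def fun_eq_iff)
  also have "\<dots> = frechet_derivative Ge (at (0, x0)) (1, 0)"
    unfolding Gt_def Ge_def using mixed_derivatives_commute[OF O' dom0[OF U(2)] G] by (simp add: x0_def)
  finally have "((\<lambda>t. Ge (t, x0)) has_real_derivative v (\<lambda>q. X q (\<lambda>r. \<psi> r $ i))) (at 0)"
    using slice_t[OF Ge dom0[OF U(2)]] by (simp add: x0_def)
  then show ?thesis
    using DERIV_cong_ev[OF refl comp refl] by simp
qed

text \<open>Along the flow line, \<open>V\<close> and the push-forward of \<open>V p\<close> differ to first order by the bracket \<open>[V, X]\<close>:
  in a chart the components of the push-forward have derivative \<open>V p (X \<psi>\<^sub>i)\<close> at time 0, those of \<open>V\<close>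
  have derivative \<open>X p (V \<psi>\<^sub>i)\<close>. The product rule for the coordinate expression of the bilinear
  form \<open>b\<close> turns this difference into the two bracket terms.\<close>

lemma tensor_along_flow_derivative:
  fixes b :: "'m \<Rightarrow> 'm tvec \<Rightarrow> 'm tvec \<Rightarrow> real"
  assumes left: "\<And>q u v w c. u \<in> tangent A q \<Longrightarrow> v \<in> tangent A q \<Longrightarrow> w \<in> tangent A q \<Longrightarrow>
      b q (u + v) w = b q u w + b q v w \<and> b q (scalev c u) w = c * b q u w"
    and right: "\<And>q u v w c. u \<in> tangent A q \<Longrightarrow> v \<in> tangent A q \<Longrightarrow> w \<in> tangent A q \<Longrightarrow>
      b q w (u + v) = b q w u + b q w v \<and> b q w (scalev c u) = c * b q w u"
    and smooth: "\<And>q Y Z. vfield_at A q Y \<Longrightarrow> vfield_at A q Z \<Longrightarrow> smooth_fun_at A q (\<lambda>r. b r (Y r) (Z r))"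
    and V: "vfield_at A p V"
  defines "v \<equiv> \<lambda>t. pushforward A (\<phi> t) p (V p)"
  shows "((\<lambda>t. b (\<phi> t p) (v t) (v t)) has_real_derivative
    X p (\<lambda>q. b q (V q) (V q)) + b p (bracket A V X p) (V p) + b p (V p) (bracket A V X p)) (at 0)"
proof -
  obtain U \<psi> where U: "(U, \<psi>) \<in> A" "p \<in> U" by (rule chart_exists)
  define E where "E = coord_field U \<psi>"
  define B where "B i j = (\<lambda>q. b q (E i q) (E j q))" for i j
  define c where "c q u i = u (\<lambda>r. \<psi> r $ i)" for q :: 'm and u :: "'m tvec" and i
  note Vp = vfield_at_tangent[OF V] and Xp = vfield_at_tangent[OF flow_vfield]
  have E: "E i q \<in> tangent A q" if "q \<in> U" for i q
    unfolding E_def by (rule coord_field_tangent[OF U(1) that])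
  have zl: "b q 0 w = 0" "b q w 0 = 0" if "w \<in> tangent A q" for q w
    using left[OF tangent_zero_mem tangent_zero_mem that, of 0] right[OF tangent_zero_mem tangent_zero_mem that, of 0]
    by simp_all
  have suml: "b q (\<Sum>i\<in>I. u i) w = (\<Sum>i\<in>I. b q (u i) w)"
    if "\<And>i. u i \<in> tangent A q" "w \<in> tangent A q" for q I w and u :: "3 \<Rightarrow> 'm tvec"
  proof -
    have "finite I" by simp
    then show ?thesis
    proof (induction I rule: finite_induct)
      case empty
      then show ?case by (simp only: sum.empty zl[OF that(2)])
    next
      case (insert i I)
      show ?case
        unfolding sum.insert[OF insert.hyps] insert.IH[symmetric]
        using left[OF that(1) tangent_sum_mem[of I u, OF that(1)] that(2)] by blast
    qed
  qed
  have sumr: "b q w (\<Sum>i\<in>I. u i) = (\<Sum>i\<in>I. b q w (u i))"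
    if "\<And>i. u i \<in> tangent A q" "w \<in> tangent A q" for q I w and u :: "3 \<Rightarrow> 'm tvec"
  proof -
    have "finite I" by simp
    then show ?thesis
    proof (induction I rule: finite_induct)
      case empty
      then show ?case by (simp only: sum.empty zl[OF that(2)])
    next
      case (insert i I)
      show ?case
        unfolding sum.insert[OF insert.hyps] insert.IH[symmetric]
        using right[OF that(1) tangent_sum_mem[of I u, OF that(1)] that(2)] by blast
    qed
  qed
  have exp: "b q u w = (\<Sum>i\<in>UNIV. \<Sum>j\<in>UNIV. u (\<lambda>r. \<psi> r $ i) * w (\<lambda>r. \<psi> r $ j) * B i j q)"
    if q: "q \<in> U" and u: "u \<in> tangent A q" and w: "w \<in> tangent A q" for q u w
  proof -
    have sE: "scalev k (E i q) \<in> tangent A q" for k i by (rule tangent_scalev_mem[OF E[OF q]])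
    have "b q u w = b q (\<Sum>i\<in>UNIV. scalev (u (\<lambda>r. \<psi> r $ i)) (E i q)) (\<Sum>j\<in>UNIV. scalev (w (\<lambda>r. \<psi> r $ j)) (E j q))"
      by (rule arg_cong2[where f = "b q", OF tangent_expansion[OF U(1) q u, folded E_def]
            tangent_expansion[OF U(1) q w, folded E_def]])
    also have "\<dots> = (\<Sum>i\<in>UNIV. b q (scalev (u (\<lambda>r. \<psi> r $ i)) (E i q)) (\<Sum>j\<in>UNIV. scalev (w (\<lambda>r. \<psi> r $ j)) (E j q)))"
      by (rule suml[OF sE tangent_sum_mem[OF sE]])
    also have "\<dots> = (\<Sum>i\<in>UNIV. \<Sum>j\<in>UNIV. b q (scalev (u (\<lambda>r. \<psi> r $ i)) (E i q)) (scalev (w (\<lambda>r. \<psi> r $ j)) (E j q)))"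
      by (intro sum.cong refl sumr[OF sE sE])
    also have "\<dots> = (\<Sum>i\<in>UNIV. \<Sum>j\<in>UNIV. u (\<lambda>r. \<psi> r $ i) * w (\<lambda>r. \<psi> r $ j) * B i j q)"
    proof (intro sum.cong refl)
      fix i j
      have 1: "b q (scalev (u (\<lambda>r. \<psi> r $ i)) (E i q)) (scalev (w (\<lambda>r. \<psi> r $ j)) (E j q)) =
          u (\<lambda>r. \<psi> r $ i) * b q (E i q) (scalev (w (\<lambda>r. \<psi> r $ j)) (E j q))"
        using left[OF E[OF q] E[OF q] sE] by blast
      have 2: "b q (E i q) (scalev (w (\<lambda>r. \<psi> r $ j)) (E j q)) = w (\<lambda>r. \<psi> r $ j) * b q (E i q) (E j q)"
        using right[OF E[OF q] E[OF q] E[OF q]] by blast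
      show "b q (scalev (u (\<lambda>r. \<psi> r $ i)) (E i q)) (scalev (w (\<lambda>r. \<psi> r $ j)) (E j q)) =
          u (\<lambda>r. \<psi> r $ i) * w (\<lambda>r. \<psi> r $ j) * B i j q"
        unfolding 1 2 B_def by (rule mult.assoc[symmetric])
    qed
    finally show ?thesis .
  qed
  have vT: "v t \<in> tangent A (\<phi> t p)" for t unfolding v_def by (rule pushforward_tangent[OF Vp])
  have v0: "v 0 = V p" unfolding v_def by (rule pushforward_0[OF Vp])
  have smB: "smooth_fun_at A p (B i j)" for i j
    unfolding B_def E_def by (rule smooth) (rule vfield_at_coord_field[OF U])+
  define f where "f i = (\<lambda>q. V q (\<lambda>r. \<psi> r $ i))" for i
  have smf: "smooth_fun_at A p (f i)" for i
    unfolding f_def by (rule vfield_at_smooth[OF V smooth_fun_at_coordinate[OF U]])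
  define \<gamma> where "\<gamma> i t = v t (\<lambda>q. \<psi> q $ i)" for i t
  have \<gamma>0: "\<gamma> i 0 = f i p" for i by (simp add: \<gamma>_def f_def v0)
  have d\<gamma>: "(\<gamma> i has_real_derivative V p (\<lambda>q. X q (\<lambda>r. \<psi> r $ i))) (at 0)" for i
    unfolding \<gamma>_def v_def by (rule pushforward_component_derivative[OF U Vp])
  have dB: "((\<lambda>t. B i j (\<phi> t p)) has_real_derivative X p (B i j)) (at 0)" for i j
    using flow_derivative[of 0 p "B i j"] smB by (simp add: flow_0)
  define w where "w i = V p (\<lambda>q. X q (\<lambda>r. \<psi> r $ i)) - X p (f i)" for i
  have brw: "bracket A V X p (\<lambda>r. \<psi> r $ i) = w i" for i
    by (simp add: bracket_apply[OF smooth_fun_at_coordinate[OF U]] w_def f_def)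
  have der: "((\<lambda>t. \<Sum>i\<in>UNIV. \<Sum>j\<in>UNIV. \<gamma> i t * \<gamma> j t * B i j (\<phi> t p)) has_real_derivative
      (\<Sum>i\<in>UNIV. \<Sum>j\<in>UNIV. ((w i + X p (f i)) * f j p + f i p * (w j + X p (f j))) * B i j p + f i p * f j p * X p (B i j))) (at 0)"
  proof (intro DERIV_sum)
    fix i j
    show "((\<lambda>t. \<gamma> i t * \<gamma> j t * B i j (\<phi> t p)) has_real_derivative
      ((w i + X p (f i)) * f j p + f i p * (w j + X p (f j))) * B i j p + f i p * f j p * X p (B i j)) (at 0)"
      by (rule derivative_eq_intros d\<gamma> dB | simp add: \<gamma>0 w_def flow_0)+
  qed
  have "\<forall>\<^sub>F t in nhds 0. (\<Sum>i\<in>UNIV. \<Sum>j\<in>UNIV. \<gamma> i t * \<gamma> j t * B i j (\<phi> t p)) = b (\<phi> t p) (v t) (v t)"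
    using flow_eventually_in[OF chart_open[OF U(1)] U(2)]
    by eventually_elim (simp add: exp vT \<gamma>_def)
  from DERIV_cong_ev[OF refl this refl] der
  have "((\<lambda>t. b (\<phi> t p) (v t) (v t)) has_real_derivative
      (\<Sum>i\<in>UNIV. \<Sum>j\<in>UNIV. ((w i + X p (f i)) * f j p + f i p * (w j + X p (f j))) * B i j p + f i p * f j p * X p (B i j))) (at 0)"
    by simp
  moreover have "X p (\<lambda>q. b q (V q) (V q)) =
      (\<Sum>i\<in>UNIV. \<Sum>j\<in>UNIV. (X p (f i) * f j p + f i p * X p (f j)) * B i j p + f i p * f j p * X p (B i j))"
  proof -
    have "\<forall>\<^sub>F q in nhds p. b q (V q) (V q) = (\<Sum>i\<in>UNIV. \<Sum>j\<in>UNIV. f i q * f j q * B i j q)"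
      using eventually_nhds_in_open[OF chart_open[OF U(1)] U(2)] vfield_at_tangent_eventually[OF V]
      by eventually_elim (simp add: exp f_def)
    then have "X p (\<lambda>q. b q (V q) (V q)) = X p (\<lambda>q. \<Sum>i\<in>UNIV. \<Sum>j\<in>UNIV. f i q * f j q * B i j q)"
      by (rule tangent_cong[OF Xp])
    also have "\<dots> = (\<Sum>i\<in>UNIV. \<Sum>j\<in>UNIV. X p (\<lambda>q. f i q * f j q * B i j q))"
      by (simp add: tangent_sum[OF Xp] smooth_fun_at_sum smooth_fun_at_mult smf smB)
    also have "\<dots> = (\<Sum>i\<in>UNIV. \<Sum>j\<in>UNIV. (X p (f i) * f j p + f i p * X p (f j)) * B i j p + f i p * f j p * X p (B i j))"
      by (simp add: tangent_mult[OF Xp] smooth_fun_at_mult smf smB)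
    finally show ?thesis .
  qed
  moreover have "b p (bracket A V X p) (V p) = (\<Sum>i\<in>UNIV. \<Sum>j\<in>UNIV. w i * f j p * B i j p)"
    using exp[OF U(2) bracket_tangent[OF V flow_vfield] Vp] by (simp add: brw f_def)
  moreover have "b p (V p) (bracket A V X p) = (\<Sum>i\<in>UNIV. \<Sum>j\<in>UNIV. f i p * w j * B i j p)"
    using exp[OF U(2) Vp bracket_tangent[OF V flow_vfield]] by (simp add: brw f_def)
  ultimately show ?thesis by (simp add: sum.distrib[symmetric] algebra_simps)
qed

end

section \<open>Sectional curvature and the normalized Jacobi field\<close>

context compatible_contact
begin

text \<open>With \<open>N\<close> and \<open>B\<close> the values of \<open>g(v, v)\<close> and \<open>g(v, S v)\<close> on the Jacobi field \<open>v\<close>, the function \<open>h\<close> is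
  the quotient of \<open>B\<close> by \<open>N\<close>, and both are differentiated by the preceding formula for tensors along the
  flow.\<close>

lemma sectional_X_eq_flow_derivative:
  assumes flow: "flow_of A X \<phi>" and e: "e \<in> \<xi> p" "g p e e = 1"
  defines "h \<equiv> \<lambda>t. g (\<phi> t p) (unit_jacobi_field A g \<phi> p e t) (D (\<phi> t p) (unit_jacobi_field A g \<phi> p e t) X)"
  shows "(h has_real_derivative
    (g p (J p e) (D p e X))\<^sup>2 - (g p e (D p e X))\<^sup>2 - sectional A g D p e (X p)) (at 0)"
proof -
  interpret smooth_flow A X \<phi>
    using flow reeb by unfold_locales (simp_all add: reeb_field_def)
  note eT = xi_tangent[OF e(1)]
  define V where "V = ext A p e"
  have V: "vfield_at A p V" "V p = e" using ext_spec[OF eT] by (simp_all add: V_def)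
  define v where "v t = pushforward A (\<phi> t) p e" for t
  have vT: "v t \<in> T (\<phi> t p)" for t unfolding v_def by (rule pushforward_tangent[OF eT])
  have v0: "v 0 = e" unfolding v_def by (rule pushforward_0[OF eT])
  define N where "N t = g (\<phi> t p) (v t) (v t)" for t
  define B where "B t = g (\<phi> t p) (v t) (S (\<phi> t p) (v t))" for t
  define w where "w = bracket A V X p"
  have wT: "w \<in> T p" unfolding w_def by (rule bracket_tangent[OF V(1) X_vfield])
  have DV: "D p (X p) V \<in> T p" by (rule D_tangent[OF X_tangent V(1)])
  have w: "w = S p e - D p (X p) V" using bracket_section_X[OF V(1)] by (simp add: w_def V(2))
  have "(N has_real_derivative X p (\<lambda>q. g q (V q) (V q)) + g p w e + g p e w) (at 0)"
    unfolding N_def v_def w_def V(2)[symmetric]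
    by (rule tensor_along_flow_derivative)
      ((intro conjI; simp only: g_linear tangent_mem)+, rule g_smooth, assumption+, rule V(1))
  moreover have "X p (\<lambda>q. g q (V q) (V q)) + g p w e + g p e w = 2 * g p (S p e) e"
    using X_norm_sq[OF V(1)] g_sym[OF eT wT] DV eT unfolding w V(2) by (simp add: g_diff_left S_tangent)
  ultimately have dN: "(N has_real_derivative 2 * g p (S p e) e) (at 0)" by simp
  have dB: "(B has_real_derivative X p (\<lambda>q. g q (V q) (S q (V q))) + g p w (S p e) + g p e (S p w)) (at 0)"
    unfolding B_def v_def w_def V(2)[symmetric]
    by (rule tensor_along_flow_derivative[where b = "\<lambda>q u v. g q u (S q v)"])
      ((intro conjI; simp only: g_linear tangent_mem S_plus S_scale S_tangent)+,
        rule g_smooth, assumption, rule S_vfield, assumption, rule V(1))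
  have h: "h = (\<lambda>t. B t / N t)"
  proof
    fix t
    let ?k = "1 / sqrt (N t)"
    have "h t = g (\<phi> t p) (scalev ?k (v t)) (S (\<phi> t p) (scalev ?k (v t)))"
      by (simp add: h_def unit_jacobi_field_def jacobi_field_def gnorm_def v_def N_def S_def)
    also have "\<dots> = ?k * (?k * B t)"
      using vT by (simp add: S_scale g_scale_left g_scale_right S_tangent tangent_mem B_def)
    also have "\<dots> = B t / N t" using g_nonneg[OF vT[of t]] by (simp add: N_def)
    finally show "h t = B t / N t" .
  qed
  have N0: "N 0 = 1" and B0: "B 0 = g p e (S p e)" by (simp_all add: N_def B_def v0 flow_0 e(2))
  define B' where "B' = X p (\<lambda>q. g q (V q) (S q (V q))) + g p w (S p e) + g p e (S p w)"
  have "((\<lambda>t. B t / N t) has_real_derivative B' - g p e (S p e) * (2 * g p (S p e) e)) (at 0)"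
    using DERIV_divide[OF dB dN] by (simp add: N0 B0 B'_def)
  then have dh: "(h has_real_derivative B' - 2 * (g p e (S p e))\<^sup>2) (at 0)"
    unfolding h using g_sym[OF eT S_tangent[OF eT]] by (simp add: power2_eq_square mult.left_commute)
  have "sectional A g D p e (X p) = - X p (\<lambda>q. g q (S q (V q)) (V q)) + g p (S p e) (D p (X p) V) - g p (S p w) e"
    using sectional_X[OF e V] g_curvature_X[OF V(1)] by (simp add: V(2) w_def)
  moreover have "D p (X p) V = S p e - w" by (simp add: w)
  moreover have "X p (\<lambda>q. g q (S q (V q)) (V q)) = X p (\<lambda>q. g q (V q) (S q (V q)))"
  proof (rule tangent_cong[OF X_tangent])
    show "\<forall>\<^sub>F q in nhds p. g q (S q (V q)) (V q) = g q (V q) (S q (V q))"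
      using vfield_at_tangent_eventually[OF V(1)] by eventually_elim (simp add: g_sym S_tangent)
  qed
  ultimately have "sectional A g D p e (X p) = g p (S p e) (S p e) - B'"
    using g_sym[OF wT S_tangent[OF eT]] g_sym[OF eT S_tangent[OF wT]] wT eT
    by (simp add: B'_def g_diff_right S_tangent)
  moreover have "g p (S p e) (S p e) = (g p e (S p e))\<^sup>2 + (g p (J p e) (S p e))\<^sup>2"
    using xi_Parseval[OF e S_xi[OF eT] S_tangent[OF eT]] g_sym[OF eT S_tangent[OF eT]]
      g_sym[OF xi_tangent[OF J_xi[OF e(1)]] S_tangent[OF eT]]
    by (simp add: power2_eq_square)
  ultimately have "B' - 2 * (g p e (S p e))\<^sup>2 =
      (g p (J p e) (S p e))\<^sup>2 - (g p e (S p e))\<^sup>2 - sectional A g D p e (X p)"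
    by simp
  with dh show ?thesis by (simp only: S_def)
qed

end

theorem theorem1p14:
  fixes A :: "('m::t2_space) chart set"
    and \<xi> :: "'m \<Rightarrow> 'm tvec set"
    and g :: "'m metric"
    and \<alpha> :: "'m form1"
    and J :: "'m \<Rightarrow> 'm tvec \<Rightarrow> 'm tvec"
    and \<theta>' :: real
    and X :: "'m vfield"
    and D :: "'m connection"
    and \<phi> :: "real \<Rightarrow> 'm \<Rightarrow> 'm"
    and p :: 'm
    and e :: "'m tvec"
  assumes "closed_connected_oriented_3manifold A"
    and "contact_structure A \<xi>"
    and "compatible_metric A \<xi> g \<alpha> J \<theta>' X"
    and "levi_civita A g D"
    and "flow_of A X \<phi>"
    and "e \<in> \<xi> p"
    and "gnorm g p e = 1"
  shows "let h = (\<lambda>t. g (\<phi> t p) (unit_jacobi_field A g \<phi> p e t)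
                          (D (\<phi> t p) (unit_jacobi_field A g \<phi> p e t) X));
             Ric = sectional A g D p e (X p) + sectional A g D p (J p e) (X p)
         in h differentiable (at 0) \<and>
            sectional A g D p e (X p) =
              (g p (J p e) (D p e X))\<^sup>2 - (g p e (D p e X))\<^sup>2 - deriv h 0 \<and>
            Ric = 2 * extrinsic_curvature A \<xi> g D X p \<and>
            2 * extrinsic_curvature A \<xi> g D X p \<le> \<theta>'\<^sup>2 / 2"
proof -
  interpret compatible_contact A \<xi> g \<alpha> J \<theta>' X D
    using assms(1,3,4) by unfold_locales (simp_all add: closed_connected_oriented_3manifold_def)
  have e: "e \<in> \<xi> p" "g p e e = 1" using assms(6,7) by (simp_all add: gnorm_def)
  note h = sectional_X_eq_flow_derivative[OF assms(5) e]
  show ?thesis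
    unfolding Let_def
    using h[THEN real_differentiable_def[THEN iffD2, OF exI]] DERIV_imp_deriv[OF h] Reeb_Ricci[OF e] extrinsic_curvature_eq[OF e]
      extrinsic_curvature_le[OF e] by simp
qed

end
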